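(* Let $m,n\ge 1$ be integers, $0<\lambda<mn$, $\vec p=(p_1,\ldots,p_m)$ with $1\le p_i\le\infty$ for $1\le i\le m$, and $0<q\le\infty$. For measurable $f$ on $\mathbb R^{mn}$ let $$J_\lambda f(x)=\int_{\mathbb R^{mn}}\frac{f(y_1,\ldots,y_m)}{(|x-y_1|+\cdots+|x-y_m|)^\lambda}\,dy_1\cdots dy_m,\qquad x\in\mathbb R^n .$$ Then the norm estimate $$\|J_\lambda f\|_{L^q}\lesssim\|f\|_{L^{\vec p}},\qquad\forall f\in L^{\vec p}(\mathbb R^{mn}),$$ is true if and only if both of the following hold: (i) $\displaystyle\frac1{p_1}+\cdots+\frac1{p_m}=\frac1q+\frac{mn-\lambda}{n}$; (ii) there is some $1\le i\le m$ such that $1<p_i<\infty$; and, setting $i_0=\max\{i:\ p_i>1,\ 1\le i\le m\}$, one has $p_{i_0}\le q<\infty$ (if $i_0<m$) or $p_m<q<\infty$ (if $i_0=m$).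
   Context: For $\vec p=(p_1,\ldots,p_m)$, the mixed-norm Lebesgue space $L^{\vec p}(\mathbb R^{mn})$ consists of all measurable $f(y_1,\ldots,y_m)$, $y_i\in\mathbb R^n$, with $\|f\|_{L^{\vec p}}:=\big\|\,\|f\|_{L^{p_1}_{y_1}}\cdots\big\|_{L^{p_m}_{y_m}}<\infty$ (the $L^{p_1}$ norm in $y_1$ is innermost, the $L^{p_m}$ norm in $y_m$ outermost). $X\lesssim Y$ means $X\le CY$ with a constant $C$ independent of $f$. Convention: $1/\infty=0$. *)

theory Defs
  imports "HOL-Probability.Essential_Supremum"
begin

definition ennpowr :: "ennreal \<Rightarrow> real \<Rightarrow> ennreal"  (infixr "ennpowr" 80) where
  "x ennpowr r = (if x = \<infinity> then \<infinity> else ennreal (enn2real x powr r))"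
  (* only used with r > 0, hence the value at infinity *)

definition Lp_norm :: "'a measure \<Rightarrow> ennreal \<Rightarrow> ('a \<Rightarrow> ennreal) \<Rightarrow> ennreal" where
  "Lp_norm M p g =
    (if p = \<infinity> then esssup M g
     else (\<integral>\<^sup>+ x. g x ennpowr enn2real p \<partial>M) ennpowr (1 / enn2real p))"

text \<open>
  A point \<open>(y\<^sub>1, \<dots>, y\<^sub>m)\<close> with \<open>y\<^sub>i \<in> \<real>\<^sup>n\<close> is a function on the index set \<open>{1..m}\<close> that takes
  the value \<open>undefined\<close> elsewhere. The completed product measure is Lebesgue measure
  on \<open>\<real>\<^sup>m\<^sup>n\<close>, so that measurable means Lebesgue measurable.
\<close>

definition lebesgue_tuple :: "nat \<Rightarrow> (nat \<Rightarrow> 'a::euclidean_space) measure" where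
  "lebesgue_tuple m = completion (Pi\<^sub>M {1..m} (\<lambda>_. lborel))"

text \<open>
  \<open>iterated_norm p k F y\<close> takes the norms in the variables \<open>1, \<dots>, k\<close> of \<open>F\<close>, the first one
  innermost, and is a function of the remaining entries of \<open>y\<close>. For \<open>k = m\<close> no
  variable is left and \<open>y\<close> only supplies the value \<open>undefined\<close> outside \<open>{1..m}\<close>.
\<close>

primrec iterated_norm ::
  "(nat \<Rightarrow> ennreal) \<Rightarrow> nat \<Rightarrow> ((nat \<Rightarrow> 'a::euclidean_space) \<Rightarrow> ennreal) \<Rightarrow> (nat \<Rightarrow> 'a) \<Rightarrow> ennreal"
where
  "iterated_norm p 0 F y = F y"
| "iterated_norm p (Suc k) F y =
    Lp_norm lebesgue (p (Suc k)) (\<lambda>t. iterated_norm p k F (y(Suc k := t)))"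

definition mixed_norm ::
  "nat \<Rightarrow> (nat \<Rightarrow> ennreal) \<Rightarrow> ((nat \<Rightarrow> 'a::euclidean_space) \<Rightarrow> complex) \<Rightarrow> ennreal" where
  "mixed_norm m p f = iterated_norm p m (\<lambda>y. ennreal (norm (f y))) (\<lambda>_. undefined)"

definition mixed_Lebesgue ::
  "nat \<Rightarrow> (nat \<Rightarrow> ennreal) \<Rightarrow> ((nat \<Rightarrow> 'a::euclidean_space) \<Rightarrow> complex) set" where
  "mixed_Lebesgue m p =
    {f. f \<in> borel_measurable (lebesgue_tuple m) \<and> mixed_norm m p f < \<infinity>}"

definition J_integrand ::
  "nat \<Rightarrow> real \<Rightarrow> ((nat \<Rightarrow> 'a::euclidean_space) \<Rightarrow> complex) \<Rightarrow> 'a \<Rightarrow> (nat \<Rightarrow> 'a) \<Rightarrow> complex" where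
  "J_integrand m lam f x y = f y / complex_of_real ((\<Sum>i=1..m. norm (x - y i)) powr lam)"

definition J ::
  "nat \<Rightarrow> real \<Rightarrow> ((nat \<Rightarrow> 'a::euclidean_space) \<Rightarrow> complex) \<Rightarrow> 'a \<Rightarrow> complex" where
  "J m lam f x = (\<integral>y. J_integrand m lam f x y \<partial>lebesgue_tuple m)"

text \<open>
  The Bochner integral of a function that is not integrable is \<open>0\<close>. The norm estimate therefore
  has to say that the integral defining \<open>J m lam f x\<close> converges absolutely for almost
  every \<open>x\<close>; for \<open>f \<ge> 0\<close> this is the finiteness almost everywhere of an integral with values
  in \<open>[0, \<infinity>]\<close>, which the bound on its norm contains.
\<close>

definition J_norm_estimate ::
  "'a::euclidean_space itself \<Rightarrow> nat \<Rightarrow> real \<Rightarrow> (nat \<Rightarrow> ennreal) \<Rightarrow> ennreal \<Rightarrow> bool" where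
  "J_norm_estimate _ m lam p q \<longleftrightarrow>
    (\<exists>C::real. \<forall>f :: (nat \<Rightarrow> 'a) \<Rightarrow> complex. f \<in> mixed_Lebesgue m p \<longrightarrow>
      (AE x in lebesgue. integrable (lebesgue_tuple m) (J_integrand m lam f x)) \<and>
      Lp_norm lebesgue q (\<lambda>x. ennreal (norm (J m lam f x))) \<le> ennreal C * mixed_norm m p f)"

end

theory Submission
  imports Defs "HOL-Real_Asymp.Real_Asymp"
begin

text \<open>
  Sufficiency. Hoelder's inequality in the innermost variable \<open>y\<^sub>1\<close> replaces the kernel
  \<open>(|x - y\<^sub>1| + \<dots>) powr - \<lambda>\<close> by a power of \<open>|x - y\<^sub>2| + \<dots>\<close> with exponent reduced by \<open>n (1 - 1 / p\<^sub>1)\<close>, and this can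
  be repeated until only \<open>y\<^sub>i\<close> with \<open>i \<ge> i\<^sub>0\<close> are left. The variables after \<open>i\<^sub>0\<close> carry \<open>L\<^sup>1\<close> norms and are frozen by
  Minkowski's inequality. What remains is an operator in the single variable \<open>y\<^bsub>i\<^sub>0\<^esub>\<close>: a fractional
  integral if \<open>p\<^bsub>i\<^sub>0\<^esub> < q\<close>, and a Hardy operator with kernel \<open>(|x - a| + |y - a|) powr - n\<close>, where \<open>a = y\<^sub>m\<close>, if
  \<open>p\<^bsub>i\<^sub>0\<^esub> = q\<close>.

  Necessity. Indicator functions of balls of radius \<open>R\<close> force the scaling relation. For the rest one
  superposes the extremal profiles of all scales between \<open>1\<close> and \<open>R\<close>: the norm of such a function grows like
  \<open>(ln R) powr (1 / p\<^bsub>i\<^sub>0\<^esub>)\<close>, that of its image at least like \<open>(ln R) powr (1 / q)\<close>, and like \<open>ln R\<close> if \<open>q = \<infinity>\<close>. To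
  exclude \<open>p\<^sub>m = q\<close> the same profile in \<open>y\<^sub>1, \<dots>, y\<^bsub>m - 1\<^esub>\<close> is centred at \<open>y\<^sub>m\<close>, which ranges over a large ball.
\<close>

section \<open>Powers and norms of extended nonnegative functions\<close>

text \<open>The exponent of the kernel decides where Hoelder's inequality has to stop. By the
  scaling relation, \<open>k\<close> Hoelder steps leave the exponent
  \<open>n / q + n * (\<Sum>i=Suc k..m. 1 - 1 / p i)\<close>, which is positive because
  \<open>q\<close> is finite. Just before \<open>i0\<close> it is
  \<open>n / q + n * (1 - 1 / p i0)\<close>; one more step would leave a power of degree
  \<open>- n / q\<close>, and such powers barely fail to lie in \<open>L^q\<close>. A genuine
  one-variable inequality is needed there. The logarithmic test functions compare powers of
  \<open>ln R\<close>, so each of them yields an inequality between reciprocals: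
  \<open>1 / q \<le> 1 / p i0\<close>, or \<open>1 \<le> 1 / p i0\<close> for infinite
  \<open>q\<close>. If all \<open>p i\<close> are \<open>1\<close>, the same argument without a
  shell gives \<open>1 / q \<le> 0\<close>; scaling then forces \<open>lam = 0\<close>, so
  \<open>i0\<close> exists. In both directions the complex operator is exchanged for an integral
  with values in [0, \<infinity>], and Lebesgue measurable functions for Borel representatives, on
  which Tonelli's theorem acts.\<close>

lemma ennpowr_top [simp]: "top ennpowr r = top"
  by (simp add: ennpowr_def)

lemma ennpowr_ennreal: "0 \<le> x \<Longrightarrow> ennreal x ennpowr r = ennreal (x powr r)"
  by (simp add: ennpowr_def)

lemma ennpowr_0 [simp]: "0 ennpowr r = 0"
  by (simp add: ennpowr_def)

lemma ennpowr_one_left [simp]: "1 ennpowr r = 1"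
  by (simp add: ennpowr_def)

lemma ennpowr_one [simp]: "x ennpowr 1 = x"
  by (cases x) (simp_all add: ennpowr_ennreal)

lemma ennpowr_eq_0_iff [simp]: "x ennpowr r = 0 \<longleftrightarrow> x = 0"
  by (cases x) (auto simp: ennpowr_ennreal)

lemma ennpowr_eq_top_iff [simp]: "x ennpowr r = top \<longleftrightarrow> x = top"
  by (cases x) (auto simp: ennpowr_ennreal)

lemma ennpowr_less_top_iff [simp]: "x ennpowr r < top \<longleftrightarrow> x < top"
  by (simp add: less_top[symmetric])

text \<open>\<open>0\<close> and \<open>top\<close> are fixed by every power, whatever the sign of
  the exponent. Hence this law and the next two hold without side conditions, also where
  \<open>top * 0 = 0\<close> occurs.\<close>

lemma ennpowr_mult: "(x * y) ennpowr r = x ennpowr r * y ennpowr r"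
proof (cases "x = top \<or> y = top")
  case True
  then show ?thesis
    by (cases "x = 0"; cases "y = 0") (auto simp: ennreal_mult_top ennreal_top_mult)
next
  case False
  then show ?thesis
    by (cases x; cases y) (auto simp: ennpowr_ennreal ennreal_mult'[symmetric] powr_mult)
qed

lemma ennpowr_ennpowr: "(x ennpowr a) ennpowr b = x ennpowr (a * b)"
  by (cases x) (auto simp: ennpowr_ennreal powr_powr)

lemma ennpowr_add: "x ennpowr (a + b) = x ennpowr a * x ennpowr b"
  by (cases x) (auto simp: ennpowr_ennreal ennreal_mult'[symmetric] powr_add)

lemma ennpowr_mono: "x \<le> y \<Longrightarrow> 0 \<le> r \<Longrightarrow> x ennpowr r \<le> y ennpowr r"
  by (cases x; cases y) (auto simp: ennpowr_ennreal powr_mono2 top_unique)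

lemma ennpowr_inverse_cancel:
  assumes "r \<noteq> 0"
  shows "(x ennpowr r) ennpowr (1 / r) = x" "(x ennpowr (1 / r)) ennpowr r = x"
  using assms by (simp_all add: ennpowr_ennpowr)

lemma ennpowr_le_iff:
  assumes "0 < r" shows "x ennpowr r \<le> y ennpowr r \<longleftrightarrow> x \<le> y"
  using ennpowr_mono[of x y r] ennpowr_mono[of "x ennpowr r" "y ennpowr r" "1 / r"] assms
  by (auto simp: ennpowr_ennpowr)

lemma ennpowr_inverse_le_iff:
  assumes "0 < r" shows "x ennpowr (1 / r) \<le> y \<longleftrightarrow> x \<le> y ennpowr r"
  using ennpowr_le_iff[of r "x ennpowr (1/r)" y] assms by (simp add: ennpowr_ennpowr)

lemma ennpowr_measurable [measurable]:
  assumes [measurable]: "f \<in> borel_measurable M"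
  shows "(\<lambda>x. f x ennpowr r) \<in> borel_measurable M"
  unfolding ennpowr_def by measurable

lemma ennpowr_indicator:
  "(c * indicator S x) ennpowr r = c ennpowr r * indicator S x"
  by (auto split: split_indicator)

section \<open>Hoelder's inequality in [0, \<infinity>]\<close>

abbreviation recip :: "ennreal \<Rightarrow> real" where
  "recip p \<equiv> enn2real (1 / p)"

text \<open>For \<open>p = top\<close> both sides are \<open>0\<close>, the right one because real
  division by \<open>0\<close> gives \<open>0\<close>; formulas in \<open>recip p\<close> thus cover
  infinite exponents.\<close>

lemma enn2real_one_divide: "0 < p \<Longrightarrow> recip p = 1 / enn2real p"
  by (cases p) (auto simp: divide_ennreal ennreal_1[symmetric] simp del: ennreal_1)

lemma conjugate_exponent_gt_one:
  fixes p r :: real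
  assumes "1 < p" "1 / p + 1 / r = 1"
  shows "1 < r"
  using assms
  by (smt (verit, best) divide_less_eq_1_pos divide_pos_pos divide_nonpos_nonneg frac_le less_divide_eq_1_pos zero_less_divide_iff)

lemma young_ennreal:
  fixes x y :: ennreal and p :: real
  assumes "1 < p" "1 / p + 1 / r = 1"
  shows "x * y \<le> ennreal (1 / p) * x ennpowr p + ennreal (1 / r) * y ennpowr r"
proof -
  have r: "1 < r" using assms by (rule conjugate_exponent_gt_one)
  show ?thesis
  proof (cases "x = top \<or> y = top")
    case True
    then show ?thesis using assms r by (auto simp: ennreal_mult_top)
  next
    case False
    then obtain a b where ab: "x = ennreal a" "y = ennreal b" "0 \<le> a" "0 \<le> b"
      by (cases x; cases y) auto
    have "a * b \<le> a powr p / p + b powr r / r"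
      using Youngs_inequality[of p r a b] assms r ab by simp
    then show ?thesis
      using ab assms r
      by (auto simp: ennpowr_ennreal ennreal_mult'[symmetric] ennreal_plus[symmetric] simp del: ennreal_plus)
  qed
qed

text \<open>Integrate Young's inequality for factors scaled to norm one. A vanishing or infinite
  norm cannot be scaled and is treated first.\<close>

lemma Hoelder_nn_integral:
  fixes f g :: "'a \<Rightarrow> ennreal"
  assumes p: "1 < p" "1 / p + 1 / r = 1"
    and [measurable]: "f \<in> borel_measurable M" "g \<in> borel_measurable M"
  shows "(\<integral>\<^sup>+x. f x * g x \<partial>M) \<le>
    (\<integral>\<^sup>+x. f x ennpowr p \<partial>M) ennpowr (1 / p) * (\<integral>\<^sup>+x. g x ennpowr r \<partial>M) ennpowr (1 / r)"
    (is "?I \<le> ?A ennpowr _ * ?B ennpowr _")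
proof -
  have r: "1 < r" using p by (rule conjugate_exponent_gt_one)
  consider "?A = 0" | "?B = 0" | "?A \<noteq> 0" "?B \<noteq> 0" "?A = top \<or> ?B = top"
    | "?A \<noteq> 0" "?B \<noteq> 0" "?A < top" "?B < top"
    by (metis less_top)
  then show ?thesis
  proof cases
    case 1
    then have "AE x in M. f x = 0" by (subst (asm) nn_integral_0_iff_AE) auto
    then have "?I = 0" by (subst nn_integral_0_iff_AE) auto
    then show ?thesis by simp
  next
    case 2
    then have "AE x in M. g x = 0" by (subst (asm) nn_integral_0_iff_AE) auto
    then have "?I = 0" by (subst nn_integral_0_iff_AE) auto
    then show ?thesis by simp
  next
    case 3
    then show ?thesis by (auto simp: ennreal_mult_top ennreal_top_mult)
  next
    case 4
    then obtain a b where ab: "?A = ennreal a" "?B = ennreal b" "0 < a" "0 < b"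
      by (cases ?A; cases ?B) (auto simp: less_le)
    define c where "c = ennreal (a powr (-1/p))"
    define d where "d = ennreal (b powr (-1/r))"
    have cA: "c ennpowr p * ?A = 1" "d ennpowr r * ?B = 1"
    proof -
      have "(a powr (-1/p)) powr p = 1 / a" "(b powr (-1/r)) powr r = 1 / b"
        using ab p r by (simp_all only: powr_powr) (auto simp: powr_minus_divide)
      then show "c ennpowr p * ?A = 1" "d ennpowr r * ?B = 1"
        using ab by (simp_all only: c_def d_def) (simp_all add: ennpowr_ennreal ennreal_mult'[symmetric])
    qed
    have "c * d * ?I = (\<integral>\<^sup>+x. (c * f x) * (d * g x) \<partial>M)"
      by (subst nn_integral_cmult[symmetric]) (auto simp: ac_simps)
    also have "\<dots> \<le> (\<integral>\<^sup>+x. ennreal (1/p) * (c * f x) ennpowr p + ennreal (1/r) * (d * g x) ennpowr r \<partial>M)"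
      by (intro nn_integral_mono young_ennreal p)
    also have "\<dots> = ennreal (1/p) * (c ennpowr p * ?A) + ennreal (1/r) * (d ennpowr r * ?B)"
      by (simp add: ennpowr_mult nn_integral_add nn_integral_cmult)
    also have "\<dots> = 1"
      using p r by (simp add: cA ennreal_plus[symmetric] del: ennreal_plus)
    finally have *: "c * d * ?I \<le> 1" .
    have "?I = ?A ennpowr (1/p) * ?B ennpowr (1/r) * (c * d * ?I)"
    proof -
      have "?A ennpowr (1/p) * c = 1" "?B ennpowr (1/r) * d = 1"
        using ab by (auto simp: c_def d_def ennpowr_ennreal ennreal_mult'[symmetric] powr_add[symmetric])
      then have "?A ennpowr (1/p) * c * (?B ennpowr (1/r) * d) * ?I = ?I" by simp
      then show ?thesis by (simp add: ac_simps)
    qed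
    also have "\<dots> \<le> ?A ennpowr (1/p) * ?B ennpowr (1/r) * 1"
      by (intro mult_left_mono *) auto
    finally show ?thesis by simp
  qed
qed

text \<open>Completeness is the point: the preimages under \<open>f\<close> and \<open>g\<close>
  differ inside a null set, all of whose subsets are measurable in the completion.\<close>

lemma borel_measurable_AE_cong_completion:
  assumes "f \<in> borel_measurable (completion M)" "AE x in completion M. f x = g x"
  shows "g \<in> borel_measurable (completion M)"
proof -
  obtain N where N: "N \<in> null_sets (completion M)" "{x \<in> space M. f x \<noteq> g x} \<subseteq> N"
    using assms(2) unfolding eventually_ae_filter by auto
  have "g -` A \<inter> space (completion M) \<in> sets (completion M)" if A: "A \<in> sets borel" for A
  proof -
    have "g -` A \<inter> space M = (f -` A \<inter> space M - N) \<union> (g -` A \<inter> space M \<inter> N)"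
      using N(2) by auto
    moreover have "f -` A \<inter> space M \<in> sets (completion M)"
      using measurable_sets[OF assms(1) A] by simp
    moreover have "g -` A \<inter> space M \<inter> N \<in> sets (completion M)"
      using N(1) by (meson Int_lower2 completion.complete2 null_setsD2)
    ultimately have "g -` A \<inter> space M \<in> sets (completion M)"
      using N(1) by (metis null_setsD2 sets.Diff sets.Un)
    then show ?thesis by simp
  qed
  then show ?thesis by (auto simp: measurable_def)
qed

text \<open>The case \<open>p = top\<close> is the delicate one because \<open>esssup\<close> of a
  non-measurable function is \<open>top\<close>; on a complete space \<open>f\<close> and
  \<open>g\<close> are measurable or non-measurable together.\<close>

lemma Lp_norm_AE_cong:
  assumes "AE x in completion M. f x = g x"
  shows "Lp_norm (completion M) p f = Lp_norm (completion M) p g"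
proof -
  have "(\<integral>\<^sup>+x. f x ennpowr r \<partial>completion M) = (\<integral>\<^sup>+x. g x ennpowr r \<partial>completion M)" for r
    by (intro nn_integral_cong_AE) (use assms in auto)
  moreover have "esssup (completion M) f = esssup (completion M) g"
  proof (cases "f \<in> borel_measurable (completion M)")
    case True
    show ?thesis
      by (rule esssup_AE_cong[OF True borel_measurable_AE_cong_completion[OF True assms] assms])
  next
    case False
    have "AE x in completion M. g x = f x" using assms by eventually_elim simp
    then have "g \<notin> borel_measurable (completion M)"
      using borel_measurable_AE_cong_completion[of g M f] False by auto
    then show ?thesis using False by (simp add: esssup_non_measurable)
  qed
  ultimately show ?thesis by (simp add: Lp_norm_def)
qed

section \<open>Integrals of radial powers\<close>

lemma nn_integral_FTC_einterval:
  fixes f F :: "real \<Rightarrow> real" and a b :: ereal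
  assumes "a < b"
    and "\<And>x. a < ereal x \<Longrightarrow> ereal x < b \<Longrightarrow> DERIV F x :> f x"
    and "\<And>x. a < ereal x \<Longrightarrow> ereal x < b \<Longrightarrow> isCont f x"
    and nn: "\<And>x. a < ereal x \<Longrightarrow> ereal x < b \<Longrightarrow> 0 \<le> f x"
    and "((F \<circ> real_of_ereal) \<longlongrightarrow> A) (at_right a)"
    and "((F \<circ> real_of_ereal) \<longlongrightarrow> B) (at_left b)"
  shows "(\<integral>\<^sup>+x. ennreal (f x) * indicator (einterval a b) x \<partial>lborel) = ennreal (B - A)"
proof -
  have "AE x in lborel. a < ereal x \<longrightarrow> ereal x < b \<longrightarrow> 0 \<le> f x" using nn by auto
  note I = interval_integral_FTC_nonneg[OF assms(1-3) this assms(5,6)]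
  have "(\<integral>\<^sup>+x. ennreal (f x) * indicator (einterval a b) x \<partial>lborel)
      = (\<integral>\<^sup>+x. ennreal (indicator (einterval a b) x *\<^sub>R f x) \<partial>lborel)"
    by (intro nn_integral_cong) (auto split: split_indicator)
  also have "\<dots> = ennreal (LINT x|lborel. indicator (einterval a b) x *\<^sub>R f x)"
    using I(1) nn unfolding set_integrable_def
    by (intro nn_integral_eq_integral AE_I2) (auto split: split_indicator simp: einterval_def)
  also have "\<dots> = ennreal (B - A)"
    using I(2) \<open>a < b\<close> by (simp add: interval_lebesgue_integral_def set_lebesgue_integral_def less_imp_le)
  finally show ?thesis .
qed

lemma nn_integral_powr_Ioo:
  assumes "0 < b" "0 < u"
  shows "(\<integral>\<^sup>+x. ennreal (b * x powr (b - 1)) * indicator {0<..<u} x \<partial>lborel) = ennreal (u powr b)"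
proof -
  have *: "((\<lambda>x. x powr b) \<longlongrightarrow> 0) (at_right 0)"
    using assms by real_asymp
  have "(\<integral>\<^sup>+x. ennreal (b * x powr (b - 1)) * indicator (einterval (ereal 0) (ereal u)) x \<partial>lborel) = ennreal (u powr b - 0)"
    using assms *
    by (intro nn_integral_FTC_einterval)
       (auto intro!: derivative_eq_intros continuous_intros tendsto_intros
             simp: ereal_tendsto_simps field_simps)
  then show ?thesis by simp
qed

lemma nn_integral_powr_Ioi:
  assumes "0 < b" "0 < u"
  shows "(\<integral>\<^sup>+x. ennreal (b * x powr (- b - 1)) * indicator {u<..} x \<partial>lborel) = ennreal (u powr - b)"
proof -
  have *: "((\<lambda>x. - (x powr - b)) \<longlongrightarrow> 0) at_top"
    using assms by real_asymp
  have "(\<integral>\<^sup>+x. ennreal (b * x powr (- b - 1)) * indicator (einterval (ereal u) \<infinity>) x \<partial>lborel) = ennreal (0 - - (u powr - b))"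
    using assms *
    by (intro nn_integral_FTC_einterval[where F="\<lambda>x. - (x powr -b)"])
       (auto intro!: derivative_eq_intros continuous_intros tendsto_intros
             simp: ereal_tendsto_simps field_simps)
  then show ?thesis by simp
qed

lemma nn_integral_inverse_Ico:
  assumes "0 < u" "u \<le> v"
  shows "(\<integral>\<^sup>+x. ennreal (1 / x) * indicator {u..<v} x \<partial>lborel) = ennreal (ln (v / u))"
proof -
  have "(\<integral>\<^sup>+x. ennreal (1 / x) * indicator {u..<v} x \<partial>lborel) = (\<integral>\<^sup>+x. ennreal (1 / x) * indicator {u..v} x \<partial>lborel)"
    by (intro nn_integral_cong_AE) (use AE_lborel_singleton[of v] in \<open>auto split: split_indicator elim!: eventually_mono\<close>)
  also have "\<dots> = ennreal (ln v - ln u)"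
    using assms by (intro nn_integral_FTC_Icc) (auto intro!: derivative_eq_intros)
  finally show ?thesis using assms by (simp add: ln_div)
qed

text \<open>A measure on the line is determined by its values on half-lines. On \<open>{..r}\<close>
  both sides give the volume \<open>V * r ^ n\<close> of a ball, and the density is its derivative
  in \<open>r\<close>. This takes the place of polar coordinates.\<close>

lemma distr_norm_lborel:
  "distr (lborel :: 'a::euclidean_space measure) borel norm =
    density lborel (\<lambda>r. ennreal (DIM('a) * unit_ball_vol DIM('a) * r powr (DIM('a) - 1)) * indicator {0<..} r)"
    (is "?M = density lborel ?d")
proof (rule measure_eqI_generator_eq)
  let ?n = "DIM('a)" and ?V = "unit_ball_vol DIM('a)"
  have npos: "0 < ?n" by simp
  show "Int_stable (range atMost :: real set set)"
    proof (rule Int_stableI)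
    fix A B :: "real set" assume "A \<in> range atMost" "B \<in> range atMost"
    then obtain a b where "A = {..a}" "B = {..b}" by auto
    then have "A \<inter> B = {..min a b}" by auto
    then show "A \<inter> B \<in> range atMost" by auto
  qed
  fix X :: "real set" assume "X \<in> range atMost"
  then obtain r where X: "X = {..r}" by auto
  have M: "emeasure ?M {..r} = emeasure lborel (cball (0::'a) r)"
    by (subst emeasure_distr) (auto intro!: arg_cong[where f="emeasure _"])
  show "emeasure ?M X = emeasure (density lborel ?d) X"
  proof (cases "0 < r")
    case True
    have "emeasure (density lborel ?d) {..r} = (\<integral>\<^sup>+x. ?d x * indicator {..r} x \<partial>lborel)"
      by (subst emeasure_density) auto
    also have "\<dots> = (\<integral>\<^sup>+x. ennreal ?V * (ennreal (?n * x powr (?n - 1)) * indicator {0<..<r} x) \<partial>lborel)"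
      using AE_lborel_singleton[of r]
      by (intro nn_integral_cong_AE)
         (auto elim!: eventually_mono split: split_indicator simp: ennreal_mult'[symmetric] ac_simps)
    also have "\<dots> = ennreal (?V * r ^ ?n)"
      using nn_integral_powr_Ioo[of ?n r] True
      by (subst nn_integral_cmult) (auto simp: ennreal_mult' powr_realpow)
    finally show ?thesis using True by (simp add: X M emeasure_cball)
  next
    case False
    then have "emeasure (density lborel ?d) {..r} = 0"
      by (subst emeasure_density, simp, simp, subst nn_integral_0_iff_AE) (auto split: split_indicator)
    moreover have "emeasure lborel (cball (0::'a) r) = 0"
      using False by (cases "r = 0") auto
    ultimately show ?thesis by (simp add: X M)
  qed
next
  show "range (\<lambda>i::nat. {..real i}) \<subseteq> range atMost" by auto
  show "(\<Union>i::nat. {..real i}) = UNIV" by (auto intro: real_arch_simple)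
  show "emeasure ?M {..real i} \<noteq> \<infinity>" for i
  proof -
    have "emeasure ?M {..real i} = emeasure lborel (cball (0::'a) i)"
      by (subst emeasure_distr) (auto intro!: arg_cong[where f="emeasure _"])
    then show ?thesis by (simp add: emeasure_cball)
  qed
qed (simp_all add: borel_eq_atMost)

lemma nn_integral_radial:
  fixes g :: "real \<Rightarrow> ennreal"
  assumes [measurable]: "g \<in> borel_measurable borel"
  shows "(\<integral>\<^sup>+x. g (norm x) \<partial>(lborel :: 'a::euclidean_space measure)) =
    ennreal (DIM('a) * unit_ball_vol DIM('a)) * (\<integral>\<^sup>+r. g r * ennreal (r powr (DIM('a) - 1)) * indicator {0<..} r \<partial>lborel)"
proof -
  have "(\<integral>\<^sup>+x. g (norm x) \<partial>(lborel :: 'a measure)) = (\<integral>\<^sup>+r. g r \<partial>distr (lborel :: 'a measure) borel norm)"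
    by (subst nn_integral_distr) auto
  also have "\<dots> = (\<integral>\<^sup>+r. ennreal (DIM('a) * unit_ball_vol DIM('a) * r powr (DIM('a) - 1)) * indicator {0<..} r * g r \<partial>lborel)"
    unfolding distr_norm_lborel by (subst nn_integral_density) auto
  also have "\<dots> = (\<integral>\<^sup>+r. ennreal (DIM('a) * unit_ball_vol DIM('a)) * (g r * ennreal (r powr (DIM('a) - 1)) * indicator {0<..} r) \<partial>lborel)"
    by (intro nn_integral_cong) (auto simp: ennreal_mult' ac_simps)
  finally show ?thesis by (simp add: nn_integral_cmult)
qed

text \<open>
  The value \<open>\<infinity>\<close> at \<open>0\<close> makes the kernel antitone on \<open>[0, \<infinity>)\<close>, so that the pointwise bounds below
  need no exception on the diagonal.
\<close>

definition kern :: "real \<Rightarrow> real \<Rightarrow> ennreal" where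
  "kern a s = (if s = 0 then top else ennreal (s powr - a))"

lemma kern_measurable [measurable]:
  assumes [measurable]: "f \<in> borel_measurable M"
  shows "(\<lambda>x. kern a (f x)) \<in> borel_measurable M"
  unfolding kern_def by measurable

lemma kern_pos: "0 < s \<Longrightarrow> kern a s = ennreal (s powr - a)"
  by (simp add: kern_def)

lemma kern_mono: "0 \<le> a \<Longrightarrow> 0 \<le> s \<Longrightarrow> s \<le> t \<Longrightarrow> kern a t \<le> kern a s"
  by (auto simp: kern_def intro!: ennreal_leI powr_mono2')

lemma kern_ennpowr: "0 \<le> s \<Longrightarrow> kern a s ennpowr b = kern (a * b) s"
  by (auto simp: kern_def ennpowr_ennreal powr_powr)

lemma kern_mult: "0 < s \<Longrightarrow> kern a s * kern b s = kern (a + b) s"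
  by (auto simp: kern_def ennreal_mult'[symmetric] powr_add[symmetric])

abbreviation Lpow :: "real \<Rightarrow> ('a::euclidean_space \<Rightarrow> ennreal) \<Rightarrow> ennreal" where
  "Lpow r f \<equiv> \<integral>\<^sup>+x. f x ennpowr r \<partial>lborel"

abbreviation riesz :: "real \<Rightarrow> ('a::euclidean_space \<Rightarrow> ennreal) \<Rightarrow> 'a \<Rightarrow> ennreal" where
  "riesz a f x \<equiv> \<integral>\<^sup>+t. f t * kern a (norm (x - t)) \<partial>lborel"

abbreviation shifted_riesz :: "real \<Rightarrow> real \<Rightarrow> ('a::euclidean_space \<Rightarrow> ennreal) \<Rightarrow> 'a \<Rightarrow> ennreal" where
  "shifted_riesz a s f x \<equiv> \<integral>\<^sup>+t. f t * kern a (norm (x - t) + s) \<partial>lborel"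

lemma nn_integral_kern_ball:
  fixes a :: real
  assumes a: "a < DIM('a::euclidean_space)" and R: "0 < R"
  shows "(\<integral>\<^sup>+x. kern a (norm (x - c)) * indicator {x. norm (x - c) < R} x \<partial>(lborel :: 'a measure)) =
    ennreal (DIM('a) * unit_ball_vol DIM('a) / (DIM('a) - a) * R powr (DIM('a) - a))"
proof -
  let ?n = "real DIM('a)" and ?V = "unit_ball_vol DIM('a)"
  have "(\<integral>\<^sup>+x. kern a (norm (x - c)) * indicator {x. norm (x - c) < R} x \<partial>(lborel :: 'a measure)) =
    (\<integral>\<^sup>+x. kern a (norm x) * indicator {..<R} (norm x) \<partial>(lborel :: 'a measure))"
    by (subst lborel_distr_plus[of "-c", symmetric], subst nn_integral_distr) (auto split: split_indicator intro!: nn_integral_cong)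
  also have "\<dots> = ennreal (?n * ?V) * (\<integral>\<^sup>+r. kern a r * indicator {..<R} r * ennreal (r powr (?n - 1)) * indicator {0<..} r \<partial>lborel)"
    using nn_integral_radial[where 'a='a and g="\<lambda>r. kern a r * indicator {..<R} r"] by simp
  also have "\<dots> = ennreal (?n * ?V) * (\<integral>\<^sup>+r. ennreal (1 / (?n - a)) * (ennreal ((?n - a) * r powr (?n - a - 1)) * indicator {0<..<R} r) \<partial>lborel)"
  proof -
    have "kern a r * indicator {..<R} r * ennreal (r powr (?n - 1)) * indicator {0<..} r =
      ennreal (1 / (?n - a)) * (ennreal ((?n - a) * r powr (?n - a - 1)) * indicator {0<..<R} r)" for r
    proof (cases "0 < r \<and> r < R")
      case True
      have "r powr - a * r powr (?n - 1) = r powr (?n - a - 1)"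
        by (subst powr_add[symmetric]) (simp add: algebra_simps)
      also have "\<dots> = 1 / (?n - a) * ((?n - a) * r powr (?n - a - 1))"
        using a by simp
      finally have "r powr - a * r powr (?n - 1) = 1 / (?n - a) * ((?n - a) * r powr (?n - a - 1))" .
      then show ?thesis using True a by (simp add: kern_pos ennreal_mult'[symmetric])
    qed auto
    then show ?thesis by simp
  qed
  also have "\<dots> = ennreal (?n * ?V) * (ennreal (1 / (?n - a)) * ennreal (R powr (?n - a)))"
    using a R by (subst nn_integral_cmult) (auto simp: nn_integral_powr_Ioo)
  finally show ?thesis using a by (simp add: ennreal_mult'[symmetric])
qed

lemma nn_integral_kern_compl_ball:
  fixes a :: real
  assumes a: "DIM('a::euclidean_space) < a" and R: "0 < R"
  shows "(\<integral>\<^sup>+x. kern a (norm (x - c)) * indicator {x. R \<le> norm (x - c)} x \<partial>(lborel :: 'a measure)) =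
    ennreal (DIM('a) * unit_ball_vol DIM('a) / (a - DIM('a)) * R powr (DIM('a) - a))"
proof -
  let ?n = "real DIM('a)" and ?V = "unit_ball_vol DIM('a)"
  have "(\<integral>\<^sup>+x. kern a (norm (x - c)) * indicator {x. R \<le> norm (x - c)} x \<partial>(lborel :: 'a measure)) =
    (\<integral>\<^sup>+x. kern a (norm x) * indicator {R..} (norm x) \<partial>(lborel :: 'a measure))"
    by (subst lborel_distr_plus[of "-c", symmetric], subst nn_integral_distr) (auto split: split_indicator intro!: nn_integral_cong)
  also have "\<dots> = ennreal (?n * ?V) * (\<integral>\<^sup>+r. kern a r * indicator {R..} r * ennreal (r powr (?n - 1)) * indicator {0<..} r \<partial>lborel)"
    using nn_integral_radial[where 'a='a and g="\<lambda>r. kern a r * indicator {R..} r"] by simp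
  also have "\<dots> = ennreal (?n * ?V) * (\<integral>\<^sup>+r. ennreal (1 / (a - ?n)) * (ennreal ((a - ?n) * r powr (- (a - ?n) - 1)) * indicator {R<..} r) \<partial>lborel)"
  proof -
    have *: "kern a r * indicator {R..} r * ennreal (r powr (?n - 1)) * indicator {0<..} r =
      ennreal (1 / (a - ?n)) * (ennreal ((a - ?n) * r powr (- (a - ?n) - 1)) * indicator {R<..} r)" if "r \<noteq> R" for r
    proof (cases "R < r")
      case True
      have "r powr - a * r powr (?n - 1) = r powr (- (a - ?n) - 1)"
        by (subst powr_add[symmetric]) (simp add: algebra_simps)
      also have "\<dots> = 1 / (a - ?n) * ((a - ?n) * r powr (- (a - ?n) - 1))"
        using a by simp
      finally have "r powr - a * r powr (?n - 1) = 1 / (a - ?n) * ((a - ?n) * r powr (- (a - ?n) - 1))" .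
      then show ?thesis using True R a by (simp add: kern_pos ennreal_mult'[symmetric])
    qed (use that in auto)
    show ?thesis
      by (intro arg_cong2[where f="(*)"] refl nn_integral_cong_AE)
         (use AE_lborel_singleton[of R] * in \<open>auto elim!: eventually_mono\<close>)
  qed
  also have "\<dots> = ennreal (?n * ?V) * (ennreal (1 / (a - ?n)) * ennreal (R powr - (a - ?n)))"
    using nn_integral_powr_Ioi[of "a - ?n" R] a R by (subst nn_integral_cmult) auto
  finally show ?thesis using a by (simp add: ennreal_mult'[symmetric])
qed

text \<open>At the critical exponent \<open>n\<close> all dyadic shells have equal mass; the
  logarithms of the necessity part originate here.\<close>

lemma nn_integral_kern_annulus:
  assumes R: "0 < u" "u \<le> v"
  shows "(\<integral>\<^sup>+x. kern DIM('a) (norm (x - c)) * indicator {x. u \<le> norm (x - c) \<and> norm (x - c) < v} x \<partial>(lborel :: 'a::euclidean_space measure)) =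
    ennreal (DIM('a) * unit_ball_vol DIM('a) * ln (v / u))"
proof -
  let ?n = "real DIM('a)" and ?V = "unit_ball_vol DIM('a)"
  have "(\<integral>\<^sup>+x. kern ?n (norm (x - c)) * indicator {x. u \<le> norm (x - c) \<and> norm (x - c) < v} x \<partial>(lborel :: 'a measure)) =
    (\<integral>\<^sup>+x. kern ?n (norm x) * indicator {u..<v} (norm x) \<partial>(lborel :: 'a measure))"
    by (subst lborel_distr_plus[of "-c", symmetric], subst nn_integral_distr) (auto split: split_indicator intro!: nn_integral_cong)
  also have "\<dots> = ennreal (?n * ?V) * (\<integral>\<^sup>+r. kern ?n r * indicator {u..<v} r * ennreal (r powr (?n - 1)) * indicator {0<..} r \<partial>lborel)"
    using nn_integral_radial[where 'a='a and g="\<lambda>r. kern ?n r * indicator {u..<v} r"] by simp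
  also have "\<dots> = ennreal (?n * ?V) * (\<integral>\<^sup>+r. ennreal (1 / r) * indicator {u..<v} r \<partial>lborel)"
  proof -
    have "kern ?n r * indicator {u..<v} r * ennreal (r powr (?n - 1)) * indicator {0<..} r =
      ennreal (1 / r) * indicator {u..<v} r" for r
    proof (cases "u \<le> r \<and> r < v")
      case True
      then have "0 < r" using R by simp
      then have "r powr - ?n * r powr (?n - 1) = 1 / r"
        by (subst powr_add[symmetric]) (simp add: powr_minus_divide)
      then show ?thesis using True \<open>0 < r\<close> by (simp add: kern_pos ennreal_mult'[symmetric])
    qed auto
    then show ?thesis by simp
  qed
  finally show ?thesis using R by (simp add: nn_integral_inverse_Ico ennreal_mult'[symmetric])
qed

section \<open>The inequalities of Minkowski, Hardy, Littlewood and Sobolev\<close>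

lemma ennreal_left_inverse: "x \<noteq> 0 \<Longrightarrow> x \<noteq> top \<Longrightarrow> inverse x * x = 1" for x :: ennreal
  by (cases x) (simp_all add: inverse_ennreal ennreal_mult'[symmetric])

lemma ennreal_cmult_less_iff:
  assumes "0 < c"
  shows "ennreal c * x < ennreal c * y \<longleftrightarrow> x < y"
proof -
  have "ennreal (1 / c) * (ennreal c * z) = z" for z
    using assms by (simp add: mult.assoc[symmetric] ennreal_mult'[symmetric])
  then show ?thesis by (metis linorder_not_le mult_left_mono zero_le)
qed

text \<open>
  Hoelder's inequality for \<open>G x y = (G x y / w y powr (1 / r)) * w y powr (1 / r)\<close> in \<open>y\<close>, followed
  by Tonelli.
\<close>

lemma Minkowski_nn_integral:
  fixes G :: "'a \<Rightarrow> 'b \<Rightarrow> ennreal"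
  assumes "sigma_finite_measure M" "sigma_finite_measure N" and q: "1 \<le> q"
    and G [measurable]: "(\<lambda>(x, y). G x y) \<in> borel_measurable (M \<Otimes>\<^sub>M N)"
    and w [measurable]: "w \<in> borel_measurable N"
    and bound: "\<And>y. y \<in> space N \<Longrightarrow> (\<integral>\<^sup>+x. G x y ennpowr q \<partial>M) \<le> w y ennpowr q"
  shows "(\<integral>\<^sup>+x. (\<integral>\<^sup>+y. G x y \<partial>N) ennpowr q \<partial>M) \<le> (\<integral>\<^sup>+y. w y \<partial>N) ennpowr q"
proof -
  interpret M: sigma_finite_measure M by fact
  interpret N: sigma_finite_measure N by fact
  interpret pair_sigma_finite M N ..
  have Fub: "(\<integral>\<^sup>+x. \<integral>\<^sup>+y. K x y \<partial>N \<partial>M) = (\<integral>\<^sup>+y. \<integral>\<^sup>+x. K x y \<partial>M \<partial>N)"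
    if "(\<lambda>(x, y). K x y) \<in> borel_measurable (M \<Otimes>\<^sub>M N)" for K :: "'a \<Rightarrow> 'b \<Rightarrow> ennreal"
    using Fubini[OF that] by simp
  have [measurable]: "\<And>y. y \<in> space N \<Longrightarrow> (\<lambda>x. G x y) \<in> borel_measurable M"
    by measurable
  let ?W = "\<integral>\<^sup>+y. w y \<partial>N"
  consider "?W = top" | "?W \<noteq> top" "q = 1" | "?W \<noteq> top" "1 < q" using q by fastforce
  then show ?thesis
  proof cases
    case 1 then show ?thesis by simp
  next
    case 2
    then have "(\<integral>\<^sup>+y. \<integral>\<^sup>+x. G x y \<partial>M \<partial>N) \<le> ?W"
      using bound by (intro nn_integral_mono) simp
    then show ?thesis using 2 Fub[OF G] by simp
  next
    case 3
    define r where "r = q / (q - 1)"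
    have r: "1 / q + 1 / r = 1" using 3 by (simp add: r_def field_simps)
    have r0: "0 < r" using 3 by (simp add: r_def)
    \<comment> \<open>Division by \<open>w y ennpowr (1 / r)\<close> is impossible where
      \<open>w y = 0\<close>. There the bound makes \<open>G x y\<close> vanish for almost every
      \<open>x\<close>, and Tonelli exchanges the order of the two quantifiers.\<close>
    have "(\<integral>\<^sup>+x. G x y * indicator {y. w y = 0} y \<partial>M) = 0" if y: "y \<in> space N" for y
    proof (cases "w y = 0")
      case True
      then have "(\<integral>\<^sup>+x. G x y ennpowr q \<partial>M) = 0" using bound[OF y] by simp
      then have "AE x in M. G x y = 0" using y by (subst (asm) nn_integral_0_iff_AE) auto
      then show ?thesis using y by (subst nn_integral_0_iff_AE) auto
    qed simp
    then have "(\<integral>\<^sup>+y. \<integral>\<^sup>+x. G x y * indicator {y. w y = 0} y \<partial>M \<partial>N) = 0"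
      by (simp cong: nn_integral_cong)
    then have "(\<integral>\<^sup>+x. \<integral>\<^sup>+y. G x y * indicator {y. w y = 0} y \<partial>N \<partial>M) = 0"
      by (subst Fub) auto
    then have z1: "AE x in M. (\<integral>\<^sup>+y. G x y * indicator {y. w y = 0} y \<partial>N) = 0"
      by (subst (asm) nn_integral_0_iff_AE) auto
    have z2: "(AE y in N. w y = 0 \<longrightarrow> G x y = 0)"
      if "(\<integral>\<^sup>+y. G x y * indicator {y. w y = 0} y \<partial>N) = 0" "x \<in> space M" for x
    proof -
      have [measurable]: "(\<lambda>y. G x y) \<in> borel_measurable N" using that(2) by measurable
      show ?thesis
        using that(1) by (subst (asm) nn_integral_0_iff_AE) (auto elim!: eventually_mono split: split_indicator_asm)
    qed
    have zero: "AE x in M. AE y in N. w y = 0 \<longrightarrow> G x y = 0"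
      by (rule AE_mp[OF z1 AE_I2]) (use z2 in blast)
    have fin: "AE y in N. w y \<noteq> top" using nn_integral_PInf_AE[of w N] 3 by simp
    define v where "v y = w y ennpowr (1 / r)" for y
    have [measurable]: "v \<in> borel_measurable N" unfolding v_def by measurable
    have vr: "v y ennpowr r = w y" for y using r0 by (simp add: v_def ennpowr_ennpowr)
    have vinv: "x * inverse (v y) * v y = x" if "w y = 0 \<longrightarrow> x = 0" "w y \<noteq> top" for x y
    proof (cases "w y = 0")
      case False
      then show ?thesis using that by (simp add: v_def mult.assoc ennreal_left_inverse)
    qed (use that in auto)
    let ?Q = "\<lambda>x. \<integral>\<^sup>+y. (G x y * inverse (v y)) ennpowr q \<partial>N"
    have "AE x in M. (\<integral>\<^sup>+y. G x y \<partial>N) ennpowr q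
      \<le> ?Q x * ?W ennpowr (q / r)"
      using zero
    proof (rule AE_mp, intro AE_I2 impI)
      fix x assume x: "x \<in> space M" and z: "AE y in N. w y = 0 \<longrightarrow> G x y = 0"
      have [measurable]: "(\<lambda>y. G x y) \<in> borel_measurable N" using x by measurable
      have "(\<integral>\<^sup>+y. G x y \<partial>N) = (\<integral>\<^sup>+y. G x y * inverse (v y) * v y \<partial>N)"
        by (intro nn_integral_cong_AE) (use z fin vinv in \<open>auto elim!: eventually_elim2\<close>)
      also have "\<dots> \<le> ?Q x ennpowr (1 / q) * (\<integral>\<^sup>+y. v y ennpowr r \<partial>N) ennpowr (1 / r)"
        using 3 r by (intro Hoelder_nn_integral) auto
      finally have "(\<integral>\<^sup>+y. G x y \<partial>N) ennpowr q \<le> (?Q x ennpowr (1 / q) * (\<integral>\<^sup>+y. v y ennpowr r \<partial>N) ennpowr (1 / r)) ennpowr q"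
        using 3 by (intro ennpowr_mono) auto
      also have "\<dots> = ?Q x * ?W ennpowr (q / r)"
        using 3 by (simp add: ennpowr_mult ennpowr_ennpowr vr)
      finally show "(\<integral>\<^sup>+y. G x y \<partial>N) ennpowr q \<le> ?Q x * ?W ennpowr (q / r)" .
    qed
    then have "(\<integral>\<^sup>+x. (\<integral>\<^sup>+y. G x y \<partial>N) ennpowr q \<partial>M) \<le> (\<integral>\<^sup>+x. ?Q x * ?W ennpowr (q / r) \<partial>M)"
      by (rule nn_integral_mono_AE)
    also have "\<dots> = (\<integral>\<^sup>+x. ?Q x \<partial>M) * ?W ennpowr (q / r)"
      by (intro nn_integral_multc) measurable
    also have "(\<integral>\<^sup>+x. ?Q x \<partial>M) = (\<integral>\<^sup>+y. (\<integral>\<^sup>+x. (G x y * inverse (v y)) ennpowr q \<partial>M) \<partial>N)"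
      by (intro Fub) measurable
    also have "\<dots> \<le> (\<integral>\<^sup>+y. w y \<partial>N)"
      using fin
    proof (intro nn_integral_mono_AE, elim AE_mp, intro AE_I2 impI)
      fix y assume y: "y \<in> space N" and f: "w y \<noteq> top"
      have [measurable]: "(\<lambda>x. G x y) \<in> borel_measurable M" using y by measurable
      have "(\<integral>\<^sup>+x. (G x y * inverse (v y)) ennpowr q \<partial>M) = (\<integral>\<^sup>+x. G x y ennpowr q \<partial>M) * inverse (v y) ennpowr q"
        by (simp add: ennpowr_mult nn_integral_multc)
      also have "\<dots> \<le> w y ennpowr q * inverse (v y) ennpowr q"
        by (intro mult_right_mono bound y) auto
      also have "\<dots> = (w y * inverse (v y)) ennpowr q" by (simp add: ennpowr_mult)
      also have "w y * inverse (v y) = w y ennpowr (1 / q)"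
      proof (cases "w y = 0")
        case False
        have "w y = w y ennpowr (1 / q) * v y" unfolding v_def ennpowr_add[symmetric] r by simp
        then have "w y * inverse (v y) = w y ennpowr (1 / q) * (v y * inverse (v y))" by (metis mult.assoc)
        also have "v y * inverse (v y) = 1"
          using False f by (subst mult.commute, intro ennreal_left_inverse) (auto simp: v_def)
        finally show ?thesis by simp
      qed simp
      also have "(w y ennpowr (1 / q)) ennpowr q = w y" using 3 by (simp add: ennpowr_ennpowr)
      finally show "(\<integral>\<^sup>+x. (G x y * inverse (v y)) ennpowr q \<partial>M) \<le> w y" .
    qed
    also have "?W * ?W ennpowr (q / r) = ?W ennpowr (1 + q / r)" by (simp add: ennpowr_add)
    also have "1 + q / r = q" using r 3 by (simp add: r_def field_simps)
    finally show ?thesis by (simp add: mult_right_mono)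
  qed
qed

text \<open>The layer-cake formula for a single value. Applied pointwise and followed by Tonelli, it
  converts bounds on level sets into bounds on integrals; at \<open>u = top\<close> it expresses
  divergence over the half-line.\<close>

lemma nn_integral_powr_layer:
  assumes b: "0 < b"
  shows "(\<integral>\<^sup>+x. ennreal (b * x powr (b - 1)) * indicator {x. 0 < x \<and> ennreal x < u} x \<partial>lborel) = u ennpowr b"
proof (cases u)
  case (real c)
  show ?thesis
  proof (cases "c = 0")
    case False
    then have "(\<integral>\<^sup>+x. ennreal (b * x powr (b - 1)) * indicator {x. 0 < x \<and> ennreal x < u} x \<partial>lborel)
      = (\<integral>\<^sup>+x. ennreal (b * x powr (b - 1)) * indicator {0<..<c} x \<partial>lborel)"
      using real by (intro nn_integral_cong) (auto split: split_indicator simp: ennreal_less_iff)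
    then show ?thesis using False real b by (simp add: nn_integral_powr_Ioo ennpowr_ennreal)
  qed (use real in simp)
next
  case top
  let ?I = "\<integral>\<^sup>+x. ennreal (b * x powr (b - 1)) * indicator {x. 0 < x \<and> ennreal x < u} x \<partial>lborel"
  have *: "ennreal (N powr b) \<le> ?I" if "0 < N" for N
    unfolding nn_integral_powr_Ioo[OF b that, symmetric]
    by (intro nn_integral_mono) (auto simp: top split: split_indicator)
  have "?I = top"
  proof (cases ?I)
    case (real c)
    then have "((c + 1) powr (1 / b)) powr b \<le> c"
      using *[of "(c + 1) powr (1 / b)"] by simp
    then show ?thesis using real b by (simp add: powr_powr)
  qed
  then show ?thesis by (simp add: top)
qed

text \<open>
  At height \<open>\<alpha>\<close> cut the kernel at radius \<open>R = \<alpha> powr (- q / n)\<close> and \<open>f\<close> at \<open>s = \<alpha> powr (q / p)\<close>.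
  The far part of the kernel (by Hoelder) and the part \<open>f \<le> s\<close> contribute at most a multiple of \<open>\<alpha>\<close>,
  hence the level set has measure at most a multiple of \<open>1 / s\<close> times the integral of \<open>f\<close> over
  \<open>{f > s}\<close>. Integrating over \<open>\<alpha>\<close> recovers the integral of \<open>f powr p\<close> because \<open>p > 1\<close>.
\<close>

lemma HLS_normalized:
  fixes p q a :: real
  assumes p: "1 < p" "p < q" and a: "a = DIM('a::euclidean_space) / q + DIM('a) * (1 - 1 / p)"
  obtains C :: real where "0 \<le> C"
    "\<And>f :: 'a \<Rightarrow> ennreal. f \<in> borel_measurable borel \<Longrightarrow> Lpow p f \<le> 1 \<Longrightarrow>
      Lpow q (riesz a f) \<le> ennreal C"
proof -
  define n where "n = real DIM('a)"
  define V where "V = unit_ball_vol n"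
  have n: "0 < n" by (simp add: n_def)
  have V: "0 < V" by (simp add: V_def n_def)
  define p' where "p' = p / (p - 1)"
  have p': "1 / p + 1 / p' = 1" "0 < p'" using p by (simp_all add: p'_def field_simps)
  have a_eq: "a = n / q + n / p'" using p by (simp add: a n_def p'_def field_simps)
  \<comment> \<open>This makes the near part of the kernel integrable, and it comes from
    \<open>p < q\<close>.\<close>
  have a_lt: "a < n" 
  proof -
    have "1 / q < 1 / p" using p by (simp add: frac_less2)
    then have "n * (1 / q - 1 / p) < 0" using n by (intro mult_pos_neg) auto
    then show ?thesis unfolding a n_def[symmetric] by (simp add: algebra_simps)
  qed
  have a0: "0 \<le> a" using p n p' by (simp add: a_eq)
  have ap': "a * p' - n = n * p' / q" using p p' by (simp add: a_eq field_simps)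
  \<comment> \<open>This puts the far part of the kernel into \<open>L^p'\<close>.\<close>
  have ap'_gt: "n < a * p'"
  proof -
    have "0 < n * p' / q" using p p' n by simp
    then show ?thesis using ap' by linarith
  qed
  define C1 where "C1 = (n * V / (a * p' - n)) powr (1 / p')"
  define C2 where "C2 = n * V / (n - a)"
  have C12: "0 \<le> C1" "0 < C2" using n V a_lt by (simp_all add: C1_def C2_def)
  \<comment> \<open>\<open>C1\<close> accounts for the far part and \<open>C2\<close> for the low
    part of \<open>f\<close>; the extra \<open>1\<close> forces the remaining term \<open>G\<close>
    to exceed \<alpha> on the level set.\<close>
  define L where "L = C1 + C2 + 1"
  have L: "0 < L" using C12 by (simp add: L_def)
  \<comment> \<open>Integrating the weak bound against \<open>q * \<alpha> powr (q - 1)\<close>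
    leaves \<open>\<alpha> powr (b - 1)\<close>, and
    \<open>f * f powr (p / q * b) = f powr p\<close>. Positivity comes from
    \<open>1 < p\<close>.\<close>
  define b where "b = q - q / p"
  have b: "0 < b" using p by (simp add: b_def field_simps)
  have bound: "Lpow q (riesz a f) \<le> ennreal (L powr q * (C2 * (q / b)))"
    if f [measurable]: "f \<in> borel_measurable borel" and f1: "Lpow p f \<le> 1"
    for f :: "'a \<Rightarrow> ennreal"
  proof -
    define T where "T x = riesz a f x" for x
    have [measurable]: "T \<in> borel_measurable borel" unfolding T_def by measurable
    have weak: "emeasure lborel {x. ennreal (L * \<alpha>) < T x}
        \<le> ennreal (C2 * \<alpha> powr (- q / p)) * (\<integral>\<^sup>+t. f t * indicator {t. ennreal (\<alpha> powr (q / p)) < f t} t \<partial>lborel)"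
      if \<alpha>: "0 < \<alpha>" for \<alpha>
    proof -
      define R where "R = \<alpha> powr (- q / n)"
      define s where "s = \<alpha> powr (q / p)"
      have R: "0 < R" using \<alpha> by (simp add: R_def)
      define I where "I = (\<integral>\<^sup>+t. f t * indicator {t. ennreal s < f t} t \<partial>lborel)"
      define k where "k x t = kern a (norm (x - t)) * indicator {..<R} (norm (x - t))" for x t :: 'a
      define G where "G x = (\<integral>\<^sup>+t. f t * indicator {t. ennreal s < f t} t * k x t \<partial>lborel)" for x
      have [measurable]: "(\<lambda>(x, t). k x t) \<in> borel_measurable (borel \<Otimes>\<^sub>M borel)"
        unfolding k_def indicator_def by measurable
      have [measurable]: "G \<in> borel_measurable borel" unfolding G_def by measurable
      have nk: "(\<integral>\<^sup>+t. k x t \<partial>lborel) = ennreal (C2 * R powr (n - a))" for x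
        using nn_integral_kern_ball[of a R x] a_lt R
        by (simp add: k_def norm_minus_commute[of x] C2_def n_def V_def indicator_def)
      have nk': "(\<integral>\<^sup>+x. k x t \<partial>lborel) = ennreal (C2 * R powr (n - a))" for t
        using nn_integral_kern_ball[of a R t] a_lt R
        by (simp add: k_def C2_def n_def V_def indicator_def)
      \<comment> \<open>The two cuts are matched to each other: a function of height
        \<open>s\<close> integrated against the near kernel, of mass
        \<open>C2 * R powr (n - a)\<close>, gives exactly \<open>C2 * \<alpha>\<close>.\<close>
      have eqR: "s * R powr (n - a) = \<alpha>"
      proof -
        have "q / p + (- q / n) * (n - a) = 1"
          using n p by (simp add: a n_def[symmetric] field_simps)
        then show ?thesis using \<alpha> by (simp add: s_def R_def powr_powr powr_add[symmetric])
      qed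
      have far: "(\<integral>\<^sup>+t. f t * (kern a (norm (x - t)) * indicator {t. R \<le> norm (x - t)} t) \<partial>lborel) \<le> ennreal (C1 * \<alpha>)" for x
      proof -
        have "(\<integral>\<^sup>+t. f t * (kern a (norm (x - t)) * indicator {t. R \<le> norm (x - t)} t) \<partial>lborel)
          \<le> Lpow p f ennpowr (1 / p) *
             (\<integral>\<^sup>+t. (kern a (norm (x - t)) * indicator {t. R \<le> norm (x - t)} t) ennpowr p' \<partial>lborel) ennpowr (1 / p')"
          using p p' by (intro Hoelder_nn_integral) auto
        also have "(\<integral>\<^sup>+t. (kern a (norm (x - t)) * indicator {t. R \<le> norm (x - t)} t) ennpowr p' \<partial>lborel)
            = ennreal (n * V / (a * p' - n) * R powr (n - a * p'))"
          using nn_integral_kern_compl_ball[of "a * p'" R x] ap'_gt R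
          by (simp add: ennpowr_indicator kern_ennpowr norm_minus_commute[of x] n_def V_def)
        also have "Lpow p f ennpowr (1 / p) * ennreal (n * V / (a * p' - n) * R powr (n - a * p')) ennpowr (1 / p')
           \<le> 1 * ennreal (n * V / (a * p' - n) * R powr (n - a * p')) ennpowr (1 / p')"
          using ennpowr_mono[OF f1, of "1 / p"] p by (intro mult_right_mono) auto
        also have "\<dots> = ennreal (C1 * \<alpha>)"
        proof -
          have "(R powr (n - a * p')) powr (1 / p') = \<alpha>"
          proof -
            have "- q / n * ((n - a * p') * (1 / p')) = 1"
              using ap' n p p' by (simp add: field_simps)
            then show ?thesis using \<alpha> by (simp only: R_def powr_powr) simp
          qed
          then have "(n * V / (a * p' - n) * R powr (n - a * p')) powr (1 / p') = C1 * \<alpha>"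
            using ap'_gt n V by (subst powr_mult) (auto simp: C1_def)
          then show ?thesis using ap'_gt n V by (subst mult_1, subst ennpowr_ennreal) auto
        qed
        finally show ?thesis .
      qed
      have split: "T x \<le> ennreal (C1 * \<alpha>) + ennreal (C2 * \<alpha>) + G x" for x
      proof -
        have "T x \<le> (\<integral>\<^sup>+t. f t * (kern a (norm (x - t)) * indicator {t. R \<le> norm (x - t)} t) +
            ennreal s * k x t + f t * indicator {t. ennreal s < f t} t * k x t \<partial>lborel)"
          unfolding T_def
        proof (intro nn_integral_mono)
          fix t
          show "f t * kern a (norm (x - t)) \<le> f t * (kern a (norm (x - t)) * indicator {t. R \<le> norm (x - t)} t) +
            ennreal s * k x t + f t * indicator {t. ennreal s < f t} t * k x t"
            by (cases "R \<le> norm (x - t)"; cases "ennreal s < f t")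
               (auto simp: k_def intro!: mult_right_mono)
        qed
        also have "\<dots> = (\<integral>\<^sup>+t. f t * (kern a (norm (x - t)) * indicator {t. R \<le> norm (x - t)} t) \<partial>lborel) +
            ennreal s * (\<integral>\<^sup>+t. k x t \<partial>lborel) + G x"
          unfolding G_def by (simp add: nn_integral_add nn_integral_cmult)
        also have "\<dots> \<le> ennreal (C1 * \<alpha>) + ennreal (C2 * \<alpha>) + G x"
        proof (intro add_mono far order_refl)
          have 1: "s * (C2 * R powr (n - a)) = C2 * \<alpha>" using eqR by (simp add: ac_simps)
          have 2: "ennreal s * ennreal (C2 * R powr (n - a)) = ennreal (s * (C2 * R powr (n - a)))"
            by (simp add: s_def ennreal_mult')
          show "ennreal s * (\<integral>\<^sup>+t. k x t \<partial>lborel) \<le> ennreal (C2 * \<alpha>)"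
            unfolding nk 2 1 by simp
        qed
        finally show ?thesis .
      qed
      have "emeasure lborel {x. ennreal (L * \<alpha>) < T x} \<le> emeasure lborel {x. 1 \<le> ennreal (1 / \<alpha>) * G x}"
      proof (intro emeasure_mono subsetI CollectI)
        fix x assume "x \<in> {x. ennreal (L * \<alpha>) < T x}"
        then have "ennreal (L * \<alpha>) < ennreal (C1 * \<alpha>) + ennreal (C2 * \<alpha>) + G x"
          using split[of x] by simp
        also have "ennreal (L * \<alpha>) = ennreal (C1 * \<alpha>) + ennreal (C2 * \<alpha>) + ennreal \<alpha>"
          using C12 \<alpha> by (simp add: L_def ennreal_plus[symmetric] algebra_simps del: ennreal_plus)
        finally have "ennreal \<alpha> < G x" by simp
        then have "ennreal (1 / \<alpha>) * ennreal \<alpha> \<le> ennreal (1 / \<alpha>) * G x"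
          by (intro mult_left_mono) auto
        then show "1 \<le> ennreal (1 / \<alpha>) * G x"
          using \<alpha> by (simp add: ennreal_mult'[symmetric])
      qed auto
      also have "\<dots> \<le> ennreal (1 / \<alpha>) * (\<integral>\<^sup>+x. G x * indicator UNIV x \<partial>lborel)"
        using nn_integral_Markov_inequality[of G UNIV lborel "ennreal (1 / \<alpha>)"] by simp
      also have "(\<integral>\<^sup>+x. G x * indicator UNIV x \<partial>lborel) = (\<integral>\<^sup>+t. (\<integral>\<^sup>+x. f t * indicator {t. ennreal s < f t} t * k x t \<partial>lborel) \<partial>lborel)"
        unfolding G_def by (subst lborel_pair.Fubini') auto
      also have "\<dots> = I * ennreal (C2 * R powr (n - a))"
        by (simp add: nn_integral_cmult nk' nn_integral_multc I_def)
      also have "ennreal (1 / \<alpha>) * (I * ennreal (C2 * R powr (n - a))) = ennreal (C2 * (1 / \<alpha> * R powr (n - a))) * I"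
        using \<alpha> C12 by (simp add: ennreal_mult'[symmetric] ac_simps)
      also have "1 / \<alpha> * R powr (n - a) = \<alpha> powr (- q / p)"
      proof -
        have "R powr (n - a) = \<alpha> * \<alpha> powr (- q / p)"
          using eqR \<alpha> by (simp add: s_def powr_minus field_simps)
        then show ?thesis using \<alpha> by simp
      qed
      finally show ?thesis by (simp add: I_def s_def)
    qed
    \<comment> \<open>\<open>?u\<close> slices the values of \<open>T / L\<close> with exponent
      \<open>q\<close>. \<open>?w\<close> slices \<open>f powr (p / q)\<close> with exponent
      \<open>b\<close>, because \<open>\<alpha> < f powr (p / q)\<close> is the condition
      \<open>s < f\<close> of the weak bound.\<close>
    let ?w = "\<lambda>\<alpha> t. ennreal (b * \<alpha> powr (b - 1)) * indicator {\<alpha>. 0 < \<alpha> \<and> ennreal \<alpha> < f t ennpowr (p / q)} \<alpha>" and ?u = "\<lambda>\<alpha> x. ennreal (q * \<alpha> powr (q - 1)) * indicator {\<alpha>. 0 < \<alpha> \<and> ennreal \<alpha> < ennreal (1 / L) * T x} \<alpha>"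
    have "(\<integral>\<^sup>+x. (ennreal (1 / L) * T x) ennpowr q \<partial>lborel) =
      (\<integral>\<^sup>+x. (\<integral>\<^sup>+\<alpha>. ?u \<alpha> x \<partial>lborel) \<partial>lborel)"
      using p by (subst nn_integral_powr_layer) auto
    also have "\<dots> = (\<integral>\<^sup>+\<alpha>. (\<integral>\<^sup>+x. ?u \<alpha> x \<partial>lborel) \<partial>lborel)"
      by (rule lborel_pair.Fubini') (simp add: indicator_def)
    also have "\<dots> \<le> (\<integral>\<^sup>+\<alpha>. (\<integral>\<^sup>+t. ennreal (C2 * (q / b)) * f t * ?w \<alpha> t \<partial>lborel) \<partial>lborel)"
    proof (rule nn_integral_mono)
      fix \<alpha> :: real
      show "(\<integral>\<^sup>+x. ?u \<alpha> x \<partial>lborel)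
        \<le> (\<integral>\<^sup>+t. ennreal (C2 * (q / b)) * f t * ?w \<alpha> t \<partial>lborel)"
      proof (cases "0 < \<alpha>")
        case True
        have iff: "ennreal \<alpha> < ennreal (1 / L) * T x \<longleftrightarrow> ennreal (L * \<alpha>) < T x" for x
        proof -
          have 1: "ennreal L * (ennreal (1 / L) * T x) = T x"
            using L by (simp add: mult.assoc[symmetric] ennreal_mult'[symmetric])
          have 2: "ennreal (L * \<alpha>) = ennreal L * ennreal \<alpha>" using L True by (simp add: ennreal_mult')
          show ?thesis
            using ennreal_cmult_less_iff[OF L, of "ennreal \<alpha>" "ennreal (1 / L) * T x"] 1 2 by simp
        qed
        have iff2: "ennreal \<alpha> < f t ennpowr (p / q) \<longleftrightarrow> ennreal (\<alpha> powr (q / p)) < f t" for t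
        proof -
          have "p / q * (q / p) = 1" using p by simp
          then have "(f t ennpowr (p / q)) ennpowr (q / p) = f t" by (simp only: ennpowr_ennpowr ennpowr_one)
          moreover have "0 < q / p" using p by simp
          ultimately show ?thesis
            using ennpowr_le_iff[of "q / p" "f t ennpowr (p / q)" "ennreal \<alpha>"] p True
            by (simp add: ennpowr_ennreal not_le[symmetric])
        qed
        have "(\<integral>\<^sup>+x. ?u \<alpha> x \<partial>lborel)
          = ennreal (q * \<alpha> powr (q - 1)) * (\<integral>\<^sup>+x. indicator {x. ennreal (L * \<alpha>) < T x} x \<partial>lborel)"
          using True by (subst nn_integral_cmult[symmetric]) (auto simp: iff intro!: nn_integral_cong split: split_indicator)
        also have "\<dots> = ennreal (q * \<alpha> powr (q - 1)) * emeasure lborel {x. ennreal (L * \<alpha>) < T x}"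
          by simp
        also have "\<dots> \<le> ennreal (q * \<alpha> powr (q - 1)) * (ennreal (C2 * \<alpha> powr (- q / p)) * (\<integral>\<^sup>+t. f t * indicator {t. ennreal (\<alpha> powr (q / p)) < f t} t \<partial>lborel))"
          by (intro mult_left_mono weak True) auto
        also have "\<dots> = ennreal (C2 * (q / b)) * ennreal (b * \<alpha> powr (b - 1)) * (\<integral>\<^sup>+t. f t * indicator {t. ennreal (\<alpha> powr (q / p)) < f t} t \<partial>lborel)"
        proof -
          have "\<alpha> powr (q - 1) * \<alpha> powr (- q / p) = \<alpha> powr (b - 1)"
            by (subst powr_add[symmetric]) (simp add: b_def algebra_simps)
          then have e: "q * \<alpha> powr (q - 1) * (C2 * \<alpha> powr (- q / p)) = C2 * (q / b) * (b * \<alpha> powr (b - 1))"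
            using b by (simp add: ac_simps)
          have "ennreal (q * \<alpha> powr (q - 1)) * ennreal (C2 * \<alpha> powr (- q / p)) = ennreal (q * \<alpha> powr (q - 1) * (C2 * \<alpha> powr (- q / p)))"
            using p by (intro ennreal_mult'[symmetric]) auto
          also have "\<dots> = ennreal (C2 * (q / b)) * ennreal (b * \<alpha> powr (b - 1))"
            unfolding e using p b C12 by (intro ennreal_mult') auto
          finally show ?thesis by (simp only: mult.assoc[symmetric])
        qed
        also have "\<dots> = (\<integral>\<^sup>+t. ennreal (C2 * (q / b)) * f t * ?w \<alpha> t \<partial>lborel)"
          using True by (subst nn_integral_cmult[symmetric]) (auto simp: iff2 ac_simps intro!: nn_integral_cong split: split_indicator)
        finally show ?thesis .
      qed simp
    qed
    also have "\<dots> = (\<integral>\<^sup>+t. (\<integral>\<^sup>+\<alpha>. ennreal (C2 * (q / b)) * f t * ?w \<alpha> t \<partial>lborel) \<partial>lborel)"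
      by (rule lborel_pair.Fubini') (simp add: indicator_def)
    also have "\<dots> = (\<integral>\<^sup>+t. ennreal (C2 * (q / b)) * f t * (f t ennpowr (p / q)) ennpowr b \<partial>lborel)"
      by (intro nn_integral_cong) (subst nn_integral_cmult, simp, simp add: nn_integral_powr_layer b)
    also have "\<dots> = (\<integral>\<^sup>+t. ennreal (C2 * (q / b)) * f t ennpowr p \<partial>lborel)"
    proof (intro nn_integral_cong)
      fix t
      have "f t * (f t ennpowr (p / q)) ennpowr b = f t ennpowr (1 + p / q * b)"
        by (simp add: ennpowr_ennpowr ennpowr_add)
      also have "1 + p / q * b = p" using p by (simp add: b_def field_simps)
      finally show "ennreal (C2 * (q / b)) * f t * (f t ennpowr (p / q)) ennpowr b = ennreal (C2 * (q / b)) * f t ennpowr p"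
        by (simp add: mult.assoc)
    qed
    also have "\<dots> \<le> ennreal (C2 * (q / b)) * 1"
      using mult_left_mono[OF f1, of "ennreal (C2 * (q / b))"] by (simp add: nn_integral_cmult)
    finally have *: "(\<integral>\<^sup>+x. (ennreal (1 / L) * T x) ennpowr q \<partial>lborel) \<le> ennreal (C2 * (q / b))" by simp
    have "T x = ennreal L * (ennreal (1 / L) * T x)" for x
      using L by (simp add: mult.assoc[symmetric] ennreal_mult'[symmetric])
    then have "(\<integral>\<^sup>+x. T x ennpowr q \<partial>lborel) = (\<integral>\<^sup>+x. ennreal L ennpowr q * (ennreal (1 / L) * T x) ennpowr q \<partial>lborel)"
      by (metis ennpowr_mult)
    also have "\<dots> \<le> ennreal L ennpowr q * ennreal (C2 * (q / b))"
      using mult_left_mono[OF *, of "ennreal L ennpowr q"] by (simp add: nn_integral_cmult)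
    also have "\<dots> = ennreal (L powr q * (C2 * (q / b)))"
      using L by (simp only: ennpowr_ennreal less_imp_le ennreal_mult'[symmetric] powr_ge_zero)
    finally show ?thesis by (simp add: T_def)
  qed
  show ?thesis
    by (rule that[OF _ bound]) (use L C12 b p in auto)
qed

lemma nn_integral_cmult_ennpowr:
  assumes [measurable]: "f \<in> borel_measurable M"
  shows "(\<integral>\<^sup>+x. (c * f x) ennpowr r \<partial>M) = c ennpowr r * (\<integral>\<^sup>+x. f x ennpowr r \<partial>M)"
  by (simp add: ennpowr_mult nn_integral_cmult)

theorem HLS_inequality:
  fixes p q a :: real
  assumes p: "1 < p" "p < q" and a: "a = DIM('a::euclidean_space) / q + DIM('a) * (1 - 1 / p)"
  obtains C :: real where "0 \<le> C"
    "\<And>f :: 'a \<Rightarrow> ennreal. f \<in> borel_measurable borel \<Longrightarrow>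
      Lpow q (riesz a f) ennpowr (1 / q)
      \<le> ennreal C * Lpow p f ennpowr (1 / p)"
proof -
  obtain C where C: "0 \<le> C" "\<And>f :: 'a \<Rightarrow> ennreal. f \<in> borel_measurable borel \<Longrightarrow> Lpow p f \<le> 1 \<Longrightarrow>
      Lpow q (riesz a f) \<le> ennreal C"
    using HLS_normalized[OF p a] by blast
  \<comment> \<open>The \<open>+ 1\<close> keeps \<open>D\<close> positive, so that the right-hand
    side is infinite whenever the norm of \<open>f\<close> is.\<close>
  define D where "D = (C + 1) powr (1 / q)"
  have D: "0 < D" using C by (simp add: D_def)
  have "Lpow q (riesz a f) ennpowr (1 / q)
      \<le> ennreal D * Lpow p f ennpowr (1 / p)"
    if f [measurable]: "f \<in> borel_measurable borel" for f :: "'a \<Rightarrow> ennreal"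
  proof -
    define A where "A = Lpow p f ennpowr (1 / p)"
    have Ap: "Lpow p f = A ennpowr p" using p by (simp add: A_def ennpowr_ennpowr)
    consider "A = 0" | "A = top" | c where "A = ennreal c" "0 < c"
      by (cases A) (auto simp: less_le)
    then show ?thesis
    proof cases
      case 1
      then have "Lpow p f = 0" by (simp add: Ap)
      then have *: "AE t in lborel. f t = 0" by (subst (asm) nn_integral_0_iff_AE) auto
      have "riesz a f x = 0" for x
        using * by (subst nn_integral_0_iff_AE) auto
      then show ?thesis by simp
    next
      case 2
      then show ?thesis using D unfolding A_def[symmetric] by (simp add: ennreal_mult_top)
    next
      case 3
      define g where "g t = ennreal (1 / c) * f t" for t
      have [measurable]: "g \<in> borel_measurable borel" unfolding g_def by measurable
      have fg: "f t = ennreal c * g t" for t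
        using 3 by (simp add: g_def mult.assoc[symmetric] ennreal_mult'[symmetric])
      have "Lpow p g = (ennreal (1 / c) * A) ennpowr p"
        unfolding g_def by (subst nn_integral_cmult_ennpowr) (auto simp: Ap ennpowr_mult)
      also have "ennreal (1 / c) * A = 1" using 3 by (simp add: ennreal_mult'[symmetric])
      finally have g: "Lpow q (riesz a g) \<le> ennreal C"
        by (intro C) auto
      have "Lpow q (riesz a f)
        = (\<integral>\<^sup>+x. (ennreal c * riesz a g x) ennpowr q \<partial>lborel)"
        unfolding fg by (simp add: mult.assoc nn_integral_cmult)
      also have "\<dots> = ennreal c ennpowr q * Lpow q (riesz a g)"
        by (subst nn_integral_cmult_ennpowr) auto
      also have "\<dots> \<le> ennreal c ennpowr q * ennreal (C + 1)"
        using g C(1) by (intro mult_left_mono) (auto intro: order_trans)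
      finally have "Lpow q (riesz a f) ennpowr (1 / q)
        \<le> (ennreal c ennpowr q * ennreal (C + 1)) ennpowr (1 / q)"
        using p by (intro ennpowr_mono) auto
      also have "\<dots> = ennreal D * A"
        using p 3 C by (simp add: ennpowr_mult ennpowr_ennpowr D_def ennpowr_ennreal powr_powr mult.commute del: ennreal_plus)
      finally show ?thesis by (simp add: A_def)
    qed
  qed
  then show ?thesis using that[of D] D by auto
qed

text \<open>The behaviour changes at \<open>norm (t - c) = u\<close>. Inside, the first factor is at
  most \<open>u powr - n\<close>, and \<open>b < n\<close> makes the rest integrable; outside, the
  product is at most \<open>norm (t - c) powr (- n - b)\<close>, and \<open>0 < b\<close> suffices.
  So the Hardy kernel reproduces powers of the distance up to a constant, which the Schur test
  requires.\<close>

lemma nn_integral_kern_add: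
  fixes b :: real
  assumes b: "0 < b" "b < DIM('a::euclidean_space)" and u: "0 < u"
  shows "(\<integral>\<^sup>+t. kern DIM('a) (u + norm (t - c)) * kern b (norm (t - c)) \<partial>(lborel :: 'a measure))
    \<le> ennreal (DIM('a) * unit_ball_vol DIM('a) * (1 / (DIM('a) - b) + 1 / b)) * kern b u"
proof -
  let ?n = "real DIM('a)" and ?V = "unit_ball_vol DIM('a)"
  let ?v = "\<lambda>t::'a. norm (t - c)"
  have "(\<integral>\<^sup>+t. kern ?n (u + ?v t) * kern b (?v t) \<partial>lborel) \<le>
    (\<integral>\<^sup>+t. kern ?n u * (kern b (?v t) * indicator {t. ?v t < u} t) + kern (?n + b) (?v t) * indicator {t. u \<le> ?v t} t \<partial>lborel)"
  proof (intro nn_integral_mono)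
    fix t
    show "kern ?n (u + ?v t) * kern b (?v t) \<le> kern ?n u * (kern b (?v t) * indicator {t. ?v t < u} t) + kern (?n + b) (?v t) * indicator {t. u \<le> ?v t} t"
    proof (cases "?v t < u")
      case True
      then show ?thesis using u by (auto intro!: mult_right_mono kern_mono)
    next
      case False
      then have "kern ?n (u + ?v t) * kern b (?v t) \<le> kern ?n (?v t) * kern b (?v t)"
        using u by (intro mult_right_mono kern_mono) auto
      also have "\<dots> = kern (?n + b) (?v t)"
        using False u by (intro kern_mult) auto
      finally show ?thesis using False by simp
    qed
  qed
  also have "\<dots> = kern ?n u * ennreal (?n * ?V / (?n - b) * u powr (?n - b)) + ennreal (?n * ?V / (?n + b - ?n) * u powr (?n - (?n + b)))"
    using nn_integral_kern_ball[of b u c] nn_integral_kern_compl_ball[of "?n + b" u c] b u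
    by (simp add: nn_integral_add nn_integral_cmult)
  also have "kern ?n u * ennreal (?n * ?V / (?n - b) * u powr (?n - b)) = ennreal (?n * ?V / (?n - b) * (u powr - ?n * u powr (?n - b)))"
    using b u by (simp add: kern_pos ennreal_mult'[symmetric] ac_simps)
  also have "u powr - ?n * u powr (?n - b) = u powr - b"
    by (subst powr_add[symmetric]) simp
  also have "ennreal (?n * ?V / (?n - b) * u powr - b) + ennreal (?n * ?V / (?n + b - ?n) * u powr (?n - (?n + b)))
    = ennreal (?n * ?V * (1 / (?n - b) + 1 / b)) * kern b u"
    using b u by (simp add: kern_pos ennreal_mult'[symmetric] ennreal_plus[symmetric] algebra_simps del: ennreal_plus)
  finally show ?thesis .
qed

text \<open>
  Schur test with the weight \<open>|t - c| powr (- n / (p * p'))\<close>.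
\<close>

lemma Hardy_inequality:
  fixes p :: real
  assumes p: "1 < p"
  obtains C :: real where "0 \<le> C"
    "\<And>(f :: 'a::euclidean_space \<Rightarrow> ennreal) c. f \<in> borel_measurable borel \<Longrightarrow>
      (\<integral>\<^sup>+x. (\<integral>\<^sup>+t. f t * kern DIM('a) (norm (x - c) + norm (t - c)) \<partial>lborel) ennpowr p \<partial>lborel)
      \<le> ennreal C * Lpow p f"
proof -
  let ?n = "real DIM('a)" and ?V = "unit_ball_vol DIM('a)"
  have n: "0 < ?n" by simp
  define p' where "p' = p / (p - 1)"
  have p': "1 / p + 1 / p' = 1" "1 < p'" using p by (simp_all add: p'_def field_simps)
  \<comment> \<open>\<open>e * p = n / p'\<close> and \<open>e * p' = n / p\<close> lie strictly
    between \<open>0\<close> and \<open>n\<close>, as both uses of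
    \<open>nn_integral_kern_add\<close> demand.\<close>
  define e where "e = ?n / (p * p')"
  have e: "0 < e" "0 < e * p" "0 < e * p'" "e * p < ?n" "e * p' < ?n" 
    using p p' n by (auto simp: e_def field_simps)
  define D where "D b = ?n * ?V * (1 / (?n - b) + 1 / b)" for b
  have D: "0 \<le> D (e * p)" "0 \<le> D (e * p')" using e by (auto simp: D_def)
  have "(\<integral>\<^sup>+x. (\<integral>\<^sup>+t. f t * kern ?n (norm (x - c) + norm (t - c)) \<partial>lborel) ennpowr p \<partial>lborel)
      \<le> ennreal (D (e * p') powr (p / p') * D (e * p)) * Lpow p f"
    if f [measurable]: "f \<in> borel_measurable borel" for f :: "'a \<Rightarrow> ennreal" and c
  proof -
    define K where "K x t = kern ?n (norm (x - c) + norm (t - c))" for x t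
    define v where "v t = norm (t - c)" for t
    have [measurable]: "(\<lambda>(x, t). K x t) \<in> borel_measurable (borel \<Otimes>\<^sub>M borel)" "\<And>x. K x \<in> borel_measurable borel"
      "v \<in> borel_measurable borel" "\<And>t. (\<lambda>x. K x t) \<in> borel_measurable borel"
      unfolding K_def v_def by measurable
    define w where "w t = ennreal (v t powr e)" for t
    have [measurable]: "w \<in> borel_measurable borel" unfolding w_def by measurable
    let ?A = "\<lambda>x. \<integral>\<^sup>+t. f t ennpowr p * w t ennpowr p * K x t \<partial>lborel"
    have pt: "(\<integral>\<^sup>+t. f t * K x t \<partial>lborel) ennpowr p \<le>
       ennreal (D (e * p') powr (p / p')) * (\<integral>\<^sup>+t. f t ennpowr p * w t ennpowr p * K x t * kern (e * p) (v x) \<partial>lborel)"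
      if x: "x \<noteq> c" for x
    proof -
      have vx: "0 < v x" using x by (simp add: v_def)
      have "(\<integral>\<^sup>+t. f t * K x t \<partial>lborel) = (\<integral>\<^sup>+t. (f t * w t * K x t ennpowr (1 / p)) * (K x t ennpowr (1 / p') * kern e (v t)) \<partial>lborel)"
      \<comment> \<open>At \<open>t = c\<close> the weight is \<open>0\<close> and
        \<open>kern e 0\<close> is \<open>top\<close>, with product \<open>0\<close> instead of
        \<open>1\<close>; the equality holds only almost everywhere.\<close>
      proof (intro nn_integral_cong_AE, use AE_lborel_singleton[of c] in \<open>eventually_elim\<close>)
        case (elim t)
        then have "w t * kern e (v t) = 1" by (simp add: w_def v_def kern_pos ennreal_mult'[symmetric] powr_add[symmetric])
        moreover have "K x t ennpowr (1 / p) * K x t ennpowr (1 / p') = K x t"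
          unfolding ennpowr_add[symmetric] p' by simp
        ultimately have "f t * K x t = f t * (w t * kern e (v t)) * (K x t ennpowr (1 / p) * K x t ennpowr (1 / p'))" by simp
        then show ?case by (simp only: ac_simps)
      qed
      also have "\<dots> \<le> (\<integral>\<^sup>+t. (f t * w t * K x t ennpowr (1 / p)) ennpowr p \<partial>lborel) ennpowr (1 / p) *
         (\<integral>\<^sup>+t. (K x t ennpowr (1 / p') * kern e (v t)) ennpowr p' \<partial>lborel) ennpowr (1 / p')"
        using p p' by (intro Hoelder_nn_integral) auto
      also have "(\<integral>\<^sup>+t. (K x t ennpowr (1 / p') * kern e (v t)) ennpowr p' \<partial>lborel) = (\<integral>\<^sup>+t. K x t * kern (e * p') (v t) \<partial>lborel)"
        using p' by (intro nn_integral_cong) (simp add: ennpowr_mult ennpowr_ennpowr kern_ennpowr v_def)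
      also have "(\<integral>\<^sup>+t. (f t * w t * K x t ennpowr (1 / p)) ennpowr p \<partial>lborel) = ?A x"
        using p by (intro nn_integral_cong) (simp add: ennpowr_mult ennpowr_ennpowr)
      finally have "(\<integral>\<^sup>+t. f t * K x t \<partial>lborel) ennpowr p \<le> (?A x ennpowr (1 / p) *
         (\<integral>\<^sup>+t. K x t * kern (e * p') (v t) \<partial>lborel) ennpowr (1 / p')) ennpowr p"
        using p by (intro ennpowr_mono) auto
      also have "\<dots> = ?A x * (\<integral>\<^sup>+t. K x t * kern (e * p') (v t) \<partial>lborel) ennpowr (p / p')"
        using p by (simp add: ennpowr_mult ennpowr_ennpowr)
      also have "\<dots> \<le> ?A x * (ennreal (D (e * p')) * kern (e * p') (v x)) ennpowr (p / p')"
        using nn_integral_kern_add[of "e * p'" "v x" c] e vx p p'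
        by (intro mult_left_mono ennpowr_mono) (auto simp: K_def v_def D_def)
      also have "(ennreal (D (e * p')) * kern (e * p') (v x)) ennpowr (p / p') = ennreal (D (e * p') powr (p / p')) * kern (e * p) (v x)"
        using D p' by (simp add: ennpowr_mult ennpowr_ennreal kern_ennpowr v_def)
      also have "?A x * (ennreal (D (e * p') powr (p / p')) * kern (e * p) (v x))
        = ennreal (D (e * p') powr (p / p')) * (?A x * kern (e * p) (v x))"
        by (simp only: ac_simps)
      also have "?A x * kern (e * p) (v x)
        = (\<integral>\<^sup>+t. f t ennpowr p * w t ennpowr p * K x t * kern (e * p) (v x) \<partial>lborel)"
        by (intro nn_integral_multc[symmetric]) measurable
      finally show ?thesis .
    qed
    have "(\<integral>\<^sup>+x. (\<integral>\<^sup>+t. f t * K x t \<partial>lborel) ennpowr p \<partial>lborel) \<le>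
      (\<integral>\<^sup>+x. ennreal (D (e * p') powr (p / p')) * (\<integral>\<^sup>+t. f t ennpowr p * w t ennpowr p * K x t * kern (e * p) (v x) \<partial>lborel) \<partial>lborel)"
      by (intro nn_integral_mono_AE, use AE_lborel_singleton[of c] in \<open>eventually_elim\<close>) (rule pt)
    also have "\<dots> = ennreal (D (e * p') powr (p / p')) * (\<integral>\<^sup>+x. \<integral>\<^sup>+t. f t ennpowr p * w t ennpowr p * K x t * kern (e * p) (v x) \<partial>lborel \<partial>lborel)"
      by (intro nn_integral_cmult) measurable
    also have "(\<integral>\<^sup>+x. \<integral>\<^sup>+t. f t ennpowr p * w t ennpowr p * K x t * kern (e * p) (v x) \<partial>lborel \<partial>lborel) =
      (\<integral>\<^sup>+t. \<integral>\<^sup>+x. f t ennpowr p * w t ennpowr p * K x t * kern (e * p) (v x) \<partial>lborel \<partial>lborel)"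
      by (rule lborel_pair.Fubini') measurable
    also have "\<dots> \<le> (\<integral>\<^sup>+t. ennreal (D (e * p)) * f t ennpowr p \<partial>lborel)"
    proof (intro nn_integral_mono_AE, use AE_lborel_singleton[of c] in \<open>eventually_elim\<close>)
      case (elim t)
      then have vt: "0 < v t" by (simp add: v_def)
      have "(\<integral>\<^sup>+x. f t ennpowr p * w t ennpowr p * K x t * kern (e * p) (v x) \<partial>lborel) =
        f t ennpowr p * w t ennpowr p * (\<integral>\<^sup>+x. K x t * kern (e * p) (v x) \<partial>lborel)"
        by (simp add: nn_integral_cmult mult.assoc)
      also have "\<dots> \<le> f t ennpowr p * w t ennpowr p * (ennreal (D (e * p)) * kern (e * p) (v t))"
        using nn_integral_kern_add[of "e * p" "v t" c] e vt
        by (intro mult_left_mono) (auto simp: K_def v_def D_def add.commute)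
      also have "w t ennpowr p * kern (e * p) (v t) = 1"
        using vt p by (simp add: w_def kern_pos ennpowr_ennreal powr_powr ennreal_mult'[symmetric] powr_add[symmetric])
      then have "f t ennpowr p * w t ennpowr p * (ennreal (D (e * p)) * kern (e * p) (v t)) = ennreal (D (e * p)) * f t ennpowr p"
        by (metis mult.assoc mult.commute mult_1)
      finally show ?case .
    qed
    also have "\<dots> = ennreal (D (e * p)) * Lpow p f" by (simp add: nn_integral_cmult)
    finally show ?thesis using D by (simp add: K_def ennreal_mult' mult.assoc mult_left_mono)
  qed
  then show ?thesis using that[of "D (e * p') powr (p / p') * D (e * p)"] D by auto
qed

section \<open>Iterated norms\<close>

lemma esssup_le_iff:
  fixes f :: "'a \<Rightarrow> ennreal"
  assumes "f \<in> borel_measurable M"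
  shows "esssup M f \<le> c \<longleftrightarrow> (AE x in M. f x \<le> c)"
  using esssup_AE[of f M] esssup_I[OF assms] by (auto elim: eventually_mono order_trans)

lemma Lp_norm_lebesgue:
  assumes "p \<noteq> top"
  shows "Lp_norm lebesgue p f = (\<integral>\<^sup>+x. f x ennpowr enn2real p \<partial>lborel) ennpowr (1 / enn2real p)"
  using assms by (simp add: Lp_norm_def nn_integral_completion)

text \<open>For \<open>p = top\<close> the sublevel set \<open>{y. esssup (G y) \<le> c}\<close>
  consists of those \<open>y\<close> for which \<open>{t. c < G y t}\<close> has measure zero, and
  this measure depends measurably on \<open>y\<close>.\<close>

lemma Lp_norm_measurable:
  fixes G :: "'b \<Rightarrow> 'a::euclidean_space \<Rightarrow> ennreal"
  assumes [measurable]: "(\<lambda>(y, t). G y t) \<in> borel_measurable (N \<Otimes>\<^sub>M lborel)"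
  shows "(\<lambda>y. Lp_norm lebesgue p (G y)) \<in> borel_measurable N"
proof (cases "p = top")
  case False
  have "(\<lambda>y. (\<integral>\<^sup>+x. G y x ennpowr enn2real p \<partial>lborel) ennpowr (1 / enn2real p)) \<in> borel_measurable N"
    by measurable
  then show ?thesis using False by (simp add: Lp_norm_lebesgue)
next
  case True
  show ?thesis
  proof (rule borel_measurableI_le)
    fix c
    have "Lp_norm lebesgue p (G y) \<le> c \<longleftrightarrow> (\<integral>\<^sup>+t. indicator {t. c < G y t} t \<partial>lborel) = 0" if "y \<in> space N" for y
    proof -
      have [measurable]: "G y \<in> borel_measurable borel" using that by measurable
      have "Lp_norm lebesgue p (G y) \<le> c \<longleftrightarrow> (AE t in lborel. G y t \<le> c)"
        using True by (simp add: Lp_norm_def esssup_le_iff AE_completion_iff measurable_completion)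
      also have "\<dots> \<longleftrightarrow> (\<integral>\<^sup>+t. indicator {t. c < G y t} t \<partial>lborel) = 0"
        by (subst nn_integral_0_iff_AE) (auto simp: not_le[symmetric] intro!: AE_cong split: split_indicator)
      finally show ?thesis .
    qed
    then have "{y \<in> space N. Lp_norm lebesgue p (G y) \<le> c} = {y \<in> space N. (\<integral>\<^sup>+t. indicator {t. c < G y t} t \<partial>lborel) = 0}"
      by auto
    also have "\<dots> \<in> sets N" by measurable
    finally show "{y \<in> space N. Lp_norm lebesgue p (G y) \<le> c} \<in> sets N" .
  qed
qed

abbreviation lborel_on :: "nat set \<Rightarrow> (nat \<Rightarrow> 'a::euclidean_space) measure" where
  "lborel_on I \<equiv> Pi\<^sub>M I (\<lambda>_. lborel)"

abbreviation J_nn ::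
  "nat \<Rightarrow> real \<Rightarrow> ((nat \<Rightarrow> 'a::euclidean_space) \<Rightarrow> ennreal) \<Rightarrow> 'a \<Rightarrow> ennreal" where
  "J_nn m lam F x \<equiv> \<integral>\<^sup>+y. F y * kern lam (\<Sum>i=1..m. norm (x - y i)) \<partial>lborel_on {1..m}"

abbreviation J_tail ::
  "nat \<Rightarrow> (nat \<Rightarrow> ennreal) \<Rightarrow> nat \<Rightarrow> real \<Rightarrow> ((nat \<Rightarrow> 'a::euclidean_space) \<Rightarrow> ennreal) \<Rightarrow> 'a \<Rightarrow> ennreal" where
  "J_tail m p K l F x \<equiv>
    \<integral>\<^sup>+y. iterated_norm p K F y * kern l (\<Sum>i=Suc K..m. norm (x - y i)) \<partial>lborel_on {Suc K..m}"

lemma product_sigma_finite_lborel: "product_sigma_finite (\<lambda>_::nat. lborel :: 'a::euclidean_space measure)"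
  by standard

text \<open>Tonelli for a measurable null set that covers the exceptional points: almost all of its
  sections are null.\<close>

lemma AE_lborel_on_insert:
  assumes I: "finite I" "i \<notin> I" and "AE y in lborel_on (insert i I). P y"
  shows "AE y in lborel_on I. AE t in (lborel :: 'a::euclidean_space measure). P (y(i := t))"
proof -
  interpret product_sigma_finite "\<lambda>_::nat. lborel :: 'a measure" by (rule product_sigma_finite_lborel)
  obtain N where N: "N \<in> sets (lborel_on (insert i I))" "emeasure (lborel_on (insert i I)) N = 0"
    "{y \<in> space (lborel_on (insert i I)). \<not> P y} \<subseteq> N"
    using assms(3) by (auto elim: AE_E)
  have [measurable]: "indicator N \<in> borel_measurable (lborel_on (insert i I))" using N(1) by simp
  have "(\<integral>\<^sup>+y. \<integral>\<^sup>+t. indicator N (y(i := t)) \<partial>lborel \<partial>lborel_on I) = (0::ennreal)"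
    using N by (subst product_nn_integral_insert[symmetric]) (auto simp: I)
  moreover have "(\<lambda>(y, t). indicator N (y(i := t)) :: ennreal) \<in> borel_measurable (lborel_on I \<Otimes>\<^sub>M lborel)"
    by measurable
  ultimately have null: "AE y in lborel_on I. (\<integral>\<^sup>+t. indicator N (y(i := t)) \<partial>lborel) = (0::ennreal)"
    by (subst (asm) nn_integral_0_iff_AE) (auto simp: lborel.borel_measurable_nn_integral)
  have "AE t in lborel. P (y(i := t))"
    if y: "y \<in> space (lborel_on I)" and 0: "(\<integral>\<^sup>+t. indicator N (y(i := t)) \<partial>lborel) = (0::ennreal)" for y
  proof -
    have "(\<lambda>t. indicator N (y(i := t)) :: ennreal) \<in> borel_measurable lborel" using y by measurable
    then have "AE t in lborel. indicator N (y(i := t)) = (0::ennreal)"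
      using 0 by (subst (asm) nn_integral_0_iff_AE) auto
    then show ?thesis
    proof eventually_elim
      case (elim t)
      then have "y(i := t) \<notin> N" by (auto split: split_indicator_asm)
      moreover have "y(i := t) \<in> space (lborel_on (insert i I))" using y by (auto simp: space_PiM PiE_def extensional_def)
      ultimately show "P (y(i := t))" using N(3) by auto
    qed
  qed
  then show ?thesis by (intro AE_mp[OF null AE_I2]) blast
qed

lemma atLeastAtMost_Suc_insert: "k < m \<Longrightarrow> {Suc k..m} = insert (Suc k) {Suc (Suc k)..m}"
  by auto

text \<open>Peeling off one variable at a time keeps the exceptional set null. This allows a Borel
  representative to stand for a Lebesgue measurable function.\<close>

lemma iterated_norm_AE_cong:
  fixes F F' :: "(nat \<Rightarrow> 'a::euclidean_space) \<Rightarrow> ennreal"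
  assumes "AE y in lborel_on {1..m}. F y = F' y" "k \<le> m"
  shows "AE y in lborel_on {Suc k..m}. iterated_norm p k F y = iterated_norm p k F' y"
  using assms(2)
proof (induction k)
  case (Suc k)
  then have "AE y in lborel_on (insert (Suc k) {Suc (Suc k)..m}). iterated_norm p k F y = iterated_norm p k F' y"
    by (subst atLeastAtMost_Suc_insert[symmetric]) auto
  from AE_lborel_on_insert[OF _ _ this]
  have "AE y in lborel_on {Suc (Suc k)..m}. AE t in lborel.
    iterated_norm p k F (y(Suc k := t)) = iterated_norm p k F' (y(Suc k := t))" by simp
  then show ?case
    by eventually_elim (auto intro!: Lp_norm_AE_cong simp: AE_completion_iff)
next
  case 0
  show ?case using assms(1) unfolding One_nat_def by simp
qed

lemma iterated_norm_measurable:
  fixes F :: "(nat \<Rightarrow> 'a::euclidean_space) \<Rightarrow> ennreal"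
  assumes "F \<in> borel_measurable (lborel_on {1..m})" "k \<le> m"
  shows "iterated_norm p k F \<in> borel_measurable (lborel_on {Suc k..m})"
  using assms(2)
proof (induction k)
  case (Suc k)
  then have [measurable]: "iterated_norm p k F \<in> borel_measurable (lborel_on (insert (Suc k) {Suc (Suc k)..m}))"
    by (subst atLeastAtMost_Suc_insert[symmetric]) auto
  have "(\<lambda>(y, t). iterated_norm p k F (y(Suc k := t))) \<in> borel_measurable (lborel_on {Suc (Suc k)..m} \<Otimes>\<^sub>M lborel)"
    by measurable
  then have "(\<lambda>y. Lp_norm lebesgue (p (Suc k)) (\<lambda>t. iterated_norm p k F (y(Suc k := t)))) \<in> borel_measurable (lborel_on {Suc (Suc k)..m})"
    by (rule Lp_norm_measurable)
  then show ?case by simp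
next
  case 0
  have "iterated_norm p 0 F = F" by auto
  then show ?case using assms(1) unfolding One_nat_def by simp
qed

text \<open>Split at distance \<open>s\<close> from \<open>x\<close>: the ball contributes
  \<open>V * s ^ n * s powr - b\<close>, and the complement a convergent tail of the same order
  because \<open>b\<close> exceeds the dimension.\<close>

lemma nn_integral_kern_shift:
  fixes b s :: real
  assumes b: "DIM('a::euclidean_space) < b" and s: "0 < s"
  shows "(\<integral>\<^sup>+t. kern b (norm (x - t) + s) \<partial>(lborel :: 'a measure)) \<le>
    ennreal (unit_ball_vol DIM('a) * (1 + DIM('a) / (b - DIM('a)))) * kern (b - DIM('a)) s"
proof -
  let ?n = "real DIM('a)" and ?V = "unit_ball_vol DIM('a)"
  have "(\<integral>\<^sup>+t. kern b (norm (x - t) + s) \<partial>lborel) \<le>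
    (\<integral>\<^sup>+t. kern b s * indicator {t. norm (t - x) < s} t + kern b (norm (t - x)) * indicator {t. s \<le> norm (t - x)} t \<partial>lborel)"
  proof (intro nn_integral_mono)
    fix t
    show "kern b (norm (x - t) + s) \<le> kern b s * indicator {t. norm (t - x) < s} t + kern b (norm (t - x)) * indicator {t. s \<le> norm (t - x)} t"
    proof (cases "norm (x - t) < s")
      case True
      have "kern b (norm (x - t) + s) \<le> kern b s"
        using s b by (intro kern_mono) auto
      then show ?thesis using True by (simp add: dist_norm norm_minus_commute[of t x])
    next
      case False
      have "kern b (norm (x - t) + s) \<le> kern b (norm (x - t))"
        using s b by (intro kern_mono) auto
      then show ?thesis using False by (simp add: dist_norm norm_minus_commute[of t x])
    qed
  qed
  also have "\<dots> = (\<integral>\<^sup>+t. kern b s * indicator {t. norm (t - x) < s} t \<partial>lborel) +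
      (\<integral>\<^sup>+t. kern b (norm (t - x)) * indicator {t. s \<le> norm (t - x)} t \<partial>lborel)"
    by (rule nn_integral_add; measurable)
  also have "(\<integral>\<^sup>+t. kern b (norm (t - x)) * indicator {t. s \<le> norm (t - x)} t \<partial>lborel) = ennreal (?n * ?V / (b - ?n) * s powr (?n - b))"
    using b s by (rule nn_integral_kern_compl_ball)
  also have "(\<integral>\<^sup>+t. kern b s * indicator {t. norm (t - x) < s} t \<partial>lborel) = ennreal (?V * s powr (?n - b))"
  proof -
    have "{t. norm (t - x) < s} = ball x s" by (auto simp: dist_norm norm_minus_commute)
    then have "(\<integral>\<^sup>+t. kern b s * indicator {t. norm (t - x) < s} t \<partial>lborel) = kern b s * ennreal (?V * s ^ DIM('a))"
      using s emeasure_ball[of s x] by (simp only: nn_integral_cmult_indicator borel_open open_ball sets_lborel less_imp_le)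
    also have "\<dots> = ennreal (s powr - b * (?V * s powr ?n))"
      using s by (simp only: kern_pos powr_realpow ennreal_mult'[symmetric] powr_ge_zero)
    also have "s powr - b * (?V * s powr ?n) = ?V * (s powr (- b + ?n))"
      by (simp only: powr_add mult_ac)
    finally show ?thesis by simp
  qed
  also have "ennreal (?V * s powr (?n - b)) + ennreal (?n * ?V / (b - ?n) * s powr (?n - b)) =
    ennreal (?V * s powr (?n - b) + ?n * ?V / (b - ?n) * s powr (?n - b))"
    using b by (intro ennreal_plus[symmetric]) auto
  also have "?V * s powr (?n - b) + ?n * ?V / (b - ?n) * s powr (?n - b) = ?V * (1 + ?n / (b - ?n)) * s powr - (b - ?n)"
    using b by (simp add: field_simps)
  also have "ennreal \<dots> = ennreal (?V * (1 + ?n / (b - ?n))) * kern (b - ?n) s"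
    using b s unfolding kern_pos[OF s] by (intro ennreal_mult) auto
  finally show ?thesis .
qed

lemma Lp_norm_eq_0_AE:
  assumes [measurable]: "f \<in> borel_measurable borel" and "Lp_norm lebesgue p f = 0"
  shows "AE x in lborel. f x = 0"
proof (cases "p = top")
  case True
  then have "esssup lebesgue f \<le> 0" using assms by (simp add: Lp_norm_def)
  moreover have "f \<in> borel_measurable lebesgue" by (simp add: measurable_completion)
  ultimately have "AE x in lebesgue. f x \<le> 0" by (simp only: esssup_le_iff)
  then show ?thesis by (simp add: AE_completion_iff)
next
  case False
  then have "(\<integral>\<^sup>+x. f x ennpowr enn2real p \<partial>lborel) = 0" using assms by (simp add: Lp_norm_lebesgue)
  then show ?thesis by (subst (asm) nn_integral_0_iff_AE) auto
qed

text \<open>Hoelder's inequality with the kernel in the dual exponent: its norm in \<open>t\<close>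
  is at most a constant times a power of \<open>s\<close>, by homogeneity, and for
  \<open>p > 1\<close> the positivity of the new exponent is exactly convergence at infinity. At
  \<open>s = 0\<close> the right-hand side is infinite unless \<open>A\<close> vanishes almost
  everywhere.\<close>

lemma integrate_out_variable:
  fixes l :: real and p :: ennreal
  assumes p: "1 \<le> p" and l': "0 < l - DIM('a::euclidean_space) * (1 - recip p)"
  obtains C :: real where "0 < C"
    "\<And>(A :: 'a \<Rightarrow> ennreal) x s. A \<in> borel_measurable borel \<Longrightarrow> 0 \<le> s \<Longrightarrow>
      shifted_riesz l s A x
      \<le> ennreal C * (Lp_norm lebesgue p A * kern (l - DIM('a) * (1 - recip p)) s)"
proof -
  let ?n = "real DIM('a)" and ?V = "unit_ball_vol DIM('a)"
  define th where "th = recip p"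
  have "\<exists>C>0. \<forall>(A :: 'a \<Rightarrow> ennreal) x. \<forall>s>0. A \<in> borel_measurable borel \<longrightarrow>
      shifted_riesz l s A x \<le> ennreal C * (Lp_norm lebesgue p A * kern (l - ?n * (1 - th)) s)"
  proof -
    consider "p = top" | "p = 1" | r where "p = ennreal r" "1 < r"
      using p by (cases p) (auto simp: ennreal_1[symmetric] less_le simp del: ennreal_1)
    then show ?thesis
    proof cases
      case 1
      define C where "C = ?V * (1 + ?n / (l - ?n))"
      have th: "th = 0" using 1 by (simp add: th_def)
      have l: "?n < l" using l' unfolding th_def[symmetric] th by simp
      have C: "0 < C" 
      proof -
        have "0 < ?n / (l - ?n)" using l by simp
        then show ?thesis by (simp add: C_def add_pos_pos)
      qed
      have "shifted_riesz l s A x \<le> ennreal C * (Lp_norm lebesgue p A * kern (l - ?n * (1 - th)) s)"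
        if A [measurable]: "A \<in> borel_measurable borel" and s: "0 < s" for A :: "'a \<Rightarrow> ennreal" and x s
      proof -
        have "AE t in lborel. A t \<le> Lp_norm lebesgue p A"
          using esssup_AE[of A lebesgue] 1 by (simp add: Lp_norm_def AE_completion_iff)
        then have "shifted_riesz l s A x \<le> (\<integral>\<^sup>+t. Lp_norm lebesgue p A * kern l (norm (x - t) + s) \<partial>lborel)"
          by (intro nn_integral_mono_AE) (auto elim!: eventually_mono intro!: mult_right_mono)
        also have "\<dots> = Lp_norm lebesgue p A * (\<integral>\<^sup>+t. kern l (norm (x - t) + s) \<partial>lborel)"
          by (simp add: nn_integral_cmult)
        also have "\<dots> \<le> Lp_norm lebesgue p A * (ennreal C * kern (l - ?n) s)"
          using nn_integral_kern_shift[OF l s, of x] by (intro mult_left_mono) (simp_all add: C_def)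
        finally show ?thesis by (simp add: th ac_simps)
      qed
      then show ?thesis using C by blast
    next
      case 2
      have th: "th = 1" using 2 by (simp add: th_def)
      have l: "0 < l" using l' unfolding th_def[symmetric] th by simp
      have "shifted_riesz l s A x \<le> ennreal 1 * (Lp_norm lebesgue p A * kern (l - ?n * (1 - th)) s)"
        if A [measurable]: "A \<in> borel_measurable borel" and s: "0 < s" for A :: "'a \<Rightarrow> ennreal" and x s
      proof -
        have "shifted_riesz l s A x \<le> (\<integral>\<^sup>+t. A t * kern l s \<partial>lborel)"
          using s l by (intro nn_integral_mono mult_left_mono kern_mono) auto
        then show ?thesis using 2 by (simp add: th nn_integral_multc Lp_norm_lebesgue)
      qed
      then show ?thesis by (intro exI[of _ 1]) auto
    next
      case 3
      define r' where "r' = r / (r - 1)"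
      have r': "1 / r + 1 / r' = 1" "0 < r'" using 3 by (simp_all add: r'_def field_simps)
      have th: "th = 1 / r" using 3 p by (simp add: th_def enn2real_one_divide)
      have th': "1 - th = 1 / r'" using r' th by simp
      have l: "?n < l * r'" using l' r' unfolding th_def[symmetric] th' by (simp add: field_simps)
      define D where "D = ?V * (1 + ?n / (l * r' - ?n))"
      have D: "0 < D" 
      proof -
        have "0 < ?n / (l * r' - ?n)" using l by simp
        then show ?thesis by (simp add: D_def add_pos_pos)
      qed
      have "shifted_riesz l s A x \<le> ennreal (D powr (1 / r')) * (Lp_norm lebesgue p A * kern (l - ?n * (1 - th)) s)"
        if A [measurable]: "A \<in> borel_measurable borel" and s: "0 < s" for A :: "'a \<Rightarrow> ennreal" and x s
      proof -
        have "shifted_riesz l s A x \<le>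
          Lpow r A ennpowr (1 / r) * (\<integral>\<^sup>+t. kern l (norm (x - t) + s) ennpowr r' \<partial>lborel) ennpowr (1 / r')"
          using 3 r' by (intro Hoelder_nn_integral) auto
        also have "Lpow r A ennpowr (1 / r) = Lp_norm lebesgue p A"
          using 3 by (simp add: Lp_norm_lebesgue)
        also have "(\<integral>\<^sup>+t. kern l (norm (x - t) + s) ennpowr r' \<partial>lborel) = (\<integral>\<^sup>+t. kern (l * r') (norm (x - t) + s) \<partial>lborel)"
          using s by (intro nn_integral_cong kern_ennpowr) auto
        also have "Lp_norm lebesgue p A * (\<integral>\<^sup>+t. kern (l * r') (norm (x - t) + s) \<partial>lborel) ennpowr (1 / r') \<le>
          Lp_norm lebesgue p A * (ennreal D * kern (l * r' - ?n) s) ennpowr (1 / r')"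
          using nn_integral_kern_shift[OF l s, of x] r'
          by (intro mult_left_mono ennpowr_mono) (simp_all add: D_def)
        also have "(ennreal D * kern (l * r' - ?n) s) ennpowr (1 / r') = ennreal (D powr (1 / r')) * kern ((l * r' - ?n) * (1 / r')) s"
          using D s by (simp only: ennpowr_mult) (simp add: ennpowr_ennreal kern_ennpowr)
        also have "(l * r' - ?n) * (1 / r') = l - ?n * (1 - th)"
          unfolding th' using r' by (simp add: field_simps)
        finally show ?thesis by (simp add: ac_simps)
      qed
      then show ?thesis using D by (intro exI[of _ "D powr (1 / r')"]) auto
    qed
  qed
  then obtain C where C: "0 < C" and bd: "\<And>(A :: 'a \<Rightarrow> ennreal) x s. 0 < s \<Longrightarrow> A \<in> borel_measurable borel \<Longrightarrow>
      shifted_riesz l s A x \<le> ennreal C * (Lp_norm lebesgue p A * kern (l - ?n * (1 - th)) s)"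
    by blast
  show ?thesis
  proof (rule that[OF C])
    fix A :: "'a \<Rightarrow> ennreal" and x :: 'a and s :: real
    assume A [measurable]: "A \<in> borel_measurable borel" and s: "0 \<le> s"
    show "shifted_riesz l s A x
      \<le> ennreal C * (Lp_norm lebesgue p A * kern (l - ?n * (1 - recip p)) s)"
    proof (cases "s = 0")
      case False
      then show ?thesis using bd[OF _ A, of s x] s by (simp add: th_def)
    next
      case True
      show ?thesis
      proof (cases "Lp_norm lebesgue p A = 0")
        case True
        from Lp_norm_eq_0_AE[OF A True] have "shifted_riesz l s A x = 0"
          by (subst nn_integral_0_iff_AE) auto
        then show ?thesis by simp
      next
        case False
        then show ?thesis using C True by (simp add: kern_def ennreal_mult_top)
      qed
    qed
  qed
qed

section \<open>Sufficiency\<close>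

lemma ennreal_gt_oneE:
  assumes "1 < p" "p \<noteq> top"
  obtains r where "p = ennreal r" "1 < r"
  using assms by (cases p) (auto simp: ennreal_1[symmetric] ennreal_less_iff simp del: ennreal_1)

text \<open>
  For \<open>p = q\<close> the kernel is \<open>|x - t| powr - n\<close>, which is not locally integrable; the shift \<open>s\<close> turns it
  into a Hardy kernel.
\<close>

lemma fractional_integral_bound:
  fixes p q a :: real
  assumes p: "1 < p" "p \<le> q" and a: "a = DIM('a::euclidean_space) / q + DIM('a) * (1 - 1 / p)"
  obtains C :: real where "0 \<le> C"
    "\<And>(f :: 'a \<Rightarrow> ennreal) s. f \<in> borel_measurable borel \<Longrightarrow> s \<in> borel_measurable borel \<Longrightarrow> (\<And>x. 0 \<le> s x) \<Longrightarrow>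
      p < q \<or> (\<exists>c. \<forall>x. norm (x - c) \<le> s x) \<Longrightarrow>
      Lpow q (\<lambda>x. shifted_riesz a (s x) f x) ennpowr (1 / q)
      \<le> ennreal C * Lpow p f ennpowr (1 / p)"
proof (cases "p < q")
  case True
  have a0: "0 \<le> a" using p by (simp add: a)
  obtain C where C: "0 \<le> C" "\<And>f :: 'a \<Rightarrow> ennreal. f \<in> borel_measurable borel \<Longrightarrow>
      Lpow q (riesz a f) ennpowr (1 / q)
      \<le> ennreal C * Lpow p f ennpowr (1 / p)"
    using HLS_inequality[OF p(1) True a] by blast
  show ?thesis
  proof (rule that[OF C(1)])
    fix f :: "'a \<Rightarrow> ennreal" and s :: "'a \<Rightarrow> real"
    assume f: "f \<in> borel_measurable borel" and s: "\<And>x. 0 \<le> s x"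
    have "Lpow q (\<lambda>x. shifted_riesz a (s x) f x) ennpowr (1 / q) \<le>
      Lpow q (riesz a f) ennpowr (1 / q)"
      using p s a0 by (intro ennpowr_mono nn_integral_mono mult_left_mono kern_mono) auto
    also note C(2)[OF f]
    finally show "Lpow q (\<lambda>x. shifted_riesz a (s x) f x) ennpowr (1 / q)
      \<le> ennreal C * Lpow p f ennpowr (1 / p)" .
  qed
next
  case False
  let ?n = "real DIM('a)"
  have q: "q = p" using False p by simp
  have an: "a = ?n" by (simp add: a q algebra_simps)
  obtain C where C: "0 \<le> C" "\<And>(f :: 'a \<Rightarrow> ennreal) c. f \<in> borel_measurable borel \<Longrightarrow>
      (\<integral>\<^sup>+x. (\<integral>\<^sup>+t. f t * kern ?n (norm (x - c) + norm (t - c)) \<partial>lborel) ennpowr p \<partial>lborel)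
      \<le> ennreal C * Lpow p f"
    using Hardy_inequality[OF p(1)] by blast
  \<comment> \<open>At \<open>T = 0\<close> both sides are \<open>top\<close>.\<close>
  have half: "kern ?n (T / 2) = ennreal (2 powr ?n) * kern ?n T" if "0 \<le> T" for T
    using that by (auto simp: kern_def ennreal_mult_top powr_divide powr_minus ennreal_mult'[symmetric] field_simps)
  show ?thesis
  proof (rule that[of "2 powr ?n * C powr (1 / p)"])
    fix f :: "'a \<Rightarrow> ennreal" and s :: "'a \<Rightarrow> real"
    assume f [measurable]: "f \<in> borel_measurable borel" and [measurable]: "s \<in> borel_measurable borel"
      and s: "\<And>x. 0 \<le> s x" and "p < q \<or> (\<exists>c. \<forall>x. norm (x - c) \<le> s x)"
    then obtain c where c: "\<And>x. norm (x - c) \<le> s x" using False by auto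
    have le: "kern a (norm (x - t) + s x) \<le> ennreal (2 powr ?n) * kern ?n (norm (x - c) + norm (t - c))" for x t
    proof -
      have "norm (t - c) \<le> norm (x - t) + norm (x - c)"
        using norm_triangle_ineq[of "t - x" "x - c"] by (simp add: norm_minus_commute)
      moreover have "norm (x - c) \<le> s x" by (rule c)
      moreover have "0 \<le> norm (x - t)" by simp
      ultimately have "norm (x - c) + norm (t - c) \<le> 2 * (norm (x - t) + s x)" by argo
      then have "(norm (x - c) + norm (t - c)) / 2 \<le> norm (x - t) + s x" by simp
      then have "kern a (norm (x - t) + s x) \<le> kern ?n ((norm (x - c) + norm (t - c)) / 2)"
        unfolding an by (intro kern_mono) auto
      then show ?thesis by (simp add: half)
    qed
    have "Lpow q (\<lambda>x. shifted_riesz a (s x) f x)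
      \<le> (\<integral>\<^sup>+x. (\<integral>\<^sup>+t. f t * (ennreal (2 powr ?n) * kern ?n (norm (x - c) + norm (t - c))) \<partial>lborel) ennpowr p \<partial>lborel)"
      unfolding q using p le by (intro ennpowr_mono nn_integral_mono mult_left_mono) auto
    also have "\<dots> = (\<integral>\<^sup>+x. (ennreal (2 powr ?n) * (\<integral>\<^sup>+t. f t * kern ?n (norm (x - c) + norm (t - c)) \<partial>lborel)) ennpowr p \<partial>lborel)"
      by (subst nn_integral_cmult[symmetric]) (simp_all add: ac_simps)
    also have "\<dots> = ennreal (2 powr ?n) ennpowr p * (\<integral>\<^sup>+x. (\<integral>\<^sup>+t. f t * kern ?n (norm (x - c) + norm (t - c)) \<partial>lborel) ennpowr p \<partial>lborel)"
      by (rule nn_integral_cmult_ennpowr) measurable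
    also have "\<dots> \<le> ennreal (2 powr ?n) ennpowr p * (ennreal C * Lpow p f)"
      by (intro mult_left_mono C f) auto
    finally have "Lpow q (\<lambda>x. shifted_riesz a (s x) f x) ennpowr (1 / q)
      \<le> (ennreal (2 powr ?n) ennpowr p * (ennreal C * Lpow p f)) ennpowr (1 / p)"
      unfolding q using p by (intro ennpowr_mono) auto
    also have "\<dots> = ennreal (2 powr ?n) * (ennreal (C powr (1 / p)) * Lpow p f ennpowr (1 / p))"
      using p C by (simp only: ennpowr_mult ennpowr_inverse_cancel ennpowr_ennreal)
    finally show "Lpow q (\<lambda>x. shifted_riesz a (s x) f x) ennpowr (1 / q)
      \<le> ennreal (2 powr ?n * C powr (1 / p)) * Lpow p f ennpowr (1 / p)"
      by (simp add: ennreal_mult' mult.assoc)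
  qed auto
qed

text \<open>Each step needs a positive exponent after it, hence the condition for all
  \<open>k \<le> K\<close>. The constant is chosen before \<open>F\<close> and \<open>x\<close>, so
  that constants simply multiply along the induction.\<close>

lemma integrate_out_variables:
  fixes lam :: real and p :: "nat \<Rightarrow> ennreal"
  assumes p: "\<And>i. i \<in> {1..m} \<Longrightarrow> 1 \<le> p i"
    and pos: "\<And>k. k \<le> K \<Longrightarrow> 0 < lam - DIM('a::euclidean_space) * (\<Sum>i=1..k. 1 - recip (p i))"
    and "K \<le> m"
  shows "\<exists>C>0. \<forall>(F :: (nat \<Rightarrow> 'a) \<Rightarrow> ennreal) x. F \<in> borel_measurable (lborel_on {1..m} :: (nat \<Rightarrow> 'a) measure) \<longrightarrow>
    (J_nn m lam F x)
    \<le> ennreal C * (\<integral>\<^sup>+y. iterated_norm p K F y *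
        kern (lam - DIM('a) * (\<Sum>i=1..K. 1 - recip (p i))) (\<Sum>i=Suc K..m. norm (x - y i)) \<partial>lborel_on {Suc K..m})"
  using pos \<open>K \<le> m\<close>
proof (induction K)
  case 0
  show ?case by (intro exI[of _ 1]) simp
next
  case (Suc K)
  let ?l = "\<lambda>k. lam - DIM('a) * (\<Sum>i=1..k. 1 - recip (p i))"
  have l_Suc: "?l (Suc K) = ?l K - DIM('a) * (1 - recip (p (Suc K)))" by (simp add: algebra_simps)
  obtain C where C: "0 < C" "\<And>F x. F \<in> borel_measurable (lborel_on {1..m} :: (nat \<Rightarrow> 'a) measure) \<Longrightarrow>
    (J_nn m lam F x)
    \<le> ennreal C * J_tail m p K (?l K) F x"
  proof -
    have "\<exists>C>0. \<forall>(F :: (nat \<Rightarrow> 'a) \<Rightarrow> ennreal) x. F \<in> borel_measurable (lborel_on {1..m} :: (nat \<Rightarrow> 'a) measure) \<longrightarrow>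
      (J_nn m lam F x)
      \<le> ennreal C * J_tail m p K (?l K) F x"
      by (rule Suc.IH) (use Suc.prems in auto)
    then show ?thesis using that by blast
  qed
  have posK: "0 < ?l K - DIM('a) * (1 - recip (p (Suc K)))"
    using Suc.prems(1)[of "Suc K"] unfolding l_Suc by simp
  have pK: "1 \<le> p (Suc K)" using p Suc.prems by simp
  obtain D where D: "0 < D" "\<And>(A :: 'a \<Rightarrow> ennreal) x s. A \<in> borel_measurable borel \<Longrightarrow> 0 \<le> s \<Longrightarrow>
      shifted_riesz (?l K) s A x
      \<le> ennreal D * (Lp_norm lebesgue (p (Suc K)) A * kern (?l (Suc K)) s)"
    unfolding l_Suc by (rule integrate_out_variable[OF pK posK]) blast
  interpret product_sigma_finite "\<lambda>_::nat. lborel :: 'a measure" by (rule product_sigma_finite_lborel)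
  let ?J = "{Suc (Suc K)..m}"
  have ins: "{Suc K..m} = insert (Suc K) ?J" using Suc.prems by auto
  show ?case
  proof (intro exI[of _ "C * D"] conjI allI impI)
    fix F :: "(nat \<Rightarrow> 'a) \<Rightarrow> ennreal" and x :: 'a
    assume F: "F \<in> borel_measurable (lborel_on {1..m} :: (nat \<Rightarrow> 'a) measure)"
    have [measurable]: "iterated_norm p K F \<in> borel_measurable (lborel_on (insert (Suc K) ?J))"
      unfolding ins[symmetric] using Suc.prems by (intro iterated_norm_measurable F) simp
    have [measurable]: "iterated_norm p (Suc K) F \<in> borel_measurable (lborel_on ?J)"
      using Suc.prems by (intro iterated_norm_measurable F) simp
    have "J_tail m p K (?l K) F x
      = (\<integral>\<^sup>+y. \<integral>\<^sup>+t. iterated_norm p K F (y(Suc K := t)) * kern (?l K) (\<Sum>i\<in>insert (Suc K) ?J. norm (x - (y(Suc K := t)) i)) \<partial>lborel \<partial>lborel_on ?J)"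
      unfolding ins by (subst product_nn_integral_insert) auto
    also have "\<dots> \<le> (\<integral>\<^sup>+y. ennreal D * (iterated_norm p (Suc K) F y * kern (?l (Suc K)) (\<Sum>i\<in>?J. norm (x - y i))) \<partial>lborel_on ?J)"
    proof (rule nn_integral_mono)
      fix y :: "nat \<Rightarrow> 'a" assume y: "y \<in> space (lborel_on ?J)"
      have "(\<lambda>t. iterated_norm p K F (y(Suc K := t))) \<in> borel_measurable lborel" using y by measurable
      then have A: "(\<lambda>t. iterated_norm p K F (y(Suc K := t))) \<in> borel_measurable borel" by simp
      have "(\<Sum>i\<in>insert (Suc K) ?J. norm (x - (y(Suc K := t)) i)) = norm (x - t) + (\<Sum>i\<in>?J. norm (x - y i))" for t
        by (subst sum.insert) (auto intro!: sum.cong)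
      then show "(\<integral>\<^sup>+t. iterated_norm p K F (y(Suc K := t)) * kern (?l K) (\<Sum>i\<in>insert (Suc K) ?J. norm (x - (y(Suc K := t)) i)) \<partial>lborel)
        \<le> ennreal D * (iterated_norm p (Suc K) F y * kern (?l (Suc K)) (\<Sum>i\<in>?J. norm (x - y i)))"
        using D(2)[OF A, of "\<Sum>i\<in>?J. norm (x - y i)" x] by (simp add: sum_nonneg)
    qed
    also have "\<dots> = ennreal D * J_tail m p (Suc K) (?l (Suc K)) F x"
      by (rule nn_integral_cmult) measurable
    finally have *: "J_tail m p K (?l K) F x
      \<le> ennreal D * J_tail m p (Suc K) (?l (Suc K)) F x" .
    note C(2)[OF F, of x]
    also note mult_left_mono[OF *, of "ennreal C"]
    finally show "(J_nn m lam F x)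
      \<le> ennreal (C * D) * J_tail m p (Suc K) (?l (Suc K)) F x"
      using C(1) by (simp add: ennreal_mult' mult.assoc)
  qed (use C D in simp)
qed

text \<open>A norm with exponent \<open>1\<close> is an integral, so Tonelli merges the remaining
  norms. The induction runs downwards from \<open>k = m\<close>, where the product measure is
  concentrated on the single point \<open>\<lambda>_. undefined\<close>.\<close>

lemma nn_integral_iterated_norm_tail:
  fixes F :: "(nat \<Rightarrow> 'a::euclidean_space) \<Rightarrow> ennreal"
  assumes F: "F \<in> borel_measurable (lborel_on {1..m})" and "k \<le> m"
    and p: "\<And>i. k < i \<Longrightarrow> i \<le> m \<Longrightarrow> p i = 1"
  shows "(\<integral>\<^sup>+y. iterated_norm p k F y \<partial>lborel_on {Suc k..m}) = iterated_norm p m F (\<lambda>_. undefined)"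
proof -
  interpret product_sigma_finite "\<lambda>_::nat. lborel :: 'a measure" by (rule product_sigma_finite_lborel)
  show ?thesis
    using \<open>k \<le> m\<close> p
  proof (induction rule: inc_induct)
    case base
    then show ?case by (simp add: nn_integral_empty)
  next
    case (step k)
    have ins: "{Suc k..m} = insert (Suc k) {Suc (Suc k)..m}" using step by auto
    have [measurable]: "iterated_norm p k F \<in> borel_measurable (lborel_on (insert (Suc k) {Suc (Suc k)..m}))"
      unfolding ins[symmetric] using step by (intro iterated_norm_measurable F) simp
    have e: "iterated_norm p (Suc k) F = (\<lambda>y. \<integral>\<^sup>+t. iterated_norm p k F (y(Suc k := t)) \<partial>lborel)"
      using step by (auto simp: fun_eq_iff Lp_norm_lebesgue)
    have "(\<integral>\<^sup>+y. iterated_norm p k F y \<partial>lborel_on {Suc k..m}) =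
      (\<integral>\<^sup>+y. iterated_norm p (Suc k) F y \<partial>lborel_on {Suc (Suc k)..m})"
      unfolding ins e by (subst product_nn_integral_insert) auto
    then show ?case using step by simp
  qed
qed

text \<open>With \<open>K = i0 - 1\<close> variables integrated out, the exponent that remains is
  the one of \<open>fractional_integral_bound\<close> for the pair \<open>p i0\<close>,
  \<open>q\<close>. That bound is uniform in the later variables, which enter only through the shift
  \<open>s y x\<close>, so Minkowski's inequality can integrate over them.\<close>

lemma mixed_norm_bound:
  fixes lam q :: real and p :: "nat \<Rightarrow> ennreal"
  assumes p: "\<And>i. i \<in> {1..m} \<Longrightarrow> 1 \<le> p i" and i0: "i0 \<in> {1..m}" "1 < p i0" "p i0 \<noteq> top"
    and tail: "\<And>i. i0 < i \<Longrightarrow> i \<le> m \<Longrightarrow> p i = 1"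
    and q: "enn2real (p i0) \<le> q" "i0 = m \<Longrightarrow> enn2real (p i0) < q"
    and scaling: "DIM('a::euclidean_space) * (\<Sum>i=1..m. 1 - recip (p i)) = lam - DIM('a) / q"
  shows "\<exists>C\<ge>0. \<forall>F. F \<in> borel_measurable (lborel_on {1..m} :: (nat \<Rightarrow> 'a) measure) \<longrightarrow>
    Lpow q (J_nn m lam F) ennpowr (1 / q)
    \<le> ennreal C * iterated_norm p m F (\<lambda>_. undefined)"
proof -
  let ?n = "real DIM('a)" and ?th = "\<lambda>i. recip (p i)"
  let ?l = "\<lambda>k. lam - ?n * (\<Sum>i=1..k. 1 - ?th i)"
  obtain r where pr: "p i0 = ennreal r" "1 < r"
    using ennreal_gt_oneE[OF i0(2,3)] by metis
  have r_def: "r = enn2real (p i0)" using pr by simp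
  have thr: "?th i0 = 1 / r" using enn2real_one_divide[OF order_less_le_trans[OF zero_less_one p[OF i0(1)]]] by (simp add: r_def)
  have rq: "r \<le> q" "i0 = m \<Longrightarrow> r < q" using q by (simp_all add: r_def)
  have q1: "1 < q" using pr rq by simp
  have th_le: "?th i \<le> 1" if "i \<in> {1..m}" for i
  proof -
    have "1 / p i \<le> 1" using p[OF that] by (intro divide_le_posI_ennreal) (auto intro: order_less_le_trans[OF zero_less_one])
    then show ?thesis using enn2real_mono[of "1 / p i" 1] by simp
  qed
  have l_eq: "?l k = ?n / q + ?n * (\<Sum>i=Suc k..m. 1 - ?th i)" if "k \<le> m" for k
  proof -
    have "(\<Sum>i=1..m. 1 - ?th i) = (\<Sum>i=1..k. 1 - ?th i) + (\<Sum>i=Suc k..m. 1 - ?th i)"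
    proof -
      have "{1..m} = {1..k} \<union> {Suc k..m}" using that by auto
      then show ?thesis by (simp only: sum.union_disjoint finite_atLeastAtMost ivl_disj_int_two)
         (rule sum.union_disjoint; auto)
    qed
    then show ?thesis using scaling by (simp add: algebra_simps)
  qed
  define K where "K = i0 - 1"
  have K: "Suc K = i0" "K \<le> m" using i0 by (auto simp: K_def)
  have "0 < ?l k" if "k \<le> K" for k
  proof -
    have "0 \<le> (\<Sum>i=Suc k..m. 1 - ?th i)" using th_le by (intro sum_nonneg) simp
    then have "0 < ?n / q + ?n * (\<Sum>i=Suc k..m. 1 - ?th i)" using q1 by (intro add_pos_nonneg) auto
    then show ?thesis using l_eq[of k] that K by simp
  qed
  from integrate_out_variables[OF p this K(2)]
  obtain C where C: "0 < C" "\<And>F x. F \<in> borel_measurable (lborel_on {1..m} :: (nat \<Rightarrow> 'a) measure) \<Longrightarrow>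
    (J_nn m lam F x)
    \<le> ennreal C * J_tail m p K (?l K) F x"
    by blast
  let ?J = "{Suc i0..m}"
  have ins: "{Suc K..m} = insert i0 ?J" using K i0 by auto
  have "(\<Sum>i=Suc K..m. 1 - ?th i) = 1 - 1 / r"
    unfolding ins using tail by (subst sum.insert) (auto simp: thr)
  then have lK: "?l K = ?n / q + ?n * (1 - 1 / r)" using l_eq[of K] K by simp
  obtain D where D: "0 \<le> D" "\<And>(f :: 'a \<Rightarrow> ennreal) s. f \<in> borel_measurable borel \<Longrightarrow> s \<in> borel_measurable borel \<Longrightarrow> (\<And>x. 0 \<le> s x) \<Longrightarrow>
      r < q \<or> (\<exists>c. \<forall>x. norm (x - c) \<le> s x) \<Longrightarrow>
      (\<integral>\<^sup>+x. shifted_riesz (?l K) (s x) f x ennpowr q \<partial>lborel) ennpowr (1 / q)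
      \<le> ennreal D * Lpow r f ennpowr (1 / r)"
    using fractional_integral_bound[OF pr(2) rq(1) lK] by blast
  interpret product_sigma_finite "\<lambda>_::nat. lborel :: 'a measure" by (rule product_sigma_finite_lborel)
  show ?thesis
  proof (intro exI[of _ "C * D"] conjI allI impI)
    fix F :: "(nat \<Rightarrow> 'a) \<Rightarrow> ennreal"
    assume F: "F \<in> borel_measurable (lborel_on {1..m} :: (nat \<Rightarrow> 'a) measure)"
    have [measurable]: "iterated_norm p K F \<in> borel_measurable (lborel_on (insert i0 ?J))"
      unfolding ins[symmetric] using K by (intro iterated_norm_measurable F) simp
    have [measurable]: "iterated_norm p i0 F \<in> borel_measurable (lborel_on ?J)"
      using i0 by (intro iterated_norm_measurable F) simp
    define s where "s y x = (\<Sum>i\<in>?J. norm (x - y i))" for y :: "nat \<Rightarrow> 'a" and x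
    define G where "G x y = (\<integral>\<^sup>+t. iterated_norm p K F (y(i0 := t)) * kern (?l K) (norm (x - t) + s y x) \<partial>lborel)" for x :: 'a and y
    have s_meas [measurable]: "(\<lambda>(x, y). s y x) \<in> borel_measurable (borel \<Otimes>\<^sub>M lborel_on ?J)"
      unfolding s_def by measurable
    have G_meas: "(\<lambda>(x, y). G x y) \<in> borel_measurable (lborel \<Otimes>\<^sub>M lborel_on ?J)"
      unfolding G_def by measurable
    have G_eq: "J_tail m p K (?l K) F x = (\<integral>\<^sup>+y. G x y \<partial>lborel_on ?J)" for x
    proof -
      have "J_tail m p K (?l K) F x
        = (\<integral>\<^sup>+y. \<integral>\<^sup>+t. iterated_norm p K F (y(i0 := t)) * kern (?l K) (\<Sum>i\<in>insert i0 ?J. norm (x - (y(i0 := t)) i)) \<partial>lborel \<partial>lborel_on ?J)"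
        unfolding ins by (subst product_nn_integral_insert) auto
      moreover have "(\<Sum>i\<in>insert i0 ?J. norm (x - (y(i0 := t)) i)) = norm (x - t) + s y x" for t y
        unfolding s_def by (subst sum.insert) (auto intro!: sum.cong)
      ultimately show ?thesis by (simp add: G_def)
    qed
    have G_bound: "(\<integral>\<^sup>+x. G x y ennpowr q \<partial>lborel) \<le> (ennreal D * iterated_norm p i0 F y) ennpowr q"
      if y: "y \<in> space (lborel_on ?J)" for y
    proof -
      have "(\<lambda>t. iterated_norm p K F (y(i0 := t))) \<in> borel_measurable lborel" using y by measurable
      then have A: "(\<lambda>t. iterated_norm p K F (y(i0 := t))) \<in> borel_measurable borel" by simp
      have s_m: "s y \<in> borel_measurable borel" unfolding s_def by measurable
      have s0: "0 \<le> s y x" for x unfolding s_def by (intro sum_nonneg) auto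
      have "r < q \<or> (\<exists>c. \<forall>x. norm (x - c) \<le> s y x)"
      proof (cases "i0 = m")
        case False
        \<comment> \<open>Since \<open>i0 < m\<close>, the distance to \<open>y m\<close> is one of
          the summands of \<open>s y x\<close>, and \<open>y m\<close> serves as the centre of the
          Hardy kernel.\<close>
        then have "norm (x - y m) \<le> s y x" for x
          unfolding s_def using i0 by (intro member_le_sum) auto
        then show ?thesis by blast
      qed (use rq in simp)
      from D(2)[OF A s_m s0 this]
      have "(\<integral>\<^sup>+x. G x y ennpowr q \<partial>lborel) ennpowr (1 / q) \<le> ennreal D * (\<integral>\<^sup>+t. iterated_norm p K F (y(i0 := t)) ennpowr r \<partial>lborel) ennpowr (1 / r)"
        by (simp add: G_def)
      also have "(\<integral>\<^sup>+t. iterated_norm p K F (y(i0 := t)) ennpowr r \<partial>lborel) ennpowr (1 / r) = iterated_norm p (Suc K) F y"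
        unfolding iterated_norm.simps(2) unfolding K(1) using pr by (simp add: Lp_norm_lebesgue)
      finally show ?thesis using q1 by (simp add: ennpowr_inverse_le_iff K)
    qed
    have "Lpow q (J_nn m lam F)
      \<le> (\<integral>\<^sup>+x. (ennreal C * (\<integral>\<^sup>+y. G x y \<partial>lborel_on ?J)) ennpowr q \<partial>lborel)"
      using q1 C(2)[OF F] unfolding G_eq by (intro nn_integral_mono ennpowr_mono) auto
    also have "\<dots> = ennreal C ennpowr q * (\<integral>\<^sup>+x. (\<integral>\<^sup>+y. G x y \<partial>lborel_on ?J) ennpowr q \<partial>lborel)"
      using G_meas sigma_finite[of ?J] by (intro nn_integral_cmult_ennpowr sigma_finite_measure.borel_measurable_nn_integral) simp_all
    also have "\<dots> \<le> ennreal C ennpowr q * (\<integral>\<^sup>+y. ennreal D * iterated_norm p i0 F y \<partial>lborel_on ?J) ennpowr q"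
      using q1 by (intro mult_left_mono Minkowski_nn_integral sigma_finite G_meas G_bound lborel.sigma_finite_measure_axioms) auto
    also have "(\<integral>\<^sup>+y. ennreal D * iterated_norm p i0 F y \<partial>lborel_on ?J) = ennreal D * iterated_norm p m F (\<lambda>_. undefined)"
      using nn_integral_iterated_norm_tail[OF F, of i0 p] tail i0 by (simp add: nn_integral_cmult)
    also have "ennreal C ennpowr q * (ennreal D * iterated_norm p m F (\<lambda>_. undefined)) ennpowr q =
      (ennreal (C * D) * iterated_norm p m F (\<lambda>_. undefined)) ennpowr q"
      using C by (simp add: ennpowr_mult[symmetric] ennreal_mult' mult.assoc)
    finally show "Lpow q (J_nn m lam F) ennpowr (1 / q)
      \<le> ennreal (C * D) * iterated_norm p m F (\<lambda>_. undefined)"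
      using q1 by (simp add: ennpowr_inverse_le_iff)
  qed (use C D in simp)
qed

text \<open>After all \<open>m\<close> norms the almost everywhere statement lives on a one-point
  space of positive mass, where it is an equality.\<close>

lemma iterated_norm_full_AE_cong:
  fixes F F' :: "(nat \<Rightarrow> 'a::euclidean_space) \<Rightarrow> ennreal"
  assumes "AE y in lborel_on {1..m}. F y = F' y"
  shows "iterated_norm p m F (\<lambda>_. undefined) = iterated_norm p m F' (\<lambda>_. undefined)"
proof -
  have "{Suc m..m} = {}" by simp
  then show ?thesis
    using iterated_norm_AE_cong[OF assms order_refl, of p]
    by (simp only: PiM_empty AE_count_space) simp
qed

lemma ennreal_norm_J_integrand:
  "ennreal (norm (J_integrand m lam f x y)) =
    ennreal (norm (f y)) * ennreal ((\<Sum>i=1..m. norm (x - y i)) powr - lam)"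
  by (simp add: J_integrand_def norm_divide norm_mult norm_inverse powr_minus divide_inverse ennreal_mult')

text \<open>One majorant \<open>T\<close> does both jobs: it is finite almost everywhere because its
  \<open>L^q\<close> norm is finite, which gives absolute convergence, and it dominates the modulus
  of \<open>J m lam f\<close>.\<close>

lemma J_norm_estimate_if:
  fixes lam :: real and p :: "nat \<Rightarrow> ennreal"
  assumes q: "0 < q" "q \<noteq> top"
    and C: "0 \<le> C" "\<And>F. F \<in> borel_measurable (lborel_on {1..m} :: (nat \<Rightarrow> 'a::euclidean_space) measure) \<Longrightarrow>
      Lpow (enn2real q) (J_nn m lam F) ennpowr (1 / enn2real q)
      \<le> ennreal C * iterated_norm p m F (\<lambda>_. undefined)"
  shows "J_norm_estimate TYPE('a) m lam p q"
  unfolding J_norm_estimate_def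
proof (intro exI[of _ C] allI impI)
  fix f :: "(nat \<Rightarrow> 'a) \<Rightarrow> complex" assume "f \<in> mixed_Lebesgue m p"
  then have f [measurable]: "f \<in> borel_measurable (completion (lborel_on {1..m}))" and fin: "mixed_norm m p f < top"
    by (auto simp: mixed_Lebesgue_def lebesgue_tuple_def)
  have "(\<lambda>y. ennreal (norm (f y))) \<in> borel_measurable (completion (lborel_on {1..m}))"
    by measurable
  then obtain F where F [measurable]: "F \<in> borel_measurable (lborel_on {1..m})"
    and AE: "AE y in lborel_on {1..m}. ennreal (norm (f y)) = F y"
    using completion_ex_borel_measurable by blast
  have norm_eq: "mixed_norm m p f = iterated_norm p m F (\<lambda>_. undefined)"
    unfolding mixed_norm_def by (rule iterated_norm_full_AE_cong[OF AE])
  define T where "T x = (J_nn m lam F x)" for x :: 'a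
  interpret product_sigma_finite "\<lambda>_::nat. lborel :: 'a measure" by (rule product_sigma_finite_lborel)
  interpret S: sigma_finite_measure "lborel_on {1..m} :: (nat \<Rightarrow> 'a) measure" by (rule sigma_finite) simp
  have [measurable]: "T \<in> borel_measurable borel" unfolding T_def by measurable
  let ?q = "enn2real q"
  have q0: "0 < ?q" using q by (simp add: enn2real_positive_iff less_top)
  have bound: "Lpow ?q T ennpowr (1 / ?q) \<le> ennreal C * mixed_norm m p f"
    using C(2)[OF F] by (simp add: T_def norm_eq)
  have le_T: "(\<integral>\<^sup>+y. ennreal (norm (J_integrand m lam f x y)) \<partial>lebesgue_tuple m) \<le> T x" for x
  proof -
    have "(\<integral>\<^sup>+y. ennreal (norm (J_integrand m lam f x y)) \<partial>lebesgue_tuple m) =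
      (\<integral>\<^sup>+y. F y * ennreal ((\<Sum>i=1..m. norm (x - y i)) powr - lam) \<partial>lborel_on {1..m})"
      unfolding ennreal_norm_J_integrand lebesgue_tuple_def nn_integral_completion
      by (intro nn_integral_cong_AE) (use AE in eventually_elim, simp)
    \<comment> \<open>On the diagonal \<open>0 powr - lam = 0\<close>, whereas
      \<open>kern lam 0 = top\<close>; elsewhere the two kernels agree.\<close>
    also have "\<dots> \<le> T x"
      unfolding T_def by (intro nn_integral_mono mult_left_mono) (auto simp: kern_def)
    finally show ?thesis .
  qed
  have "Lpow ?q T ennpowr (1 / ?q) < top"
    by (rule le_less_trans[OF bound]) (use fin in \<open>simp add: ennreal_mult_less_top\<close>)
  then have "Lpow ?q T \<noteq> \<infinity>" by simp
  then have "AE x in lborel. T x ennpowr ?q \<noteq> \<infinity>"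
    by (intro nn_integral_PInf_AE) auto
  then have "AE x in lborel. integrable (lebesgue_tuple m) (J_integrand m lam f x)"
  proof eventually_elim
    case (elim x)
    have "(\<lambda>y. complex_of_real ((\<Sum>i=1..m. norm (x - y i)) powr lam)) \<in> borel_measurable (lborel_on {1..m})"
      by measurable
    then have [measurable]: "(\<lambda>y. complex_of_real ((\<Sum>i=1..m. norm (x - y i)) powr lam)) \<in> borel_measurable (completion (lborel_on {1..m}))"
      by (rule measurable_completion)
    have "J_integrand m lam f x \<in> borel_measurable (lebesgue_tuple m)"
      unfolding J_integrand_def lebesgue_tuple_def by measurable
    then show ?case
      using elim le_T[of x] by (auto simp: integrable_iff_bounded less_top intro: le_less_trans)
  qed
  then have 1: "AE x in lebesgue. integrable (lebesgue_tuple m) (J_integrand m lam f x)"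
    by (simp add: AE_completion_iff)
  have "ennreal (norm (J m lam f x)) \<le> T x" for x
  proof (cases "integrable (lebesgue_tuple m) (J_integrand m lam f x)")
    case True
    then show ?thesis unfolding J_def by (intro order_trans[OF integral_norm_bound_ennreal le_T])
  qed (simp add: J_def not_integrable_integral_eq)
  then have "Lp_norm lebesgue q (\<lambda>x. ennreal (norm (J m lam f x))) \<le> Lpow ?q T ennpowr (1 / ?q)"
    using q q0 by (simp add: Lp_norm_lebesgue) (intro ennpowr_mono nn_integral_mono; simp)
  then show "(AE x in lebesgue. integrable (lebesgue_tuple m) (J_integrand m lam f x)) \<and>
      Lp_norm lebesgue q (\<lambda>x. ennreal (norm (J m lam f x))) \<le> ennreal C * mixed_norm m p f"
    using 1 bound by (auto intro: order_trans)
qed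

section \<open>Necessity\<close>

text \<open>\<open>kern lam\<close> and the real power differ only where every \<open>y i\<close>
  equals \<open>x\<close>; this shows that such tuples are negligible.\<close>

lemma AE_lborel_on_component_neq:
  assumes "i \<in> I" "finite I"
  shows "AE y in lborel_on I. y i \<noteq> (x :: 'a::euclidean_space)"
proof -
  interpret product_sigma_finite "\<lambda>_::nat. lborel :: 'a measure" by (rule product_sigma_finite_lborel)
  let ?A = "\<lambda>j. if j = i then {x} else UNIV"
  have "emeasure (lborel_on I) (PiE I ?A) = (\<Prod>j\<in>I. emeasure lborel (?A j))"
    using assms by (intro emeasure_PiM) auto
  also have "\<dots> = 0" using assms by (intro prod_zero) auto
  finally have 0: "emeasure (lborel_on I) (PiE I ?A) = 0" .
  have "PiE I ?A \<in> null_sets (lborel_on I)"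
    using 0 assms by (intro null_setsI sets_PiM_I_finite) auto
  then show ?thesis
    by (rule AE_I') (auto simp: space_PiM PiE_def Pi_def)
qed

text \<open>The form in which test functions are inserted: real values make \<open>F\<close> an
  admissible complex function, \<open>J_nn\<close> raises no question of convergence, and the
  constant is a parameter that can be compared for all \<open>R\<close>.\<close>

definition nonneg_estimate ::
  "'a::euclidean_space itself \<Rightarrow> nat \<Rightarrow> real \<Rightarrow> (nat \<Rightarrow> ennreal) \<Rightarrow> ennreal \<Rightarrow> real \<Rightarrow> bool" where
  "nonneg_estimate _ m lam p q C \<longleftrightarrow> 0 \<le> C \<and>
    (\<forall>F :: (nat \<Rightarrow> 'a) \<Rightarrow> real. F \<in> borel_measurable (lborel_on {1..m}) \<longrightarrow> (\<forall>y. 0 \<le> F y) \<longrightarrow>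
      iterated_norm p m (\<lambda>y. ennreal (F y)) (\<lambda>_. undefined) < top \<longrightarrow>
      Lp_norm lebesgue q (J_nn m lam (\<lambda>y. ennreal (F y)))
      \<le> ennreal C * iterated_norm p m (\<lambda>y. ennreal (F y)) (\<lambda>_. undefined))"

text \<open>For \<open>F \<ge> 0\<close> the clause on absolute convergence identifies
  \<open>J\<close> with \<open>J_nn\<close> almost everywhere; without it a divergent integral would
  count as \<open>0\<close>. The given constant may be negative, hence
  \<open>max 0 C\<close>.\<close>

lemma J_norm_estimate_nonneg:
  fixes lam :: real and p :: "nat \<Rightarrow> ennreal"
  assumes "J_norm_estimate TYPE('a::euclidean_space) m lam p q" "1 \<le> m"
  shows "\<exists>C. nonneg_estimate TYPE('a) m lam p q C"
proof -
  obtain C :: real where C: "\<And>f :: (nat \<Rightarrow> 'a) \<Rightarrow> complex. f \<in> mixed_Lebesgue m p \<Longrightarrow>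
      (AE x in lebesgue. integrable (lebesgue_tuple m) (J_integrand m lam f x)) \<and>
      Lp_norm lebesgue q (\<lambda>x. ennreal (norm (J m lam f x))) \<le> ennreal C * mixed_norm m p f"
    using assms(1) unfolding J_norm_estimate_def by blast
  have "Lp_norm lebesgue q (J_nn m lam (\<lambda>y. ennreal (F y)))
      \<le> ennreal (max 0 C) * iterated_norm p m (\<lambda>y. ennreal (F y)) (\<lambda>_. undefined)"
    if F: "F \<in> borel_measurable (lborel_on {1..m})" and F0: "\<And>y. 0 \<le> F y"
      and fin: "iterated_norm p m (\<lambda>y. ennreal (F y)) (\<lambda>_. undefined) < top" for F :: "(nat \<Rightarrow> 'a) \<Rightarrow> real"
  proof -
    define f where "f y = complex_of_real (F y)" for y
    have norm_eq: "mixed_norm m p f = iterated_norm p m (\<lambda>y. ennreal (F y)) (\<lambda>_. undefined)"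
      using F0 by (simp add: mixed_norm_def f_def)
    have "f \<in> borel_measurable (lborel_on {1..m})" unfolding f_def using F by measurable
    then have "f \<in> mixed_Lebesgue m p"
      using fin norm_eq by (auto simp: mixed_Lebesgue_def lebesgue_tuple_def intro: measurable_completion)
    note * = C[OF this]
    let ?T = "\<lambda>x. J_nn m lam (\<lambda>y. ennreal (F y)) x"
    define g where "g x y = F y * (\<Sum>i=1..m. norm (x - y i)) powr - lam" for x y
    have g: "J_integrand m lam f x = (\<lambda>y. complex_of_real (g x y))" for x
      by (auto simp: J_integrand_def f_def g_def fun_eq_iff powr_minus divide_inverse)
    have "AE x in lebesgue. ennreal (norm (J m lam f x)) = ?T x"
      using *[THEN conjunct1]
    proof eventually_elim
      case (elim x)
      then have int: "integrable (lebesgue_tuple m) (g x)"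
        using integrable_Re[OF elim] unfolding g by simp
      have g0: "0 \<le> g x y" for y using F0 by (simp add: g_def)
      have "J m lam f x = complex_of_real (integral\<^sup>L (lebesgue_tuple m) (g x))"
        unfolding J_def g by simp
      then have "ennreal (norm (J m lam f x)) = ennreal (integral\<^sup>L (lebesgue_tuple m) (g x))"
        using g0 by simp
      also have "\<dots> = (\<integral>\<^sup>+y. ennreal (g x y) \<partial>lebesgue_tuple m)"
        using int g0 by (simp add: nn_integral_eq_integral)
      also have "\<dots> = (\<integral>\<^sup>+y. ennreal (g x y) \<partial>lborel_on {1..m})"
        by (simp add: lebesgue_tuple_def nn_integral_completion)
      also have "\<dots> = ?T x"
      proof (intro nn_integral_cong_AE)
        have "AE y in lborel_on {1..m}. y 1 \<noteq> x"
          using assms(2) by (intro AE_lborel_on_component_neq) auto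
        then show "AE y in lborel_on {1..m}. ennreal (g x y) = ennreal (F y) * kern lam (\<Sum>i=1..m. norm (x - y i))"
        proof eventually_elim
          case (elim y)
          have "0 < norm (x - y 1)" using elim by simp
          also have "\<dots> \<le> (\<Sum>i=1..m. norm (x - y i))"
            using assms(2) by (intro member_le_sum) auto
          finally show ?case using F0 by (simp add: g_def kern_pos ennreal_mult')
        qed
      qed
      finally show ?case .
    qed
    then have "Lp_norm lebesgue q ?T = Lp_norm lebesgue q (\<lambda>x. ennreal (norm (J m lam f x)))"
      by (intro Lp_norm_AE_cong) (auto elim: eventually_mono)
    also have "\<dots> \<le> ennreal C * iterated_norm p m (\<lambda>y. ennreal (F y)) (\<lambda>_. undefined)"
      using * norm_eq by simp
    also have "\<dots> \<le> ennreal (max 0 C) * iterated_norm p m (\<lambda>y. ennreal (F y)) (\<lambda>_. undefined)"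
      by (intro mult_right_mono ennreal_leI) auto
    finally show ?thesis .
  qed
  then show ?thesis unfolding nonneg_estimate_def by (intro exI[of _ "max 0 C"]) auto
qed

section \<open>Exact norms of test functions\<close>

lemma Lp_norm_zero: "0 < p \<Longrightarrow> Lp_norm lebesgue p (\<lambda>_ :: 'a::euclidean_space. 0) = 0"
  by (simp add: Lp_norm_def esssup_const)

text \<open>\<open>recip top = 0\<close> makes one formula serve all \<open>p\<close>; in that case
  positive measure of \<open>S\<close> ensures that the essential supremum sees the value
  \<open>c\<close>.\<close>

lemma Lp_norm_If:
  fixes S :: "'a::euclidean_space set"
  assumes S [measurable]: "S \<in> sets borel" and v: "emeasure lborel S = ennreal v" "0 < v" and c: "0 \<le> c" and p: "0 < p"
  shows "Lp_norm lebesgue p (\<lambda>t. ennreal (if t \<in> S then c else 0)) = ennreal (c * v powr recip p)"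
proof (cases "p = top")
  case True
  let ?f = "\<lambda>t. ennreal (if t \<in> S then c else 0)"
  have "?f \<in> borel_measurable borel" by measurable
  then have f: "?f \<in> borel_measurable lebesgue" by (simp add: measurable_completion)
  have "esssup lebesgue ?f = ennreal c"
  proof (rule antisym)
    show "esssup lebesgue ?f \<le> ennreal c" using f by (rule esssup_I) auto
    show "ennreal c \<le> esssup lebesgue ?f"
    proof (rule ccontr)
      assume "\<not> ennreal c \<le> esssup lebesgue ?f"
      then have less: "esssup lebesgue ?f < ennreal c" by simp
      have "AE t in lborel. ?f t \<le> esssup lebesgue ?f"
        using esssup_AE[of ?f lebesgue] by (simp add: AE_completion_iff)
      then have "AE t in lborel. t \<notin> S"
        by eventually_elim (use less in auto)
      then have "emeasure lborel S = 0" by (simp add: AE_iff_measurable[OF _ refl])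
      then show False using v by simp
    qed
  qed
  then show ?thesis using True v by (simp add: Lp_norm_def)
next
  case False
  have r: "0 < enn2real p" using p False by (simp add: enn2real_positive_iff less_top)
  have "(\<integral>\<^sup>+t. ennreal (if t \<in> S then c else 0) ennpowr enn2real p \<partial>lborel) = (\<integral>\<^sup>+t. ennreal (c powr enn2real p) * indicator S t \<partial>lborel)"
    using c by (intro nn_integral_cong) (auto simp: ennpowr_ennreal split: split_indicator)
  also have "\<dots> = ennreal (c powr enn2real p * v)"
    using v by (simp add: nn_integral_cmult_indicator ennreal_mult')
  finally show ?thesis
    using False r c v by (simp add: Lp_norm_lebesgue ennpowr_ennreal powr_mult powr_powr enn2real_one_divide p)
qed

lemma emeasure_annulus:
  fixes c :: "'a::euclidean_space"
  assumes "0 \<le> a" "a \<le> b"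
  shows "emeasure lborel {t. a \<le> norm (t - c) \<and> norm (t - c) < b} = ennreal (unit_ball_vol DIM('a) * (b ^ DIM('a) - a ^ DIM('a)))"
proof -
  have "{t. a \<le> norm (t - c) \<and> norm (t - c) < b} = ball c b - ball c a"
    by (auto simp: dist_norm norm_minus_commute)
  also have "emeasure lborel \<dots> = emeasure lborel (ball c b) - emeasure lborel (ball c a)"
    using assms by (intro emeasure_Diff) (auto simp: emeasure_ball subset_ball)
  also have "\<dots> = ennreal (unit_ball_vol DIM('a) * b ^ DIM('a) - unit_ball_vol DIM('a) * a ^ DIM('a))"
    using assms by (simp add: emeasure_ball ennreal_minus)
  finally show ?thesis by (simp add: algebra_simps)
qed

text \<open>The exponent \<open>- n / p\<close> is the borderline of \<open>L^p\<close>
  integrability: its \<open>p\<close>-th power is the critical kernel. For \<open>p = top\<close>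
  the profile is the constant \<open>A\<close>, and the exponent \<open>recip top = 0\<close>
  removes the logarithm.\<close>

lemma Lp_norm_annulus_powr:
  fixes c :: "'a::euclidean_space"
  assumes p: "0 < p" and R: "1 < R" and A: "0 \<le> A"
  shows "Lp_norm lebesgue p (\<lambda>t. ennreal (if 1 \<le> norm (t - c) \<and> norm (t - c) < R then A * norm (t - c) powr (- (DIM('a) * recip p)) else 0))
    = ennreal (A * (DIM('a) * unit_ball_vol DIM('a) * ln R) powr recip p)"
proof (cases "p = top")
  case True
  let ?S = "{t. 1 \<le> norm (t - c) \<and> norm (t - c) < R}"
  have eq: "(\<lambda>t. ennreal (if 1 \<le> norm (t - c) \<and> norm (t - c) < R then A * norm (t - c) powr (- (DIM('a) * recip p)) else 0))
    = (\<lambda>t. ennreal (if t \<in> ?S then A else 0))"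
    using True by (auto simp: fun_eq_iff)
  have "Lp_norm lebesgue p (\<lambda>t. ennreal (if t \<in> ?S then A else 0)) = ennreal (A * (unit_ball_vol DIM('a) * (R ^ DIM('a) - 1 ^ DIM('a))) powr recip p)"
    using R A p by (intro Lp_norm_If emeasure_annulus) (auto simp: one_less_power)
  moreover have "1 < R ^ DIM('a)" using R by (intro one_less_power) auto
  moreover have "unit_ball_vol (real DIM('a)) \<noteq> 0"
    using unit_ball_vol_pos[of "real DIM('a)"] by (metis less_irrefl of_nat_0_le_iff)
  ultimately show ?thesis unfolding eq using True R by auto
next
  case False
  let ?n = "real DIM('a)" and ?r = "enn2real p"
  have r: "0 < ?r" using p False by (simp add: enn2real_positive_iff less_top)
  have "(\<integral>\<^sup>+t. ennreal (if 1 \<le> norm (t - c) \<and> norm (t - c) < R then A * norm (t - c) powr (- (?n * recip p)) else 0) ennpowr ?r \<partial>lborel)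
    = (\<integral>\<^sup>+t. ennreal (A powr ?r) * (kern ?n (norm (t - c)) * indicator {t. 1 \<le> norm (t - c) \<and> norm (t - c) < R} t) \<partial>lborel)"
  proof (rule nn_integral_cong)
    fix t
    show "ennreal (if 1 \<le> norm (t - c) \<and> norm (t - c) < R then A * norm (t - c) powr (- (?n * recip p)) else 0) ennpowr ?r
      = ennreal (A powr ?r) * (kern ?n (norm (t - c)) * indicator {t. 1 \<le> norm (t - c) \<and> norm (t - c) < R} t)"
    proof (cases "1 \<le> norm (t - c) \<and> norm (t - c) < R")
      case True
      then have pos: "0 < norm (t - c)" by linarith
      show ?thesis
      proof -
        have "(A * norm (t - c) powr - (?n * recip p)) powr ?r = A powr ?r * norm (t - c) powr - ?n"
          using A r by (subst powr_mult) (auto simp: powr_powr enn2real_one_divide p)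
        then have "ennreal (A * norm (t - c) powr - (?n * recip p)) ennpowr ?r = ennreal (A powr ?r * norm (t - c) powr - ?n)"
          using A by (subst ennpowr_ennreal) auto
        then show ?thesis
          using True pos by (simp add: kern_pos ennreal_mult' del: zero_less_norm_iff)
      qed
    qed auto
  qed
  also have "\<dots> = ennreal (A powr ?r) * ennreal (?n * unit_ball_vol ?n * ln (R / 1))"
    using nn_integral_kern_annulus[of 1 R c] R by (subst nn_integral_cmult) auto
  also have "\<dots> = ennreal (A powr ?r * (?n * unit_ball_vol ?n * ln R))"
    by (simp add: ennreal_mult')
  finally show ?thesis
    using False r A R p by (simp add: Lp_norm_lebesgue ennpowr_ennreal powr_mult powr_powr enn2real_one_divide)
qed

text \<open>
  Since \<open>esssup\<close> of a non-measurable function is \<open>\<infinity>\<close>, iterated norms are not monotone; the norms of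
  test functions are therefore computed exactly instead of being estimated.
\<close>

lemma iterated_norm_eqI:
  assumes "\<And>y. F y = G 0 y"
    and "\<And>j y. j < k \<Longrightarrow> Lp_norm lebesgue (p (Suc j)) (\<lambda>t. G j (y(Suc j := t))) = G (Suc j) y"
  shows "iterated_norm p k F y = G k y"
  using assms(2)
proof (induction k arbitrary: y)
  case (Suc k)
  have "iterated_norm p k F z = G k z" for z
    by (rule Suc.IH) (use Suc.prems in auto)
  then show ?case by (simp only: iterated_norm.simps Suc.prems[OF lessI])
qed (simp add: assms(1))

text \<open>The first \<open>k\<close> norms overwrite only the entries
  \<open>1, \<dots>, k\<close>, so a later entry may be treated as a constant. The endpoint test
  function uses this to freeze its centre.\<close>

lemma iterated_norm_cong:
  assumes "\<And>z. (\<And>i. i \<notin> {1..k} \<Longrightarrow> z i = y i) \<Longrightarrow> F z = G z"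
  shows "iterated_norm p k F y = iterated_norm p k G y"
  using assms
proof (induction k arbitrary: y)
  case 0
  then show ?case by simp
next
  case (Suc k)
  have "iterated_norm p k F (y(Suc k := t)) = iterated_norm p k G (y(Suc k := t))" for t
    by (rule Suc.IH, rule Suc.prems) (auto split: if_splits)
  then show ?case by simp
qed

lemma iterated_norm_zero:
  assumes "\<And>i. i \<in> {1..k} \<Longrightarrow> 0 < p i"
  shows "iterated_norm p k (\<lambda>_ :: nat \<Rightarrow> 'a::euclidean_space. 0) y = 0"
  using assms by (intro iterated_norm_eqI[where G="\<lambda>_ _. 0"]) (auto intro: Lp_norm_zero)

lemma iterated_norm_ball:
  fixes c :: "'a::euclidean_space"
  assumes p: "\<And>i. i \<in> {1..m} \<Longrightarrow> 0 < p i" and R: "0 < R"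
  shows "iterated_norm p m (\<lambda>y. ennreal (if \<forall>i\<in>{1..m}. norm (y i - c) < R then 1 else 0)) y
    = ennreal ((unit_ball_vol DIM('a) * R ^ DIM('a)) powr (\<Sum>i=1..m. recip (p i)))"
proof -
  let ?v = "unit_ball_vol DIM('a) * R ^ DIM('a)"
  let ?s = "\<lambda>j. \<Sum>i=1..j. recip (p i)"
  have v: "0 < ?v" using R by simp
  define G where "G j y = ennreal (if \<forall>i\<in>{Suc j..m}. norm (y i - c) < R then ?v powr ?s j else 0)" for j and y :: "nat \<Rightarrow> 'a"
  have "iterated_norm p m (\<lambda>y. ennreal (if \<forall>i\<in>{1..m}. norm (y i - c) < R then 1 else 0)) y = G m y"
  proof (rule iterated_norm_eqI)
    fix j and y :: "nat \<Rightarrow> 'a" assume j: "j < m"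
    have "(\<forall>i\<in>{Suc j..m}. norm ((y(Suc j := t)) i - c) < R) \<longleftrightarrow> t \<in> ball c R \<and> (\<forall>i\<in>{Suc (Suc j)..m}. norm (y i - c) < R)" for t
      unfolding atLeastAtMost_Suc_insert[OF j] by (auto simp: dist_norm norm_minus_commute)
    then have "Lp_norm lebesgue (p (Suc j)) (\<lambda>t. G j (y(Suc j := t))) =
      Lp_norm lebesgue (p (Suc j)) (\<lambda>t. ennreal (if t \<in> ball c R then (if \<forall>i\<in>{Suc (Suc j)..m}. norm (y i - c) < R then ?v powr ?s j else 0) else 0))"
      by (intro arg_cong[where f="Lp_norm lebesgue (p (Suc j))"] ext) (auto simp: G_def)
    also have "\<dots> = ennreal ((if \<forall>i\<in>{Suc (Suc j)..m}. norm (y i - c) < R then ?v powr ?s j else 0) * ?v powr recip (p (Suc j)))"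
      using p j R v by (intro Lp_norm_If emeasure_ball) auto
    also have "\<dots> = G (Suc j) y" by (simp add: powr_add G_def)
    finally show "Lp_norm lebesgue (p (Suc j)) (\<lambda>t. G j (y(Suc j := t))) = G (Suc j) y" .
  qed (use R unit_ball_vol_pos[of "real DIM('a)"] in \<open>auto simp: G_def less_imp_neq[symmetric] simp del: unit_ball_vol_pos\<close>)
  then show ?thesis by (simp add: G_def)
qed

text \<open>
  Integrating out \<open>y 1, \<dots>, y (I - 1)\<close> multiplies by powers of \<open>|y I - c| powr n\<close>. With the exponent
  \<open>e = - n (1 / p 1 + \<dots> + 1 / p I)\<close> what is left in \<open>y I\<close> is \<open>|y I - c| powr (- n / p I)\<close>, whose norm on the
  annulus is the logarithm of \<open>R\<close> to the power \<open>1 / p I\<close>, whereas every dyadic shell contributes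
  equally to the left-hand side. For \<open>I = 0\<close> no shell is present: \<open>y 0\<close> is not a coordinate.
\<close>

definition shell_test :: "nat \<Rightarrow> nat \<Rightarrow> real \<Rightarrow> real \<Rightarrow> 'a::euclidean_space \<Rightarrow> (nat \<Rightarrow> 'a) \<Rightarrow> real" where
  "shell_test I m e R c y =
    (if (I \<noteq> 0 \<longrightarrow> 1 \<le> norm (y I - c) \<and> norm (y I - c) < R) \<and>
        (\<forall>i\<in>{1..<I}. norm (y i - c) < norm (y I - c)) \<and> (\<forall>i\<in>{I<..m}. norm (y i - c) < 1)
     then if I = 0 then 1 else norm (y I - c) powr e else 0)"

lemma shell_test_nonneg: "0 \<le> shell_test I m e R c y"
  by (simp add: shell_test_def)

lemma iterated_norm_shell_test:
  fixes c :: "'a::euclidean_space"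
  defines "n \<equiv> real DIM('a)" and "V \<equiv> unit_ball_vol DIM('a)"
  assumes p: "\<And>i. i \<in> {1..m} \<Longrightarrow> 0 < p i" and R: "1 < R" and I: "I \<le> m"
  shows "iterated_norm p m (\<lambda>y. ennreal (shell_test I m (- (n * (\<Sum>i=1..I. recip (p i)))) R c y)) y
    = ennreal (V powr (\<Sum>i\<in>{1..m} - {I}. recip (p i)) * (n * V * ln R) powr (if I = 0 then 0 else recip (p I)))"
proof -
  define th where "th i = recip (p i)" for i
  have V: "0 < V" by (simp add: V_def)
  have L: "0 < n * V * ln R" using R V by (simp add: n_def)
  define B where "B j = V powr (\<Sum>i\<in>{1..j} - {I}. th i) * (n * V * ln R) powr (if I \<noteq> 0 \<and> I \<le> j then th I else 0)" for j
  have B0: "0 \<le> B j" for j by (simp add: B_def)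
  have B_Suc: "B (Suc j) = B j * V powr th (Suc j)" if "Suc j \<noteq> I" for j
  proof -
    have "{1..Suc j} - {I} = insert (Suc j) ({1..j} - {I})" using that by auto
    then have "(\<Sum>i\<in>{1..Suc j} - {I}. th i) = th (Suc j) + (\<Sum>i\<in>{1..j} - {I}. th i)" by simp
    moreover have "I \<le> Suc j \<longleftrightarrow> I \<le> j" using that by auto
    ultimately show ?thesis by (simp add: B_def powr_add)
  qed
  have B_I: "B (Suc j) = B j * (n * V * ln R) powr th (Suc j)" if "Suc j = I" for j
  proof -
    have "{1..Suc j} - {I} = {1..j} - {I}" using that by auto
    then show ?thesis using that L by (simp add: B_def)
  qed
  define Q where "Q j y \<longleftrightarrow> (\<forall>i\<in>{max I j<..m}. norm (y i - c) < 1)" for j and y :: "nat \<Rightarrow> 'a"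
  define P where "P j y \<longleftrightarrow> (j < I \<longrightarrow> 1 \<le> norm (y I - c) \<and> norm (y I - c) < R) \<and> (\<forall>i\<in>{j<..<I}. norm (y i - c) < norm (y I - c))"
    for j and y :: "nat \<Rightarrow> 'a"
  \<comment> \<open>The function after \<open>j\<close> norms. \<open>P\<close> and \<open>Q\<close>
    are the support conditions still visible and \<open>B j\<close> is the constant collected so
    far. Each ball of radius \<open>norm (y I - c)\<close> adds \<open>n * th j\<close> to the
    exponent, which has risen to \<open>- n * th I\<close> when the annulus variable is
    reached.\<close>
  define G where "G j y = ennreal (if P j y \<and> Q j y then B j * (if j < I then norm (y I - c) powr (n * ((\<Sum>i=1..j. th i) - (\<Sum>i=1..I. th i))) else 1) else 0)"
    for j and y :: "nat \<Rightarrow> 'a"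
  have "iterated_norm p m (\<lambda>y. ennreal (shell_test I m (- (n * (\<Sum>i=1..I. th i))) R c y)) y = G m y"
  proof (rule iterated_norm_eqI)
    fix y
    have "{0<..<I} = {1..<I}" by auto
    then show "ennreal (shell_test I m (- (n * (\<Sum>i=1..I. th i))) R c y) = G 0 y"
      using L by (auto simp: shell_test_def G_def P_def Q_def B_def)
  next
    fix j and y :: "nat \<Rightarrow> 'a" assume j: "j < m"
    have pj: "0 < p (Suc j)" using p j by simp
    consider "Suc j < I" | "Suc j = I" | "I < Suc j" by linarith
    then show "Lp_norm lebesgue (p (Suc j)) (\<lambda>t. G j (y(Suc j := t))) = G (Suc j) y"
    proof cases
      case 1
      let ?r = "norm (y I - c)"
      let ?e = "n * ((\<Sum>i=1..j. th i) - (\<Sum>i=1..I. th i))"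
      have ins: "{j<..<I} = insert (Suc j) {Suc j<..<I}" using 1 by auto
      have mx: "max I j = I" "max I (Suc j) = I" using 1 by auto
      have Q: "Q j (y(Suc j := t)) \<longleftrightarrow> Q (Suc j) y" for t
        using 1 by (auto simp: Q_def mx)
      have P: "P j (y(Suc j := t)) \<longleftrightarrow> t \<in> ball c ?r \<and> P (Suc j) y" for t
        unfolding P_def ins using 1 by (auto simp: dist_norm norm_minus_commute)
      show ?thesis
      proof (cases "P (Suc j) y \<and> Q (Suc j) y")
        case True
        then have r: "1 \<le> ?r" using 1 by (auto simp: P_def)
        then have r0: "0 < ?r" by linarith
        have "Lp_norm lebesgue (p (Suc j)) (\<lambda>t. G j (y(Suc j := t))) =
          Lp_norm lebesgue (p (Suc j)) (\<lambda>t. ennreal (if t \<in> ball c ?r then B j * ?r powr ?e else 0))"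
          using True 1 by (intro arg_cong[where f="Lp_norm lebesgue (p (Suc j))"] ext) (auto simp: G_def P Q)
        also have "\<dots> = ennreal (B j * ?r powr ?e * (V * ?r ^ DIM('a)) powr th (Suc j))"
          unfolding th_def V_def using r0 pj B0 by (intro Lp_norm_If emeasure_ball) auto
        also have "(V * ?r ^ DIM('a)) powr th (Suc j) = V powr th (Suc j) * ?r powr (n * th (Suc j))"
          using r0 V by (simp add: powr_mult n_def flip: powr_realpow) (simp add: powr_powr)
        also have "B j * ?r powr ?e * (V powr th (Suc j) * ?r powr (n * th (Suc j))) = B (Suc j) * ?r powr (?e + n * th (Suc j))"
          using 1 by (simp add: B_Suc powr_add)
        also have "?e + n * th (Suc j) = n * ((\<Sum>i=1..Suc j. th i) - (\<Sum>i=1..I. th i))"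
          by (simp add: algebra_simps)
        also have "ennreal (B (Suc j) * ?r powr (n * ((\<Sum>i=1..Suc j. th i) - (\<Sum>i=1..I. th i)))) = G (Suc j) y" using True 1 by (simp add: G_def)
        finally show ?thesis .
      next
        case False
        then have "G j (y(Suc j := t)) = 0" for t by (auto simp: G_def P Q)
        moreover have "G (Suc j) y = 0" using False by (auto simp: G_def)
        ultimately show ?thesis using pj by (simp add: Lp_norm_zero)
      qed
    next
      case 2
      have mx: "max I j = I" "max I (Suc j) = I" using 2 by auto
      have Q: "Q j (y(Suc j := t)) \<longleftrightarrow> Q (Suc j) y" for t
        using 2 by (auto simp: Q_def mx)
      have P: "P j (y(Suc j := t)) \<longleftrightarrow> 1 \<le> norm (t - c) \<and> norm (t - c) < R" for t
        unfolding P_def using 2 by auto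
      have P': "P (Suc j) y" using 2 by (auto simp: P_def)
      have e: "n * ((\<Sum>i=1..j. th i) - (\<Sum>i=1..I. th i)) = - (n * th (Suc j))"
        using 2 by (auto simp: algebra_simps)
      show ?thesis
      proof (cases "Q (Suc j) y")
        case True
        have "Lp_norm lebesgue (p (Suc j)) (\<lambda>t. G j (y(Suc j := t))) =
          Lp_norm lebesgue (p (Suc j)) (\<lambda>t. ennreal (if 1 \<le> norm (t - c) \<and> norm (t - c) < R then B j * norm (t - c) powr - (n * th (Suc j)) else 0))"
          using True 2 unfolding G_def P Q e by (intro arg_cong[where f="Lp_norm lebesgue (p (Suc j))"] ext) auto
        also have "\<dots> = ennreal (B j * (n * V * ln R) powr th (Suc j))"
          unfolding th_def n_def V_def using pj R B0 by (rule Lp_norm_annulus_powr)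
        also have "\<dots> = G (Suc j) y" using True 2 P' B_I[OF 2] by (simp add: G_def)
        finally show ?thesis .
      next
        case False
        then have "G j (y(Suc j := t)) = 0" for t by (auto simp: G_def Q)
        moreover have "G (Suc j) y = 0" using False by (auto simp: G_def)
        ultimately show ?thesis using pj by (simp add: Lp_norm_zero)
      qed
    next
      case 3
      have ins: "{max I j<..m} = insert (Suc j) {max I (Suc j)<..m}" using 3 j by auto
      have Q: "Q j (y(Suc j := t)) \<longleftrightarrow> t \<in> ball c 1 \<and> Q (Suc j) y" for t
        unfolding Q_def ins using 3 by (auto simp: dist_norm norm_minus_commute)
      have P: "P j z" "P (Suc j) z" for z using 3 by (auto simp: P_def)
      have "Lp_norm lebesgue (p (Suc j)) (\<lambda>t. G j (y(Suc j := t))) =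
          Lp_norm lebesgue (p (Suc j)) (\<lambda>t. ennreal (if t \<in> ball c 1 then (if Q (Suc j) y then B j else 0) else 0))"
          using 3 by (intro arg_cong[where f="Lp_norm lebesgue (p (Suc j))"] ext) (auto simp: G_def P Q)
      also have "\<dots> = ennreal ((if Q (Suc j) y then B j else 0) * (V * 1 ^ DIM('a)) powr th (Suc j))"
        unfolding th_def V_def using pj B0 by (intro Lp_norm_If emeasure_ball) auto
      also have "\<dots> = G (Suc j) y" using 3 by (simp add: G_def P B_Suc)
        finally show ?thesis .
    qed
  qed
  moreover have "G m y = ennreal (B m)" using I by (auto simp: G_def P_def Q_def)
  ultimately show ?thesis using I by (simp add: B_def th_def)
qed

section \<open>Lower bounds from single dyadic scales\<close>

lemma Lp_norm_mono:
  fixes f g :: "'a::euclidean_space \<Rightarrow> ennreal"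
  assumes "f \<in> borel_measurable borel" "\<And>x. f x \<le> g x"
  shows "Lp_norm lebesgue p f \<le> Lp_norm lebesgue p g"
proof (cases "p = top")
  case True
  have "f \<in> borel_measurable lebesgue" using assms(1) by (simp add: measurable_completion)
  then show ?thesis using True assms(2) by (simp add: Lp_norm_def esssup_mono)
next
  case False
  then show ?thesis
    using assms(2) by (simp add: Lp_norm_lebesgue) (intro ennpowr_mono nn_integral_mono; simp)
qed

lemma Lp_norm_ge_on_set:
  fixes S :: "'a::euclidean_space set"
  assumes S [measurable]: "S \<in> sets borel" and v: "emeasure lborel S = ennreal v" "0 < v" and c: "0 \<le> c" and q: "0 < q"
    and T: "\<And>x. x \<in> S \<Longrightarrow> ennreal c \<le> T x"
  shows "ennreal (c * v powr recip q) \<le> Lp_norm lebesgue q T"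
  unfolding Lp_norm_If[OF S v c q, symmetric]
  using T by (intro Lp_norm_mono) (auto, measurable)

text \<open>The part of the support of \<open>shell_test\<close> at scale \<open>r\<close>, cut down
  to a product so that its volume is explicit:
  \<open>norm (y i - c) < r \<le> norm (y I - c)\<close> for \<open>i < I\<close>. For
  \<open>I = 0\<close> all coordinates lie in unit balls.\<close>

definition shell_box :: "nat \<Rightarrow> real \<Rightarrow> 'a::euclidean_space \<Rightarrow> nat \<Rightarrow> 'a set" where
  "shell_box I r c i =
    (if i < I then ball c r else if i = I then {t. r \<le> norm (t - c) \<and> norm (t - c) < 2 * r} else ball c 1)"

lemma shell_box_subset: "1 \<le> r \<Longrightarrow> t \<in> shell_box I r c i \<Longrightarrow> norm (t - c) < 2 * r"
  by (auto simp: shell_box_def dist_norm norm_minus_commute split: if_splits)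

lemma shell_box_sets [measurable]: "shell_box I r c i \<in> sets borel"
  by (simp add: shell_box_def)

text \<open>The shell between \<open>r\<close> and \<open>2 * r\<close> is at least as large as the
  ball of radius \<open>r\<close> because \<open>2 ^ n - 1 \<ge> 1\<close>.\<close>

lemma emeasure_shell_box:
  fixes c :: "'a::euclidean_space"
  assumes "1 \<le> r"
  shows "ennreal (unit_ball_vol DIM('a) * (if i \<le> I then r ^ DIM('a) else 1)) \<le> emeasure lborel (shell_box I r c i)"
proof -
  have r0: "0 \<le> r" using assms by simp
  have "(2::real) ^ 1 \<le> 2 ^ DIM('a)" using DIM_positive[where 'a='a] by (intro power_increasing) (auto simp: Suc_le_eq)
  then have "2 * r ^ DIM('a) \<le> 2 ^ DIM('a) * r ^ DIM('a)" using r0 by (intro mult_right_mono) auto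
  then have "unit_ball_vol DIM('a) * r ^ DIM('a) \<le> unit_ball_vol DIM('a) * ((2 * r) ^ DIM('a) - r ^ DIM('a))"
    by (intro mult_left_mono) (auto simp: power_mult_distrib)
  then show ?thesis
    using r0 by (auto simp: shell_box_def emeasure_ball emeasure_annulus intro!: ennreal_leI)
qed

text \<open>On the box the test function is at least \<open>(2 * r) powr e\<close>, the kernel at
  least \<open>(M * r) powr - lam\<close>, and the volume is at least
  \<open>V ^ m * r powr (n * I)\<close>. \<open>S\<close> is left abstract because the endpoint
  argument adds the distance to one more, frozen variable.\<close>

lemma shell_test_lower:
  fixes c :: "'a::euclidean_space" and lam M :: real
  defines "n \<equiv> real DIM('a)" and "V \<equiv> unit_ball_vol DIM('a)"
  assumes I: "I \<le> m" and r: "1 \<le> r" "I \<noteq> 0 \<Longrightarrow> 2 * r \<le> R" and e: "e \<le> 0" and lam: "0 \<le> lam" and M: "0 < M"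
    and S: "\<And>y. 0 \<le> S y" "\<And>y. y \<in> PiE {1..m} (shell_box I r c) \<Longrightarrow> S y \<le> M * r"
  shows "ennreal (V ^ m * 2 powr e * M powr - lam * r powr (n * I + e - lam)) \<le>
    (\<integral>\<^sup>+y. ennreal (shell_test I m e R c y) * kern lam (S y) * indicator (PiE {1..m} (shell_box I r c)) y \<partial>lborel_on {1..m})"
proof -
  interpret product_sigma_finite "\<lambda>_::nat. lborel :: 'a measure" by (rule product_sigma_finite_lborel)
  let ?D = "PiE {1..m} (shell_box I r c)"
  have V: "0 < V" by (simp add: V_def)
  have D: "?D \<in> sets (lborel_on {1..m})" by (intro sets_PiM_I_finite) auto
  have "ennreal (V ^ m * r powr (n * I)) = (\<Prod>i=1..m. ennreal (V * (if i \<le> I then r ^ DIM('a) else 1)))"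
  proof -
    have "(\<Prod>i=1..m. V * (if i \<le> I then r ^ DIM('a) else 1)) = V ^ m * (\<Prod>i=1..m. if i \<le> I then r ^ DIM('a) else 1)"
      by (simp add: prod.distrib)
    also have "(\<Prod>i=1..m. if i \<le> I then r ^ DIM('a) else 1) = (\<Prod>i=1..I. r ^ DIM('a))"
      using I by (intro prod.mono_neutral_cong_right) auto
    also have "\<dots> = r powr (n * I)"
      using r by (simp add: n_def powr_realpow flip: power_mult of_nat_mult)
    finally show ?thesis using V r by (subst prod_ennreal) auto
  qed
  also have "\<dots> \<le> (\<Prod>i=1..m. emeasure lborel (shell_box I r c i))"
    unfolding V_def using r(1) by (intro prod_mono_ennreal emeasure_shell_box)
  also have "\<dots> = emeasure (lborel_on {1..m}) ?D"
    by (rule emeasure_PiM[symmetric]) auto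
  finally have vol: "ennreal (V ^ m * r powr (n * I)) \<le> emeasure (lborel_on {1..m}) ?D" .
  have pt: "ennreal ((2 * r) powr e * (M * r) powr - lam) \<le> ennreal (shell_test I m e R c y) * kern lam (S y)" if y: "y \<in> ?D" for y
  proof -
    have yi: "y i \<in> shell_box I r c i" if "i \<in> {1..m}" for i using y that by auto
    have 1: "r \<le> norm (y I - c) \<and> norm (y I - c) < 2 * r" if "I \<noteq> 0"
      using yi[of I] that I by (auto simp: shell_box_def)
    have 2: "norm (y i - c) < r" if "i \<in> {1..<I}" for i
      using yi[of i] that I by (auto simp: shell_box_def dist_norm norm_minus_commute)
    have 3: "norm (y i - c) < 1" if "i \<in> {I<..m}" for i
      using yi[of i] that I by (auto simp: shell_box_def dist_norm norm_minus_commute)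
    have "(2 * r) powr e \<le> shell_test I m e R c y"
    proof (cases "I = 0")
      case True
      have "(2 * r) powr e \<le> 1 powr e" using r e by (intro powr_mono2') auto
      then show ?thesis using True 3 by (simp add: shell_test_def)
    next
      case False
      have "shell_test I m e R c y = norm (y I - c) powr e"
        using False 1 2 3 r by (fastforce simp: shell_test_def)
      also have "\<dots> \<ge> (2 * r) powr e" using 1[OF False] r e by (intro powr_mono2') auto
      finally show ?thesis .
    qed
    moreover have "ennreal ((M * r) powr - lam) \<le> kern lam (S y)"
    proof -
      have "kern lam (M * r) \<le> kern lam (S y)" using S y lam by (intro kern_mono) auto
      then show ?thesis using M r by (simp add: kern_pos)
    qed
    ultimately show ?thesis
      by (simp only: ennreal_mult' powr_ge_zero) (intro mult_mono ennreal_leI; simp)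
  qed
  have eq: "V ^ m * 2 powr e * M powr - lam * r powr (n * I + e - lam) = (2 * r) powr e * (M * r) powr - lam * (V ^ m * r powr (n * I))"
    using M r by (simp add: powr_mult powr_add powr_diff powr_minus field_simps)
  have "ennreal (V ^ m * 2 powr e * M powr - lam * r powr (n * I + e - lam)) =
    ennreal ((2 * r) powr e * (M * r) powr - lam) * ennreal (V ^ m * r powr (n * I))"
    unfolding eq by (intro ennreal_mult') simp
  also have "\<dots> \<le> ennreal ((2 * r) powr e * (M * r) powr - lam) * emeasure (lborel_on {1..m}) ?D"
    by (intro mult_left_mono vol) auto
  also have "\<dots> = (\<integral>\<^sup>+y. ennreal ((2 * r) powr e * (M * r) powr - lam) * indicator ?D y \<partial>lborel_on {1..m})"
    using D by (rule nn_integral_cmult_indicator[symmetric])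
  also have "\<dots> \<le> (\<integral>\<^sup>+y. ennreal (shell_test I m e R c y) * kern lam (S y) * indicator ?D y \<partial>lborel_on {1..m})"
    using pt by (intro nn_integral_mono) (auto split: split_indicator)
  finally show ?thesis .
qed

lemma powr_bounded_imp_exponent_eq_0:
  fixes K C e :: real
  assumes "0 < K" "0 \<le> C" and bd: "\<And>R. 0 < R \<Longrightarrow> K * R powr e \<le> C"
  shows "e = 0"
proof (rule ccontr)
  assume "e \<noteq> 0"
  then have "(((C + 1) / K) powr (1 / e)) powr e = (C + 1) / K"
    using assms by (simp add: powr_powr)
  then show False using bd[of "((C + 1) / K) powr (1 / e)"] assms by simp
qed

lemma powr_growth_le:
  fixes K C a b :: real
  assumes K: "0 < K" and C: "0 \<le> C" and bd: "\<And>u. 1 \<le> u \<Longrightarrow> K * u powr a \<le> C * u powr b"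
  shows "a \<le> b"
proof (rule ccontr)
  assume "\<not> a \<le> b"
  define u where "u = max 1 (((C + 1) / K) powr (1 / (a - b)))"
  have u: "1 \<le> u" by (simp add: u_def)
  have "(C + 1) / K = (((C + 1) / K) powr (1 / (a - b))) powr (a - b)"
    using \<open>\<not> a \<le> b\<close> K C by (simp add: powr_powr)
  also have "\<dots> \<le> u powr (a - b)" using \<open>\<not> a \<le> b\<close> by (intro powr_mono2) (auto simp: u_def)
  finally have "C + 1 \<le> K * u powr (a - b)" using K by (simp add: field_simps)
  then have "(C + 1) * u powr b \<le> K * u powr (a - b) * u powr b" by (intro mult_right_mono) auto
  also have "\<dots> = K * u powr a" using u by (simp add: powr_diff)
  also have "\<dots> \<le> C * u powr b" by (rule bd[OF u])
  finally show False using u by simp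
qed

text \<open>The centre may vary with \<open>y\<close>, and \<open>A\<close> may contain further
  indices, because the endpoint argument centres the profile at the coordinate
  \<open>y (Suc m)\<close>.\<close>

lemma shell_test_measurable:
  fixes g :: "(nat \<Rightarrow> 'a::euclidean_space) \<Rightarrow> 'a"
  assumes "I \<le> m" "{1..m} \<subseteq> A" and g: "g \<in> borel_measurable (lborel_on A)"
  shows "(\<lambda>y. shell_test I m e R (g y) y) \<in> borel_measurable (lborel_on A)"
proof -
  let ?M = "lborel_on A :: (nat \<Rightarrow> 'a) measure"
  have norm_meas: "(\<lambda>y. norm (y i - g y)) \<in> borel_measurable ?M" if "i \<in> {1..m}" for i
  proof -
    have "i \<in> A" using that assms(2) by auto
    have "(\<lambda>y. y i) \<in> borel_measurable ?M"
      using measurable_component_singleton[OF \<open>i \<in> A\<close>, of "\<lambda>_. lborel :: 'a measure"]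
      by (simp only: measurable_cong_sets[OF refl sets_lborel])
    then show ?thesis using g by measurable
  qed
  have small: "{y \<in> space ?M. \<forall>i\<in>{I<..m}. norm (y i - g y) < 1} \<in> sets ?M"
    by (intro sets.sets_Collect_finite_All borel_measurable_less norm_meas) auto
  show ?thesis
  proof (cases "I = 0")
    case True
    have "(\<lambda>y. if \<forall>i\<in>{I<..m}. norm (y i - g y) < 1 then 1 else 0) \<in> borel_measurable ?M"
      using small by (intro measurable_If) auto
    moreover have "shell_test I m e R (g y) y = (if \<forall>i\<in>{I<..m}. norm (y i - g y) < 1 then 1 else 0)" for y
      using True by (simp add: shell_test_def)
    ultimately show ?thesis by simp
  next
    case False
    have I: "I \<in> {1..m}" using False assms by simp
    have "{y \<in> space ?M. \<forall>i\<in>{1..<I}. norm (y i - g y) < norm (y I - g y)} \<in> sets ?M"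
      by (intro sets.sets_Collect_finite_All borel_measurable_less norm_meas I) (use I in auto)
    moreover have "{y \<in> space ?M. 1 \<le> norm (y I - g y)} \<in> sets ?M" "{y \<in> space ?M. norm (y I - g y) < R} \<in> sets ?M"
      using norm_meas[OF I] by measurable
    ultimately have "{y \<in> space ?M. (1 \<le> norm (y I - g y) \<and> norm (y I - g y) < R) \<and>
        (\<forall>i\<in>{1..<I}. norm (y i - g y) < norm (y I - g y)) \<and> (\<forall>i\<in>{I<..m}. norm (y i - g y) < 1)} \<in> sets ?M"
      using small by (intro sets.sets_Collect_conj)
    moreover have "(\<lambda>y. norm (y I - g y) powr e) \<in> borel_measurable ?M"
      using norm_meas[OF I] by measurable
    ultimately have "(\<lambda>y. if (1 \<le> norm (y I - g y) \<and> norm (y I - g y) < R) \<and>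
        (\<forall>i\<in>{1..<I}. norm (y i - g y) < norm (y I - g y)) \<and> (\<forall>i\<in>{I<..m}. norm (y i - g y) < 1)
        then norm (y I - g y) powr e else 0) \<in> borel_measurable ?M"
      by (intro measurable_If) auto
    then show ?thesis using False by (simp only: shell_test_def simp_thms if_False)
  qed
qed

section \<open>Necessary conditions on the exponents\<close>

lemma nonneg_estimateD:
  fixes F :: "(nat \<Rightarrow> 'a::euclidean_space) \<Rightarrow> real"
  assumes "nonneg_estimate TYPE('a) m lam p q C"
    and "F \<in> borel_measurable (lborel_on {1..m})" "\<And>y. 0 \<le> F y"
    and N: "iterated_norm p m (\<lambda>y. ennreal (F y)) (\<lambda>_. undefined) = ennreal N" "0 \<le> N"
    and L: "ennreal L \<le> Lp_norm lebesgue q (J_nn m lam (\<lambda>y. ennreal (F y)))"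
  shows "L \<le> C * N"
proof -
  have C: "0 \<le> C" using assms(1) by (simp add: nonneg_estimate_def)
  note L
  also have "Lp_norm lebesgue q (J_nn m lam (\<lambda>y. ennreal (F y))) \<le> ennreal C * ennreal N"
    using assms(1)[unfolded nonneg_estimate_def, THEN conjunct2, rule_format, OF assms(2,3)] N(1) by simp
  also have "\<dots> = ennreal (C * N)" using C by (simp add: ennreal_mult')
  finally show ?thesis using C N(2) by (simp add: ennreal_le_iff)
qed

text \<open>If \<open>x\<close> and all \<open>y i\<close> lie in the ball of radius
  \<open>R\<close>, the kernel is at least \<open>(2 * m * R) powr - lam\<close>. Both sides of the
  estimate are then constants times powers of \<open>R\<close>; letting \<open>R\<close> be small as
  well as large leaves only equal exponents.\<close>

lemma scaling_necessary:
  fixes lam :: real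
  assumes est: "nonneg_estimate TYPE('a::euclidean_space) m lam p q C" and m: "1 \<le> m" and lam: "0 \<le> lam"
    and p: "\<And>i. i \<in> {1..m} \<Longrightarrow> 0 < p i" and q: "0 < q"
  shows "DIM('a) * (m + recip q - (\<Sum>i=1..m. recip (p i))) = lam"
proof -
  interpret product_sigma_finite "\<lambda>_::nat. lborel :: 'a measure" by (rule product_sigma_finite_lborel)
  define n where "n = real DIM('a)"
  define V where "V = unit_ball_vol DIM('a)"
  define s where "s = (\<Sum>i=1..m. recip (p i))"
  define t where "t = recip q"
  have V: "0 < V" by (simp add: V_def)
  have C: "0 \<le> C" using est by (simp add: nonneg_estimate_def)
  have "n * (m + t - s) - lam = 0"
  proof (rule powr_bounded_imp_exponent_eq_0[OF _ C])
    show "0 < V powr (m + t - s) * (2 * m) powr - lam" using V m by simp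
    fix R :: real assume R: "0 < R"
    define v where "v = V * R ^ DIM('a)"
    have v: "0 < v" using V R by (simp add: v_def)
    have v_powr: "v powr a = V powr a * R powr (n * a)" for a
      using V R by (simp add: v_def powr_mult n_def powr_powr flip: powr_realpow)
    define F where "F y = (if \<forall>i\<in>{1..m}. norm (y i - 0) < R then 1 else 0 :: real)" for y :: "nat \<Rightarrow> 'a"
    let ?D = "PiE {1..m} (\<lambda>_. ball (0::'a) R)"
    have D: "?D \<in> sets (lborel_on {1..m})" by (intro sets_PiM_I_finite) auto
    have D_vol: "emeasure (lborel_on {1..m}) ?D = ennreal (v ^ m)"
      using v R by (subst emeasure_PiM) (auto simp: emeasure_ball v_def V_def ennreal_power)
    have "v ^ m * (2 * m * R) powr - lam * v powr t \<le> C * v powr s"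
    proof (rule nonneg_estimateD[OF est])
      show "F \<in> borel_measurable (lborel_on {1..m})" unfolding F_def by simp
      show "0 \<le> F y" for y by (simp add: F_def)
      show "iterated_norm p m (\<lambda>y. ennreal (F y)) (\<lambda>_. undefined) = ennreal (v powr s)"
        unfolding F_def v_def V_def s_def by (rule iterated_norm_ball[OF p R])
      show "ennreal (v ^ m * (2 * m * R) powr - lam * v powr t) \<le> Lp_norm lebesgue q (J_nn m lam (\<lambda>y. ennreal (F y)))"
        unfolding t_def
      proof (rule Lp_norm_ge_on_set[OF _ _ v _ q])
        show "emeasure lborel (ball (0::'a) R) = ennreal v" using R by (simp add: emeasure_ball v_def V_def)
        fix x :: 'a assume x: "x \<in> ball 0 R"
        have "ennreal (v ^ m * (2 * m * R) powr - lam) = (\<integral>\<^sup>+y. ennreal ((2 * m * R) powr - lam) * indicator ?D y \<partial>lborel_on {1..m})"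
          unfolding nn_integral_cmult_indicator[OF D] D_vol using v by (simp add: ennreal_mult' mult.commute)
        also have "\<dots> \<le> (J_nn m lam (\<lambda>y. ennreal (F y)) x)"
        proof (rule nn_integral_mono)
          fix y
          show "ennreal ((2 * m * R) powr - lam) * indicator ?D y \<le> ennreal (F y) * kern lam (\<Sum>i=1..m. norm (x - y i))"
          proof (cases "y \<in> ?D")
            case True
            then have yi: "norm (y i) < R" if "i \<in> {1..m}" for i using that by (auto simp: PiE_iff)
            have "(\<Sum>i=1..m. norm (x - y i)) \<le> (\<Sum>i=1..m. 2 * R)"
              using x yi by (intro sum_mono) (smt (verit) dist_0_norm mem_ball norm_triangle_ineq4)
            also have "\<dots> = 2 * m * R" by simp
            finally have "kern lam (2 * m * R) \<le> kern lam (\<Sum>i=1..m. norm (x - y i))"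
              using lam by (intro kern_mono) (auto intro: sum_nonneg)
            moreover have "F y = 1" using yi by (simp add: F_def)
            ultimately show ?thesis using True m R by (simp add: kern_pos)
          qed simp
        qed
        finally show "ennreal (v ^ m * (2 * m * R) powr - lam) \<le> (J_nn m lam (\<lambda>y. ennreal (F y)) x)" .
      qed (use v in auto)
    qed (use v in auto)
    then have "v powr (m + t) * (2 * m * R) powr - lam \<le> C * v powr s"
      using v by (simp add: powr_add powr_realpow ac_simps)
    then have "v powr (m + t) * (2 * m * R) powr - lam * v powr - s \<le> C * v powr s * v powr - s"
      by (intro mult_right_mono) auto
    also have "\<dots> = C" using v by (simp add: mult.assoc powr_add[symmetric])
    also have "v powr (m + t) * (2 * m * R) powr - lam * v powr - s = v powr (m + t - s) * (2 * m * R) powr - lam"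
      using v by (simp add: powr_diff powr_minus field_simps)
    also have "\<dots> = V powr (m + t - s) * (2 * m) powr - lam * R powr (n * (m + t - s) - lam)"
    proof -
      have "(2 * m * R) powr - lam = (2 * m) powr - lam * R powr - lam" using R by (simp add: powr_mult)
      moreover have "R powr (n * (m + t - s)) * R powr - lam = R powr (n * (m + t - s) - lam)"
        by (simp only: powr_add[symmetric] diff_conv_add_uminus)
      ultimately show ?thesis by (simp only: v_powr mult.assoc mult.left_commute[of "R powr _"])
    qed
    finally show "V powr (m + t - s) * (2 * m) powr - lam * R powr (n * (m + t - s) - lam) \<le> C" .
  qed
  then show ?thesis by (simp add: n_def s_def t_def)
qed

text \<open>Combined with \<open>shell_test_lower\<close>, this says that the image of the test
  function is at least of size \<open>r powr (- n / q)\<close> at distance \<open>r\<close> from the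
  centre, the borderline of \<open>L^q\<close>.\<close>

lemma shell_exponent:
  fixes lam :: real and m :: nat
  assumes "DIM('a::euclidean_space) * (m + recip q - (\<Sum>i=1..m. recip (p i))) = lam"
    and "I \<le> m" and tail: "\<And>i. I < i \<Longrightarrow> i \<le> m \<Longrightarrow> p i = 1"
  shows "DIM('a) * real I + - (DIM('a) * (\<Sum>i=1..I. recip (p i))) - lam = - (DIM('a) * recip q)"
proof -
  have "{1..m} = {1..I} \<union> {I<..m}" using assms(2) by auto
  then have "(\<Sum>i=1..m. recip (p i)) = (\<Sum>i=1..I. recip (p i)) + (\<Sum>i\<in>{I<..m}. recip (p i))"
    by (simp only:) (rule sum.union_disjoint; auto)
  also have "(\<Sum>i\<in>{I<..m}. recip (p i)) = (\<Sum>i\<in>{I<..m}. 1)"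
    using tail by (intro sum.cong) auto
  also have "\<dots> = real m - real I" using assms(2) by simp
  finally have S: "(\<Sum>i=1..m. recip (p i)) = (\<Sum>i=1..I. recip (p i)) + (real m - real I)" .
  show ?thesis using assms(1) unfolding S by (simp add: algebra_simps)
qed

lemma sum_norm_diff_le:
  fixes c :: "'a::real_normed_vector"
  assumes "norm (x - c) \<le> r" "\<And>i. i \<in> {1..m} \<Longrightarrow> norm (y i - c) \<le> 2 * r"
  shows "(\<Sum>i=1..m. norm (x - y i)) \<le> 3 * real m * r"
proof -
  have "norm (x - y i) \<le> 3 * r" if "i \<in> {1..m}" for i
    using assms(1) assms(2)[OF that] norm_triangle_ineq4[of "x - c" "y i - c"] by simp
  then have "(\<Sum>i=1..m. norm (x - y i)) \<le> (\<Sum>i=1..m. 3 * r)" by (intro sum_mono)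
  then show ?thesis by simp
qed

lemma norm_diff_le_of_shell_box:
  assumes "y \<in> PiE {1..m} (shell_box I r c)" "1 \<le> r" "i \<in> {1..m}"
  shows "norm (y i - c) \<le> 2 * r"
  using shell_box_subset[OF assms(2) PiE_mem[OF assms(1,3)]] by simp

text \<open>At the point \<open>x\<close> the box of scale \<open>norm x\<close> alone gives the
  lower bound \<open>c1 * norm x powr (- n / q)\<close>. Its \<open>L^q\<close> norm over
  \<open>1 \<le> norm x < exp u\<close> grows like \<open>u powr (1 / q)\<close>, while the norm of
  the test function is at most of order \<open>u powr th\<close>.\<close>

lemma exponent_le_necessary:
  fixes lam :: real
  assumes est: "nonneg_estimate TYPE('a::euclidean_space) m lam p q C" and m: "1 \<le> m" and lam: "0 \<le> lam"
    and p: "\<And>i. i \<in> {1..m} \<Longrightarrow> 0 < p i" and q: "0 < q"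
    and I: "I \<le> m" and tail: "\<And>i. I < i \<Longrightarrow> i \<le> m \<Longrightarrow> p i = 1"
  shows "recip q \<le> (if I = 0 then 0 else recip (p I))"
proof -
  let ?n = "real DIM('a)"
  define V where "V = unit_ball_vol ?n"
  have nV: "0 < ?n * V" by (simp add: V_def)
  have V: "0 < V" by (simp add: V_def)
  define e where "e = - (?n * (\<Sum>i=1..I. recip (p i)))"
  have e: "e \<le> 0" by (simp add: e_def sum_nonneg)
  define t where "t = recip q"
  define th where "th = (if I = 0 then 0 else recip (p I))"
  have th: "0 \<le> th" by (simp add: th_def)
  have ex: "?n * real I + e - lam = - (?n * t)"
    unfolding e_def t_def by (rule shell_exponent[OF scaling_necessary[OF est m lam p q] I tail])
  define K where "K = V powr (\<Sum>i\<in>{1..m} - {I}. recip (p i))"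
  define c1 where "c1 = V ^ m * 2 powr e * (3 * real m) powr - lam"
  have c1: "0 < c1" using V m by (simp add: c1_def)
  have C: "0 \<le> C" using est by (simp add: nonneg_estimate_def)
  have K: "0 \<le> K" by (simp add: K_def)
  have "t \<le> th"
  proof (rule powr_growth_le)
    show "0 < c1 * (?n * V) powr t" by (intro mult_pos_pos c1) (use V in simp)
    show "0 \<le> C * K * (2 * (?n * V)) powr th" using C K by simp
    fix u :: real assume u: "1 \<le> u"
    \<comment> \<open>The factor \<open>2\<close> lets the shell from \<open>norm x\<close> to
      \<open>2 * norm x\<close> fit below \<open>R\<close> whenever
      \<open>norm x < exp u\<close>.\<close>
    define R where "R = 2 * exp u"
    have "1 < exp u" using u by simp
    then have R: "1 < R" "1 < exp u" unfolding R_def by linarith+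
    have "ln R = ln 2 + u" by (simp add: R_def ln_mult_pos)
    then have lnR: "ln R \<le> 2 * u" "0 < ln R"
      using u ln_2_less_1 ln_gt_zero[OF R(1)] by linarith+
    have "c1 * (?n * V * ln (exp u)) powr t \<le> C * (K * (?n * V * ln R) powr th)"
    proof (rule nonneg_estimateD[OF est])
      show "shell_test I m e R (0::'a) \<in> borel_measurable (lborel_on {1..m})" by (rule shell_test_measurable[OF I order_refl]) simp
      show "0 \<le> shell_test I m e R (0::'a) y" for y by (rule shell_test_nonneg)
      show "iterated_norm p m (\<lambda>y. ennreal (shell_test I m e R (0::'a) y)) (\<lambda>_. undefined) = ennreal (K * (?n * V * ln R) powr th)"
        unfolding e_def K_def V_def th_def by (rule iterated_norm_shell_test[OF p R(1) I])
      show "ennreal (c1 * (?n * V * ln (exp u)) powr t) \<le> Lp_norm lebesgue q (J_nn m lam (\<lambda>y. ennreal (shell_test I m e R (0::'a) y)))"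
        unfolding t_def V_def Lp_norm_annulus_powr[OF q R(2) less_imp_le[OF c1], of "0::'a", symmetric]
      proof (rule Lp_norm_mono)
        show "(\<lambda>x::'a. ennreal (if 1 \<le> norm (x - 0) \<and> norm (x - 0) < exp u then c1 * norm (x - 0) powr - (?n * recip q) else 0)) \<in> borel_measurable borel"
          by measurable
        fix x :: 'a
        show "ennreal (if 1 \<le> norm (x - 0) \<and> norm (x - 0) < exp u then c1 * norm (x - 0) powr - (?n * recip q) else 0)
          \<le> (J_nn m lam (\<lambda>y. ennreal (shell_test I m e R (0::'a) y)) x)"
        proof (cases "1 \<le> norm x \<and> norm x < exp u")
          case True
          let ?D = "PiE {1..m} (shell_box I (norm x) (0::'a))"
          have "ennreal (c1 * norm x powr (?n * I + e - lam)) \<le>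
            (\<integral>\<^sup>+y. ennreal (shell_test I m e R 0 y) * kern lam (\<Sum>i=1..m. norm (x - y i)) * indicator ?D y \<partial>lborel_on {1..m})"
            unfolding c1_def V_def
          proof (rule shell_test_lower[OF I _ _ e lam])
            show "2 * norm x \<le> R" using True by (simp add: R_def)
            show "0 < 3 * real m" using m by simp
            show "(\<Sum>i=1..m. norm (x - y i)) \<le> 3 * real m * norm x" if "y \<in> ?D" for y
            proof (rule sum_norm_diff_le[where c=0])
              show "norm (y i - 0) \<le> 2 * norm x" if "i \<in> {1..m}" for i
                using norm_diff_le_of_shell_box[OF \<open>y \<in> ?D\<close> _ that] True by blast
            qed simp
          qed (use True in \<open>auto intro: sum_nonneg\<close>)
          also have "\<dots> \<le> (J_nn m lam (\<lambda>y. ennreal (shell_test I m e R 0 y)) x)"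
            by (intro nn_integral_mono) (auto split: split_indicator)
          finally show ?thesis using True by (simp add: ex t_def)
        qed auto
      qed
    qed (use K in simp)
    also have "\<dots> \<le> C * (K * (2 * (?n * V) * u) powr th)"
    proof -
      have "0 \<le> ?n * V * ln R" using V lnR by (intro mult_nonneg_nonneg) auto
      moreover have "?n * V * ln R \<le> 2 * (?n * V) * u"
        using mult_left_mono[OF lnR(1), of "?n * V"] nV by linarith
      ultimately have "(?n * V * ln R) powr th \<le> (2 * (?n * V) * u) powr th"
        using th by (intro powr_mono2)
      then show ?thesis using C K by (intro mult_left_mono)
    qed
    also have "(2 * (?n * V) * u) powr th = (2 * (?n * V)) powr th * u powr th"
      by (rule powr_mult)
    also have "(?n * V * ln (exp u)) powr t = (?n * V) powr t * u powr t"
      unfolding ln_exp by (rule powr_mult)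
    finally show "c1 * (?n * V) powr t * u powr t \<le> C * K * (2 * (?n * V)) powr th * u powr th"
      by (simp only: mult.assoc)
  qed
  then show ?thesis by (simp add: t_def th_def)
qed

text \<open>For infinite \<open>q\<close> the power of \<open>r\<close> in
  \<open>shell_test_lower\<close> is \<open>0\<close>: at every \<open>x\<close> in the unit ball
  each of \<open>N\<close> dyadic boxes contributes at least \<open>c1\<close>. The image thus grows
  linearly in \<open>N\<close>, the norm of the test function only like a constant times
  \<open>N powr (1 / p I)\<close>.\<close>

lemma exponent_finite_necessary:
  fixes lam :: real
  assumes est: "nonneg_estimate TYPE('a::euclidean_space) m lam p top C" and m: "1 \<le> m" and lam: "0 \<le> lam"
    and p: "\<And>i. i \<in> {1..m} \<Longrightarrow> 0 < p i"
    and I: "1 \<le> I" "I \<le> m" and tail: "\<And>i. I < i \<Longrightarrow> i \<le> m \<Longrightarrow> p i = 1"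
  shows "1 \<le> recip (p I)"
proof -
  let ?n = "real DIM('a)"
  define V where "V = unit_ball_vol ?n"
  have V: "0 < V" by (simp add: V_def)
  have nV: "0 < ?n * V" using V by simp
  define e where "e = - (?n * (\<Sum>i=1..I. recip (p i)))"
  have e: "e \<le> 0" by (simp add: e_def sum_nonneg)
  define th where "th = recip (p I)"
  have th: "0 \<le> th" by (simp add: th_def)
  have ex: "?n * real I + e - lam = 0"
    using shell_exponent[OF scaling_necessary[OF est m lam p] I(2) tail] by (simp add: e_def)
  define K where "K = V powr (\<Sum>i\<in>{1..m} - {I}. recip (p i))"
  define c1 where "c1 = V ^ m * 2 powr e * (3 * real m) powr - lam"
  have c1: "0 < c1" using V m by (simp add: c1_def)
  have C: "0 \<le> C" using est by (simp add: nonneg_estimate_def)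
  have K: "0 \<le> K" by (simp add: K_def)
  have main: "c1 * real N \<le> C * (K * (?n * V * ln (2 ^ N)) powr th)" if N: "1 \<le> N" for N :: nat
  proof -
    define R where "R = (2::real) ^ N"
    have R: "1 < R" using N by (simp add: R_def one_less_power)
    \<comment> \<open>The factor \<open>V powr recip top\<close> is \<open>1\<close>; it matches the
      form of \<open>Lp_norm_ge_on_set\<close>.\<close>
    have "c1 * real N * V powr recip top \<le> C * (K * (?n * V * ln R) powr th)"
    proof (rule nonneg_estimateD[OF est])
      show "shell_test I m e R (0::'a) \<in> borel_measurable (lborel_on {1..m})" by (rule shell_test_measurable[OF I(2) order_refl]) simp
      show "0 \<le> shell_test I m e R (0::'a) y" for y by (rule shell_test_nonneg)
      show "iterated_norm p m (\<lambda>y. ennreal (shell_test I m e R (0::'a) y)) (\<lambda>_. undefined) = ennreal (K * (?n * V * ln R) powr th)"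
        using iterated_norm_shell_test[OF p R I(2), where c="0::'a" and y="\<lambda>_. undefined"] I(1)
        by (simp add: e_def K_def V_def th_def)
      show "ennreal (c1 * real N * V powr recip top) \<le> Lp_norm lebesgue top (J_nn m lam (\<lambda>y. ennreal (shell_test I m e R (0::'a) y)))"
      proof (rule Lp_norm_ge_on_set)
        show "emeasure lborel (ball (0::'a) 1) = ennreal V" by (simp add: emeasure_ball V_def)
        fix x :: 'a assume x: "x \<in> ball 0 1"
        define D where "D k = PiE {1..m} (shell_box I (2 ^ k) (0::'a))" for k :: nat
        let ?f = "\<lambda>y. ennreal (shell_test I m e R 0 y) * kern lam (\<Sum>i=1..m. norm (x - y i))"
        have [measurable]: "shell_test I m e R (0::'a) \<in> borel_measurable (lborel_on {1..m})" by (rule shell_test_measurable[OF I(2) order_refl]) simp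
        have D_sets [measurable]: "D k \<in> sets (lborel_on {1..m})" for k
          unfolding D_def by (intro sets_PiM_I_finite) auto
        have D_norm: "2 ^ k \<le> norm (y I) \<and> norm (y I) < 2 ^ Suc k" if "y \<in> D k" for y k
        proof -
          have "y I \<in> shell_box I (2 ^ k) 0 I" 
            using PiE_mem[OF that[unfolded D_def], of I] I by simp
          then show ?thesis by (simp add: shell_box_def)
        qed
        have "D k \<inter> D l = {}" if "k < l" for k l
        proof -
          have "(2::real) ^ Suc k \<le> 2 ^ l" using that by (intro power_increasing) auto
          then show ?thesis using D_norm[of _ k] D_norm[of _ l] by fastforce
        qed
        \<comment> \<open>Boxes of different scales are separated by the size of \<open>y I\<close>,
          so their contributions add up.\<close>
        then have disj: "disjoint_family_on D {..<N}"
          unfolding disjoint_family_on_def by (metis Int_commute linorder_neqE_nat)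
        have lower: "ennreal c1 \<le> (\<integral>\<^sup>+y. ?f y * indicator (D k) y \<partial>lborel_on {1..m})" if k: "k < N" for k
        proof -
          have k1: "(1::real) \<le> 2 ^ k" by simp
          have "ennreal (c1 * (2 ^ k) powr (?n * I + e - lam)) \<le> (\<integral>\<^sup>+y. ?f y * indicator (D k) y \<partial>lborel_on {1..m})"
            unfolding c1_def V_def D_def
          proof (rule shell_test_lower[OF I(2) k1 _ e lam])
            have "(2::real) ^ Suc k \<le> 2 ^ N" using k by (intro power_increasing) auto
            then show "2 * 2 ^ k \<le> R" by (simp add: R_def)
            show "0 < 3 * real m" using m by simp
            show "(\<Sum>i=1..m. norm (x - y i)) \<le> 3 * real m * 2 ^ k" if y: "y \<in> PiE {1..m} (shell_box I (2 ^ k) 0)" for y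
            proof (rule sum_norm_diff_le[where c=0])
              show "norm (y i - 0) \<le> 2 * 2 ^ k" if "i \<in> {1..m}" for i
                by (rule norm_diff_le_of_shell_box[OF y k1 that])
              have "norm x < 1" using x by simp
              then show "norm (x - 0) \<le> 2 ^ k" using k1 unfolding diff_zero by linarith
            qed
          qed (auto intro: sum_nonneg)
          then show ?thesis by (simp add: ex)
        qed
        have "ennreal (c1 * real N) = (\<Sum>k<N. ennreal c1)"
          by (simp add: ennreal_of_nat_eq_real_of_nat ennreal_mult'' mult.commute)
        also have "\<dots> \<le> (\<Sum>k<N. \<integral>\<^sup>+y. ?f y * indicator (D k) y \<partial>lborel_on {1..m})"
          using lower by (intro sum_mono) auto
        also have "\<dots> = (\<integral>\<^sup>+y. (\<Sum>k<N. ?f y * indicator (D k) y) \<partial>lborel_on {1..m})"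
          by (rule nn_integral_sum[symmetric]) measurable
        also have "\<dots> \<le> (\<integral>\<^sup>+y. ?f y \<partial>lborel_on {1..m})"
        proof (rule nn_integral_mono)
          fix y
          have "(\<Sum>k<N. ?f y * indicator (D k) y) = ?f y * indicator (\<Union>k<N. D k) y"
            by (simp add: sum_distrib_left[symmetric] indicator_UN_disjoint[OF _ disj])
          also have "\<dots> \<le> ?f y" by (auto split: split_indicator)
          finally show "(\<Sum>k<N. ?f y * indicator (D k) y) \<le> ?f y" .
        qed
        finally show "ennreal (c1 * real N) \<le> (\<integral>\<^sup>+y. ?f y \<partial>lborel_on {1..m})" .
      qed (use V c1 in auto)
    qed (use K in simp)
    then show ?thesis using V by (simp add: R_def)
  qed
  have "1 \<le> th"
  proof (rule powr_growth_le[OF c1])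
    show "0 \<le> C * K * (2 * (?n * V)) powr th" using C K by simp
    fix u :: real assume u: "1 \<le> u"
    \<comment> \<open>Rounding up loses at most a factor \<open>2\<close> for
      \<open>u \<ge> 1\<close> and reduces the comparison of growth in \<open>N\<close> to one in a
      real variable.\<close>
    define N where "N = nat \<lceil>u\<rceil>"
    have N: "u \<le> real N" "real N \<le> 2 * u" "1 \<le> N"
      using u by (simp_all add: N_def) linarith+
    have "c1 * u \<le> c1 * real N" using N c1 by (intro mult_left_mono) auto
    also have "\<dots> \<le> C * (K * (?n * V * ln (2 ^ N)) powr th)" by (rule main[OF N(3)])
    also have "\<dots> \<le> C * (K * (2 * (?n * V) * u) powr th)"
    proof -
      have ln0: "0 \<le> ln ((2::real) ^ N)" by simp
      have "ln ((2::real) ^ N) = real N * ln 2" by (simp add: ln_realpow)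
      also have "\<dots> \<le> real N * 1" using ln_2_less_1 by (intro mult_left_mono) auto
      finally have "ln ((2::real) ^ N) \<le> 2 * u" using N by simp
      from mult_left_mono[OF this, of "?n * V"] have "?n * V * ln (2 ^ N) \<le> 2 * (?n * V) * u"
        using nV by (simp add: ac_simps)
      moreover have "0 \<le> ?n * V * ln (2 ^ N)" using V ln0 by (intro mult_nonneg_nonneg) auto
      ultimately have "(?n * V * ln (2 ^ N)) powr th \<le> (2 * (?n * V) * u) powr th"
        using th by (intro powr_mono2)
      then show ?thesis using C K by (intro mult_left_mono)
    qed
    also have "(2 * (?n * V) * u) powr th = (2 * (?n * V)) powr th * u powr th"
      by (rule powr_mult)
    finally show "c1 * u powr 1 \<le> C * K * (2 * (?n * V)) powr th * u powr th"
      using u by (simp add: mult.assoc)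
  qed
  then show ?thesis by (simp add: th_def)
qed

text \<open>
  Here the centre of the test function is the last variable, spread over a ball of radius \<open>2 * R\<close>.
\<close>

lemma endpoint_necessary:
  fixes lam :: real
  assumes est: "nonneg_estimate TYPE('a::euclidean_space) (Suc m) lam p q C" and lam: "0 \<le> lam"
    and p: "\<And>i. i \<in> {1..Suc m} \<Longrightarrow> 0 < p i" and q: "0 < q"
    and I: "I \<le> m" and tail: "\<And>i. I < i \<Longrightarrow> i \<le> m \<Longrightarrow> p i = 1"
    and pq: "recip (p (Suc m)) = recip q"
  shows "1 \<le> (if I = 0 then 0 else recip (p I))"
proof -
  let ?n = "real DIM('a)" and ?m = "Suc m"
  interpret product_sigma_finite "\<lambda>_::nat. lborel :: 'a measure" by (rule product_sigma_finite_lborel)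
  define V where "V = unit_ball_vol ?n"
  have V: "0 < V" by (simp add: V_def)
  have nV: "0 < ?n * V" using V by simp
  define e where "e = - (?n * (\<Sum>i=1..I. recip (p i)))"
  have e: "e \<le> 0" by (simp add: e_def sum_nonneg)
  define t where "t = recip q"
  define th where "th = (if I = 0 then 0 else recip (p I))"
  have th: "0 \<le> th" by (simp add: th_def)
  have ex: "?n * real I + e - lam = - ?n"
  proof -
    have "?n * (?m + t - ((\<Sum>i=1..m. recip (p i)) + t)) = lam"
      using scaling_necessary[OF est _ lam p q] pq by (simp add: t_def)
    \<comment> \<open>Without its last variable, the problem obeys the scaling relation with
      \<open>lam - n\<close> in place of \<open>lam\<close> and infinite \<open>q\<close>. This lets
      \<open>shell_exponent\<close> be applied to the first \<open>m\<close> variables.\<close>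
    then have "?n * (real m + recip top - (\<Sum>i=1..m. recip (p i))) = lam - ?n"
      by (simp add: algebra_simps)
    from shell_exponent[OF this I tail] show ?thesis by (simp add: e_def)
  qed
  define K where "K = V powr (\<Sum>i\<in>{1..m} - {I}. recip (p i))"
  \<comment> \<open>\<open>V ^ m\<close> belongs to the \<open>m\<close> coordinates of the box, but
    the distances are bounded by \<open>3 * Suc m * r\<close> because the centre itself contributes
    \<open>r\<close>.\<close>
  define c1 where "c1 = V ^ m * 2 powr e * (3 * real ?m) powr - lam"
  have c1: "0 < c1" using V by (simp add: c1_def)
  have C: "0 \<le> C" using est by (simp add: nonneg_estimate_def)
  have K: "0 \<le> K" by (simp add: K_def)
  have "1 \<le> th"
  proof (rule powr_growth_le)
    show "0 < c1 * (?n * V)" using c1 nV by (rule mult_pos_pos)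
    show "0 \<le> C * K * (2 * (?n * V)) powr th * (2 ^ DIM('a)) powr t" using C K by simp
    fix u :: real assume u: "1 \<le> u"
    define R where "R = 2 * exp u"
    have "1 < exp u" using u by simp
    then have R: "1 < R" "1 < exp u" unfolding R_def by linarith+
    have "ln R = ln 2 + u" by (simp add: R_def ln_mult_pos)
    then have lnR: "ln R \<le> 2 * u" "0 < ln R"
      using u ln_2_less_1 ln_gt_zero[OF R(1)] by linarith+
    define B where "B = K * (?n * V * ln R) powr th"
    have B: "0 \<le> B" using K by (simp add: B_def)
    \<comment> \<open>The radius \<open>2 * R\<close> admits every centre \<open>z\<close> with
      \<open>norm (z - x) < exp u\<close> when \<open>norm x < R\<close>, since \<open>exp u\<close>
      is \<open>R / 2\<close>.\<close>
    define F where "F y = (if norm (y ?m) < 2 * R then shell_test I m e R (y ?m) y else 0)" for y :: "nat \<Rightarrow> 'a"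
    have F_upd: "F (y(?m := z)) = (if norm z < 2 * R then shell_test I m e R z y else 0)" for y z
      unfolding F_def shell_test_def using I by (intro if_cong) auto
    have ins: "{1..?m} = insert ?m {1..m}" by auto
    have F_meas: "F \<in> borel_measurable (lborel_on {1..?m})"
    proof -
      have comp: "(\<lambda>y. y ?m) \<in> borel_measurable (lborel_on {1..?m} :: (nat \<Rightarrow> 'a) measure)"
        using measurable_component_singleton[of ?m "{1..?m}" "\<lambda>_. lborel :: 'a measure"]
        by (simp only: measurable_cong_sets[OF refl sets_lborel]) simp
      have "{1..m} \<subseteq> {1..?m}" by auto
      from shell_test_measurable[OF I this comp]
      have "(\<lambda>y. shell_test I m e R (y ?m) y) \<in> borel_measurable (lborel_on {1..?m} :: (nat \<Rightarrow> 'a) measure)" .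
      then show ?thesis unfolding F_def using comp by measurable
    qed
    define v where "v = V * R ^ DIM('a)"
    have v: "0 < v" using V R by (simp add: v_def)
    have v2: "V * (2 * R) ^ DIM('a) = 2 ^ DIM('a) * v" by (simp add: v_def power_mult_distrib)
    \<comment> \<open>Fixing the centre \<open>z\<close> leaves
      \<open>c1 * norm (z - x) powr - n\<close>, whose integral over the annulus about
      \<open>x\<close> is linear in \<open>u\<close>. As the last exponent has the same reciprocal
      as \<open>q\<close>, the volume enters as \<open>v powr t\<close> on both sides and
      cancels.\<close>
    have "c1 * (?n * V * u) * v powr t \<le> C * (B * (2 ^ DIM('a) * v) powr t)"
    proof (rule nonneg_estimateD[OF est F_meas])
      show "0 \<le> F y" for y by (simp add: F_def shell_test_nonneg)
      show "iterated_norm p ?m (\<lambda>y. ennreal (F y)) (\<lambda>_. undefined) = ennreal (B * (2 ^ DIM('a) * v) powr t)"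
      proof -
        have "iterated_norm p m (\<lambda>y. ennreal (F y)) ((\<lambda>_. undefined)(?m := z)) = ennreal (if z \<in> ball 0 (2 * R) then B else 0)" for z
        proof (cases "norm z < 2 * R")
          case True
          have "iterated_norm p m (\<lambda>y. ennreal (F y)) ((\<lambda>_. undefined)(?m := z)) =
            iterated_norm p m (\<lambda>y. ennreal (shell_test I m e R z y)) ((\<lambda>_. undefined)(?m := z))"
            by (rule iterated_norm_cong) (use True in \<open>simp add: F_def\<close>)
          also have "\<dots> = ennreal B"
            unfolding e_def B_def K_def V_def th_def by (rule iterated_norm_shell_test[OF _ R(1) I]) (use p in auto)
          finally show ?thesis using True by simp
        next
          case False
          have "iterated_norm p m (\<lambda>y. ennreal (F y)) ((\<lambda>_. undefined)(?m := z)) =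
            iterated_norm p m (\<lambda>y. 0) ((\<lambda>_. undefined)(?m := z))"
            by (rule iterated_norm_cong) (use False in \<open>simp add: F_def\<close>)
          also have "\<dots> = 0" by (rule iterated_norm_zero) (use p in auto)
          finally show ?thesis using False by simp
        qed
        then have "iterated_norm p ?m (\<lambda>y. ennreal (F y)) (\<lambda>_. undefined) =
          Lp_norm lebesgue (p ?m) (\<lambda>z. ennreal (if z \<in> ball (0::'a) (2 * R) then B else 0))" by simp
        also have "\<dots> = ennreal (B * (V * (2 * R) ^ DIM('a)) powr recip (p ?m))"
          unfolding V_def using R B p V by (intro Lp_norm_If emeasure_ball) auto
        finally show ?thesis unfolding v2 pq t_def .
      qed
      show "ennreal (c1 * (?n * V * u) * v powr t) \<le> Lp_norm lebesgue q (\<lambda>x. J_nn ?m lam (\<lambda>y. ennreal (F y)) x)"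
        unfolding t_def
      proof (rule Lp_norm_ge_on_set[OF _ _ v _ q])
        show "emeasure lborel (ball (0::'a) R) = ennreal v" using R by (simp add: emeasure_ball v_def V_def)
        fix x :: 'a assume x: "x \<in> ball 0 R"
        let ?H = "\<lambda>z. \<integral>\<^sup>+y. ennreal (F (y(?m := z))) * kern lam (\<Sum>i\<in>insert ?m {1..m}. norm (x - (y(?m := z)) i)) \<partial>lborel_on {1..m}"
        have "ennreal (c1 * (?n * V * u)) = ennreal c1 * ennreal (?n * V * ln (exp u / 1))"
          using c1 by (simp add: ennreal_mult')
        also have "\<dots> = (\<integral>\<^sup>+z. ennreal c1 * (kern ?n (norm (z - x)) * indicator {z. 1 \<le> norm (z - x) \<and> norm (z - x) < exp u} z) \<partial>lborel)"
          using R unfolding V_def by (subst nn_integral_cmult) (auto simp: nn_integral_kern_annulus simp del: ln_exp)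
        also have "\<dots> \<le> (\<integral>\<^sup>+z. ?H z \<partial>lborel)"
        proof (rule nn_integral_mono)
          fix z :: 'a
          show "ennreal c1 * (kern ?n (norm (z - x)) * indicator {z. 1 \<le> norm (z - x) \<and> norm (z - x) < exp u} z)
            \<le> ?H z"
          proof (cases "1 \<le> norm (z - x) \<and> norm (z - x) < exp u")
            case True
            define r where "r = norm (x - z)"
            have r: "1 \<le> r" "r < exp u" using True by (simp_all add: r_def norm_minus_commute)
            have "norm z \<le> norm x + norm (z - x)" using norm_triangle_sub[of z x] by simp
            moreover have "norm x < R" using x by simp
            ultimately have z: "norm z < 2 * R" using True R unfolding R_def by linarith
            let ?D = "PiE {1..m} (shell_box I r z)"
            have sum_eq: "(\<Sum>i\<in>insert ?m {1..m}. norm (x - (y(?m := z)) i)) = r + (\<Sum>i=1..m. norm (x - y i))" for y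
              by (subst sum.insert) (auto simp: r_def intro!: sum.cong)
            have "ennreal (c1 * r powr (?n * I + e - lam)) \<le>
              (\<integral>\<^sup>+y. ennreal (shell_test I m e R z y) * kern lam (r + (\<Sum>i=1..m. norm (x - y i))) * indicator ?D y \<partial>lborel_on {1..m})"
              unfolding c1_def V_def
            proof (rule shell_test_lower[OF I r(1) _ e lam])
              show "2 * r \<le> R" using r by (simp add: R_def)
              show "r + (\<Sum>i=1..m. norm (x - y i)) \<le> 3 * real ?m * r" if y: "y \<in> ?D" for y
              proof -
                have "(\<Sum>i=1..m. norm (x - y i)) \<le> 3 * real m * r"
                proof (rule sum_norm_diff_le[where c=z])
                  show "norm (x - z) \<le> r" by (simp add: r_def)
                  show "norm (y i - z) \<le> 2 * r" if "i \<in> {1..m}" for i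
                    by (rule norm_diff_le_of_shell_box[OF y r(1) that])
                qed
                then show ?thesis using r by (simp add: algebra_simps)
              qed
              show "0 \<le> r + (\<Sum>i=1..m. norm (x - y i))" for y
                using r by (intro add_nonneg_nonneg sum_nonneg) auto
            qed simp
            also have "\<dots> \<le> ?H z"
              unfolding sum_eq F_upd using z by (intro nn_integral_mono) (auto split: split_indicator)
            also have "ennreal (c1 * r powr (?n * I + e - lam)) = ennreal c1 * kern ?n (norm (z - x))"
            proof -
              have nz: "norm (z - x) = r" unfolding r_def by (rule norm_minus_commute)
              have "0 < r" using r by linarith
              then show ?thesis unfolding ex nz kern_pos[OF \<open>0 < r\<close>] using c1 by (intro ennreal_mult') linarith
            qed
            finally have fin: "ennreal c1 * kern ?n (norm (z - x)) \<le> ?H z" .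
            have "indicator {z. 1 \<le> norm (z - x) \<and> norm (z - x) < exp u} z = (1 :: ennreal)" using True by simp
            then show ?thesis using fin by (simp only: mult_1_right)
          qed simp
        qed
        also have "\<dots> = (J_nn ?m lam (\<lambda>y. ennreal (F y)) x)"
        proof -
          have [measurable]: "F \<in> borel_measurable (lborel_on (insert ?m {1..m}))" using F_meas unfolding ins .
          have "(\<lambda>y. \<Sum>i\<in>A. norm (x - y i)) \<in> borel_measurable (lborel_on A)" for A :: "nat set"
            by measurable
          then have [measurable]: "(\<lambda>y. \<Sum>i\<in>insert ?m {1..m}. norm (x - y i)) \<in> borel_measurable (lborel_on (insert ?m {1..m}))" .
          have "(\<lambda>y. ennreal (F y) * kern lam (\<Sum>i\<in>insert ?m {1..m}. norm (x - y i))) \<in> borel_measurable (lborel_on (insert ?m {1..m}))"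
            by (intro borel_measurable_times_ennreal measurable_compose_rev[OF measurable_ennreal] kern_measurable) fact+
          then show ?thesis unfolding ins by (intro product_nn_integral_insert_rev[symmetric]) auto
        qed
        finally show "ennreal (c1 * (?n * V * u)) \<le> (J_nn ?m lam (\<lambda>y. ennreal (F y)) x)" .
      qed (use c1 nV u in auto)
    qed (use B in simp)
    also have "C * (B * (2 ^ DIM('a) * v) powr t) = C * B * (2 ^ DIM('a)) powr t * v powr t"
      by (simp add: powr_mult)
    finally have "c1 * (?n * V * u) \<le> C * B * (2 ^ DIM('a)) powr t"
      using v by simp
    also have "\<dots> \<le> C * (K * (2 * (?n * V) * u) powr th) * (2 ^ DIM('a)) powr t"
    proof -
      have "0 \<le> ?n * V * ln R" using V lnR by (intro mult_nonneg_nonneg) auto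
      moreover have "?n * V * ln R \<le> 2 * (?n * V) * u"
        using mult_left_mono[OF lnR(1), of "?n * V"] nV by linarith
      ultimately have "(?n * V * ln R) powr th \<le> (2 * (?n * V) * u) powr th"
        using th by (intro powr_mono2)
      then show ?thesis unfolding B_def using C K by (intro mult_left_mono mult_right_mono) auto
    qed
    also have "(2 * (?n * V) * u) powr th = (2 * (?n * V)) powr th * u powr th"
      by (rule powr_mult)
    finally show "c1 * (?n * V) * u powr 1 \<le> C * K * (2 * (?n * V)) powr th * (2 ^ DIM('a)) powr t * u powr th"
      using u by (simp add: ac_simps)
  qed
  then show ?thesis by (simp add: th_def)
qed

section \<open>From reciprocals back to exponents in [0, \<infinity>]\<close>

lemma one_divide_ennreal_enn2real: "0 < p \<Longrightarrow> 1 / p = ennreal (recip p)"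
  by (cases p) (auto simp: divide_ennreal ennreal_1[symmetric] simp del: ennreal_1)

lemma enn2real_one_divide_less_one: "1 < p \<Longrightarrow> recip p < 1"
proof (cases "p = top")
  case False
  assume "1 < p"
  then obtain r where "p = ennreal r" "1 < r" using False by (rule ennreal_gt_oneE)
  then show ?thesis using \<open>1 < p\<close> by (simp add: enn2real_one_divide)
qed simp

lemma enn2real_one_divide_le_iff:
  assumes "0 < p" "0 < q" "q \<noteq> top"
  shows "recip q \<le> recip p \<longleftrightarrow> p \<le> q"
proof -
  obtain s where s: "q = ennreal s" "0 < s" using assms by (cases q) auto
  show ?thesis
  proof (cases p)
    case (real r)
    then have "0 < r" using assms by simp
    then show ?thesis using s real assms by (simp add: enn2real_one_divide) (auto simp: field_simps)
  next
    case top
    then show ?thesis using s assms by (simp add: enn2real_one_divide top_unique)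
  qed
qed

text \<open>All terms are finite because the exponents are positive, and
  \<open>lam \<le> m * n\<close> keeps the last one from being truncated to \<open>0\<close>; so the
  equation in \<open>ennreal\<close> is one between real numbers.\<close>

lemma exponent_condition_iff:
  fixes lam :: real
  assumes "0 < n" "lam \<le> m * n" "\<And>i. i \<in> A \<Longrightarrow> 0 < p i" "0 < q"
  shows "(\<Sum>i\<in>A. 1 / p i) = 1 / q + ennreal ((m * n - lam) / n) \<longleftrightarrow>
    n * (m + recip q - (\<Sum>i\<in>A. recip (p i))) = lam"
proof -
  have "(\<Sum>i\<in>A. 1 / p i) = (\<Sum>i\<in>A. ennreal (recip (p i)))"
    using assms(3) by (intro sum.cong refl one_divide_ennreal_enn2real)
  also have "\<dots> = ennreal (\<Sum>i\<in>A. recip (p i))" by (intro sum_ennreal) simp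
  finally have 1: "(\<Sum>i\<in>A. 1 / p i) = ennreal (\<Sum>i\<in>A. recip (p i))" .
  have 2: "1 / q + ennreal ((m * n - lam) / n) = ennreal (recip q + (m * n - lam) / n)"
    using assms by (subst one_divide_ennreal_enn2real) (simp_all add: ennreal_plus)
  have "0 \<le> recip q + (m * n - lam) / n" using assms by simp
  then have "ennreal (\<Sum>i\<in>A. recip (p i)) = ennreal (recip q + (m * n - lam) / n) \<longleftrightarrow>
    (\<Sum>i\<in>A. recip (p i)) = recip q + (m * n - lam) / n"
    by (intro ennreal_inj sum_nonneg) auto
  also have "\<dots> \<longleftrightarrow> n * (m + recip q - (\<Sum>i\<in>A. recip (p i))) = lam"
    using assms(1) by (auto simp: field_simps)
  finally show ?thesis unfolding 1 2 .
qed

text \<open>Among the first \<open>m - 1\<close> exponents let \<open>I\<close> be the last one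
  above \<open>1\<close>. If \<open>p m = q\<close>, the endpoint test would give
  \<open>1 \<le> 1 / p I < 1\<close>, or \<open>1 \<le> 0\<close> if there is no such index.\<close>

lemma last_exponent_neq:
  fixes lam :: real
  assumes est: "nonneg_estimate TYPE('a::euclidean_space) m lam p q C" and "1 \<le> m" and lam: "0 \<le> lam"
    and p: "\<And>i. i \<in> {1..m} \<Longrightarrow> 1 \<le> p i" and q: "0 < q"
  shows "p m \<noteq> q"
proof
  assume pq: "p m = q"
  obtain k where k: "m = Suc k" using \<open>1 \<le> m\<close> by (cases m) auto
  define S where "S = {i \<in> {1..k}. 1 < p i}"
  \<comment> \<open>\<open>Max {}\<close> has no specified value; \<open>0\<close> is the index for
    which \<open>shell_test\<close> has no shell.\<close>
  define I where "I = (if S = {} then 0 else Max S)"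
  have "finite S" by (simp add: S_def)
  have I_S: "I \<in> S" if "I \<noteq> 0"
    using that \<open>finite S\<close> Max_in[of S] by (auto simp: I_def split: if_splits)
  have I_k: "I \<le> k" using I_S by (cases "I = 0") (auto simp: S_def)
  have tail: "p i = 1" if i: "I < i" "i \<le> k" for i
  proof (rule ccontr)
    assume "p i \<noteq> 1"
    then have "i \<in> S" using i p[of i] k by (auto simp: S_def less_le)
    then have "i \<le> I" using \<open>finite S\<close> by (auto simp: I_def)
    then show False using i by simp
  qed
  have p0: "0 < p i" if "i \<in> {1..Suc k}" for i
    using p[of i] that k by (auto intro: order_less_le_trans[OF zero_less_one])
  have pq': "recip (p (Suc k)) = recip q" using pq k by simp
  have "1 \<le> (if I = 0 then 0 else recip (p I))"
    by (rule endpoint_necessary[OF est[unfolded k] lam p0 q I_k tail pq'])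
  then have "I \<noteq> 0" "1 \<le> recip (p I)" by (auto split: if_splits)
  moreover have "recip (p I) < 1"
    using I_S[OF \<open>I \<noteq> 0\<close>] by (intro enn2real_one_divide_less_one) (simp add: S_def)
  ultimately show False by simp
qed

theorem corollary1p3:
  fixes m :: nat and lam :: real and p :: "nat \<Rightarrow> ennreal" and q :: ennreal
  assumes "1 \<le> m"
    and "0 < lam" and "lam < real (m * CARD('n::finite))"
    and "\<And>i. i \<in> {1..m} \<Longrightarrow> 1 \<le> p i"
    and "0 < q"
  shows "J_norm_estimate TYPE(real ^ 'n) m lam p q \<longleftrightarrow>
    (\<Sum>i=1..m. 1 / p i) = 1 / q + ennreal ((real (m * CARD('n)) - lam) / real CARD('n)) \<and>
    (\<exists>i\<in>{1..m}. 1 < p i \<and> p i < \<infinity>) \<and>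
    (let i0 = Max {i \<in> {1..m}. 1 < p i} in
      if i0 < m then p i0 \<le> q \<and> q < \<infinity> else p m < q \<and> q < \<infinity>)"
proof -
  let ?n = "real CARD('n)" and ?S = "{i \<in> {1..m}. 1 < p i}"
  define i0 where "i0 = Max ?S"
  have n: "0 < ?n" by simp
  have DIM: "DIM(real ^ 'n) = CARD('n)" by simp
  have lam: "0 \<le> lam" using assms(2) by simp
  have p0: "0 < p i" if "i \<in> {1..m}" for i
    using assms(4)[OF that] by (rule order_less_le_trans[OF zero_less_one])
  have i0: "i0 \<in> {1..m}" "1 < p i0" if "?S \<noteq> {}"
    using Max_in[of ?S] that by (auto simp: i0_def)
  \<comment> \<open>This also holds for empty \<open>?S\<close>, where \<open>i0\<close> is
    unspecified: an index with \<open>p i \<noteq> 1\<close> would be an element of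
    \<open>?S\<close>.\<close>
  have tail: "p i = 1" if "i0 < i" "i \<le> m" for i
  proof (rule ccontr)
    assume "p i \<noteq> 1"
    show False
    proof (cases "1 \<le> i")
      case True
      then have "1 < p i" using assms(4)[of i] that \<open>p i \<noteq> 1\<close> by (simp add: less_le)
      then have "i \<le> i0" unfolding i0_def using True that by (intro Max_ge) auto
      then show False using that by simp
    qed (use that in simp)
  qed
  have cond_i: "(\<Sum>i=1..m. 1 / p i) = 1 / q + ennreal ((real (m * CARD('n)) - lam) / ?n) \<longleftrightarrow>
    ?n * (m + recip q - (\<Sum>i=1..m. recip (p i))) = lam"
    using exponent_condition_iff[OF n, of lam "real m" "{1..m}" p q] assms p0 by simp
  show ?thesis
  proof
    assume "J_norm_estimate TYPE(real ^ 'n) m lam p q"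
    from J_norm_estimate_nonneg[OF this assms(1)]
    obtain C where est: "nonneg_estimate TYPE(real ^ 'n) m lam p q C" ..
    have scal: "?n * (m + recip q - (\<Sum>i=1..m. recip (p i))) = lam"
      using scaling_necessary[OF est assms(1) lam p0 assms(5)] by simp
    have S: "?S \<noteq> {}"
    proof
      assume "?S = {}"
      then have one: "p i = 1" if "i \<in> {1..m}" for i
        using assms(4)[OF that] that by (auto simp: less_le)
      \<comment> \<open>With no shell the test function has a norm independent of \<open>R\<close>,
        so \<open>1 / q\<close> must vanish, and the scaling relation collapses to
        \<open>lam = 0\<close>.\<close>
      then have "recip q \<le> 0"
        using exponent_le_necessary[OF est assms(1) lam p0 assms(5), of 0] by auto
      then have "recip q = 0" by (simp add: antisym)
      moreover have "(\<Sum>i=1..m. recip (p i)) = m" using one by simp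
      ultimately show False using scal assms(2) by simp
    qed
    note i0 = i0[OF S]
    have I: "1 \<le> i0" "i0 \<le> m" using i0 by auto
    have q_fin: "q \<noteq> top"
    proof
      assume "q = top"
      then have "1 \<le> recip (p i0)"
        using exponent_finite_necessary[OF _ assms(1) lam p0 I tail] est by simp
      then show False using enn2real_one_divide_less_one[OF i0(2)] by simp
    qed
    have "recip q \<le> recip (p i0)"
      using exponent_le_necessary[OF est assms(1) lam p0 assms(5) I(2) tail] I(1) by simp
    then have le: "p i0 \<le> q"
      using enn2real_one_divide_le_iff[OF p0[OF i0(1)] assms(5) q_fin] by simp
    have neq: "p m \<noteq> q"
      by (rule last_exponent_neq[OF est assms(1) lam assms(4) assms(5)])
    have "p i0 < \<infinity>" "q < \<infinity>" using le q_fin by (auto simp: less_top[symmetric] top_unique)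
    moreover have "p m < q" if "\<not> i0 < m"
      using that I(2) le neq by (simp add: order.strict_iff_order)
    ultimately show "(\<Sum>i=1..m. 1 / p i) = 1 / q + ennreal ((real (m * CARD('n)) - lam) / ?n) \<and>
      (\<exists>i\<in>{1..m}. 1 < p i \<and> p i < \<infinity>) \<and>
      (let i0 = Max ?S in if i0 < m then p i0 \<le> q \<and> q < \<infinity> else p m < q \<and> q < \<infinity>)"
      unfolding cond_i i0_def[symmetric] Let_def using scal i0 le by auto
  next
    assume R: "(\<Sum>i=1..m. 1 / p i) = 1 / q + ennreal ((real (m * CARD('n)) - lam) / ?n) \<and>
      (\<exists>i\<in>{1..m}. 1 < p i \<and> p i < \<infinity>) \<and>
      (let i0 = Max ?S in if i0 < m then p i0 \<le> q \<and> q < \<infinity> else p m < q \<and> q < \<infinity>)"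
    then have "?S \<noteq> {}" by auto
    note i0 = i0[OF this]
    have scal: "?n * (m + recip q - (\<Sum>i=1..m. recip (p i))) = lam"
      using R cond_i by simp
    have ii: "if i0 < m then p i0 \<le> q \<and> q < \<infinity> else p m < q \<and> q < \<infinity>"
      using R[THEN conjunct2, THEN conjunct2] unfolding i0_def Let_def .
    then have q_fin: "q \<noteq> top" by (auto split: if_splits)
    have le: "p i0 \<le> q" and less: "i0 = m \<Longrightarrow> p i0 < q"
      using ii i0(1) by (auto split: if_splits)
    have p_fin: "p i0 \<noteq> top" using le q_fin by (auto simp: top_unique)
    have scal': "DIM(real ^ 'n) * (\<Sum>i=1..m. 1 - recip (p i)) = lam - DIM(real ^ 'n) / enn2real q"
      using scal unfolding DIM by (simp add: sum_subtractf algebra_simps enn2real_one_divide[OF assms(5)])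
    have le': "enn2real (p i0) \<le> enn2real q" using le q_fin by (intro enn2real_mono) (auto simp: less_top)
    have less': "enn2real (p i0) < enn2real q" if "i0 = m"
      using less[OF that] p_fin q_fin by (cases "p i0"; cases q) (auto simp: ennreal_less_iff)
    have "\<exists>C\<ge>0. \<forall>F. F \<in> borel_measurable (lborel_on {1..m} :: (nat \<Rightarrow> real ^ 'n) measure) \<longrightarrow>
      Lpow (enn2real q) (J_nn m lam F) ennpowr (1 / enn2real q)
      \<le> ennreal C * iterated_norm p m F (\<lambda>_. undefined)"
      by (rule mixed_norm_bound) (fact assms(4) i0 p_fin tail le' less' scal')+
    then obtain C where "0 \<le> C" "\<And>F. F \<in> borel_measurable (lborel_on {1..m} :: (nat \<Rightarrow> real ^ 'n) measure) \<Longrightarrow>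
      Lpow (enn2real q) (J_nn m lam F) ennpowr (1 / enn2real q)
      \<le> ennreal C * iterated_norm p m F (\<lambda>_. undefined)"
      by blast
    then show "J_norm_estimate TYPE(real ^ 'n) m lam p q"
      by (rule J_norm_estimate_if[OF assms(5) q_fin])
  qed
qed

end
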